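(* Let $\Omega\subset\mathbb{R}^d$ ($d\ge2$) be a bounded connected open set with smooth boundary, let $\mathbf{B}\in C^0(\overline\Omega,\mathbb{R}^{n\times d\times n})$ and $k\in\{0,\dots,n\}$. Then $\dim N(\nabla+\mathbf{B}\cdot)=k$ if and only if $\mathbf{B}$ is $k$-conservative.
   Context: $N(\nabla+\mathbf{B}\cdot)$ is the set of $\boldsymbol\mu\in L^2(\Omega,\mathbb{R}^n)$ with $\nabla\boldsymbol\mu+\mathbf{B}\cdot\boldsymbol\mu=0$ in the distributional sense, where $(\nabla\boldsymbol\mu)_{ij}=\partial_j\mu_i$ and $(\mathbf{B}\cdot\boldsymbol\mu)_{ij}=\sum_k\mathbf{B}_{ijk}\mu_k$. For $x,y\in\Omega$ let $\Gamma(x,y)=\{\boldsymbol\gamma\in C^1([0,1],\Omega):\boldsymbol\gamma(0)=x,\ \boldsymbol\gamma(1)=y\}$. For $\boldsymbol\gamma\in\Gamma(x,y)$ define the linear map $R^{\boldsymbol\gamma}_{\mathbf{B}}:\mathbb{R}^n\to\mathbb{R}^n$ by $R^{\boldsymbol\gamma}_{\mathbf{B}}(\mathbf{v})=\boldsymbol\varphi_{\mathbf{v}}(1)$, where $\boldsymbol\varphi_{\mathbf{v}}$ is the unique solution on $[0,1]$ of $\varphi_i'(t)=-\sum_{j,k}\mathbf{B}_{ijk}(\boldsymbol\gamma(t))\varphi_k(t)\gamma_j'(t)$, $\boldsymbol\varphi(0)=\mathbf{v}$. For $x\in\Omega$ let $E^x_{\mathbf{B}}=\{\mathbf{v}\in\mathbb{R}^n:\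 \forall y\in\Omega,\ \forall\boldsymbol\gamma_1,\boldsymbol\gamma_2\in\Gamma(x,y),\ R^{\boldsymbol\gamma_1}_{\mathbf{B}}(\mathbf{v})=R^{\boldsymbol\gamma_2}_{\mathbf{B}}(\mathbf{v})\}$, a vector subspace of $\mathbb{R}^n$. $\mathbf{B}$ is called $k$-conservative if $\dim E^x_{\mathbf{B}}=k$ for all $x\in\Omega$. *)

theory Defs
  imports "HOL-Analysis.Analysis"
begin

definition partial_deriv :: "'d::finite \<Rightarrow> (real^'d \<Rightarrow> real) \<Rightarrow> real^'d \<Rightarrow> real" where
  "partial_deriv j f x = deriv (\<lambda>t. f (x + t *\<^sub>R axis j 1)) 0"

fun iter_partial :: "'d::finite list \<Rightarrow> (real^'d \<Rightarrow> real) \<Rightarrow> real^'d \<Rightarrow> real" where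
  "iter_partial [] f = f"
| "iter_partial (j # js) f = partial_deriv j (iter_partial js f)"

definition Cinf_on :: "(real^'d::finite) set \<Rightarrow> (real^'d \<Rightarrow> real) \<Rightarrow> bool" where
  "Cinf_on S f \<longleftrightarrow>
     (\<forall>js. continuous_on S (iter_partial js f) \<and>
        (\<forall>j. \<forall>x\<in>S. (\<lambda>t. iter_partial js f (x + t *\<^sub>R axis j 1)) differentiable (at 0)))"

definition smooth_boundary :: "(real^'d::finite) set \<Rightarrow> bool" where
  "smooth_boundary \<Omega> \<longleftrightarrow>
     (\<forall>x\<in>frontier \<Omega>. \<exists>r>0. \<exists>\<rho>. Cinf_on (ball x r) \<rho> \<and>
        (\<forall>y\<in>ball x r. \<exists>j. partial_deriv j \<rho> y \<noteq> 0) \<and>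
        \<Omega> \<inter> ball x r = {y\<in>ball x r. \<rho> y < 0})"

text \<open>B x $ i $ j $ k is B_{ijk}(x); i,k index R^n, j indexes R^d.\<close>

definition test_function :: "(real^'d::finite) set \<Rightarrow> (real^'d \<Rightarrow> real) \<Rightarrow> bool" where
  "test_function \<Omega> \<phi> \<longleftrightarrow> Cinf_on UNIV \<phi> \<and>
     compact (closure {x. \<phi> x \<noteq> 0}) \<and> closure {x. \<phi> x \<noteq> 0} \<subseteq> \<Omega>"

definition L2_on :: "(real^'d::finite) set \<Rightarrow> (real^'d \<Rightarrow> real^'n::finite) \<Rightarrow> bool" where
  "L2_on \<Omega> \<mu> \<longleftrightarrow> \<mu> \<in> borel_measurable (lebesgue_on \<Omega>) \<and>
     integrable (lebesgue_on \<Omega>) (\<lambda>x. (norm (\<mu> x))\<^sup>2)"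

definition in_null_space ::
  "(real^'d::finite) set \<Rightarrow> (real^'d \<Rightarrow> real^'n^'d^'n::finite) \<Rightarrow> (real^'d \<Rightarrow> real^'n) \<Rightarrow> bool" where
  "in_null_space \<Omega> B \<mu> \<longleftrightarrow> L2_on \<Omega> \<mu> \<and>
     (\<forall>\<phi>. test_function \<Omega> \<phi> \<longrightarrow> (\<forall>i j.
        integral\<^sup>L (lebesgue_on \<Omega>)
          (\<lambda>x. - (\<mu> x $ i) * partial_deriv j \<phi> x + (\<Sum>k\<in>UNIV. B x $ i $ j $ k * \<mu> x $ k) * \<phi> x) = 0))"

text \<open>dim N = m, where N is regarded (as a subspace of L^2) modulo a.e. equality on Omega:
  there are m elements of N that are linearly independent modulo a.e.-null functions
  and span N modulo a.e.-null functions.\<close>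
definition null_space_dim ::
  "(real^'d::finite) set \<Rightarrow> (real^'d \<Rightarrow> real^'n^'d^'n::finite) \<Rightarrow> nat \<Rightarrow> bool" where
  "null_space_dim \<Omega> B m \<longleftrightarrow>
     (\<exists>\<mu>s :: (real^'d \<Rightarrow> real^'n) list. length \<mu>s = m \<and> (\<forall>\<mu>\<in>set \<mu>s. in_null_space \<Omega> B \<mu>) \<and>
        (\<forall>c :: nat \<Rightarrow> real. (AE x in lebesgue. x \<in> \<Omega> \<longrightarrow> (\<Sum>l<m. c l *\<^sub>R (\<mu>s ! l) x) = 0)
             \<longrightarrow> (\<forall>l<m. c l = 0)) \<and>
        (\<forall>\<mu>. in_null_space \<Omega> B \<mu> \<longrightarrow>
           (\<exists>c :: nat \<Rightarrow> real. AE x in lebesgue. x \<in> \<Omega> \<longrightarrow> \<mu> x = (\<Sum>l<m. c l *\<^sub>R (\<mu>s ! l) x))))"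

definition C1_curves :: "(real^'d::finite) set \<Rightarrow> real^'d \<Rightarrow> real^'d \<Rightarrow> (real \<Rightarrow> real^'d) set" where
  "C1_curves \<Omega> x y = {\<gamma>. \<gamma> ` {0..1} \<subseteq> \<Omega> \<and> \<gamma> 0 = x \<and> \<gamma> 1 = y \<and>
     (\<exists>D. continuous_on {0..1} D \<and>
        (\<forall>t\<in>{0..1}. (\<gamma> has_vector_derivative D t) (at t within {0..1})))}"

definition transport ::
  "(real^'d \<Rightarrow> real^'n^'d^'n::finite) \<Rightarrow> (real \<Rightarrow> real^'d::finite) \<Rightarrow> real^'n \<Rightarrow> real^'n" where
  "transport B \<gamma> v = (THE w. \<exists>\<phi>. \<phi> 0 = v \<and> \<phi> 1 = w \<and>
     (\<forall>t\<in>{0..1}. (\<phi> has_vector_derivative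
        (\<chi> i. - (\<Sum>j\<in>UNIV. \<Sum>k\<in>UNIV. B (\<gamma> t) $ i $ j $ k * \<phi> t $ k
                   * vector_derivative \<gamma> (at t within {0..1}) $ j)))
        (at t within {0..1})))"

definition E_space ::
  "(real^'d::finite) set \<Rightarrow> (real^'d \<Rightarrow> real^'n^'d^'n::finite) \<Rightarrow> real^'d \<Rightarrow> (real^'n) set" where
  "E_space \<Omega> B x = {v. \<forall>y\<in>\<Omega>. \<forall>\<gamma>1\<in>C1_curves \<Omega> x y. \<forall>\<gamma>2\<in>C1_curves \<Omega> x y.
       transport B \<gamma>1 v = transport B \<gamma>2 v}"

definition k_conservative ::
  "(real^'d::finite) set \<Rightarrow> (real^'d \<Rightarrow> real^'n^'d^'n::finite) \<Rightarrow> nat \<Rightarrow> bool" where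
  "k_conservative \<Omega> B k \<longleftrightarrow> (\<forall>x\<in>\<Omega>. dim (E_space \<Omega> B x) = k)"

end

theory Submission
  imports Defs "HOL-Computational_Algebra.Polynomial"
begin

text \<open>Elements of the null space are, up to null sets, the classical solutions u of
  du = - (B u), the parallel sections of the connection B, and evaluation at x identifies
  the space of parallel sections with E_x: a parallel section is transported along every curve,
  and conversely a vector with path-independent transport extends to a parallel section.

  Regularity of a weak solution f in L1 follows from its increments. Testing with smooth bumps averaged
  along a segment gives, for almost all y, that f (y + t e_j) - f y is minus the integral of B_j f over the
  segment. A Gronwall argument for the averages of |f| over small cubes bounds them uniformly, hence the averages
  of f are uniformly Lipschitz, and they converge to a differentiable representative as the cubes shrink.
  Conversely a parallel section is bounded, hence in L2, because near a boundary point Gronwall's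
  inequality along a fixed inward direction compares it with its values on a compact set.\<close>

section \<open>Smooth tensor bumps as test functions\<close>

text \<open>Since B is merely continuous and f merely integrable, the lower-order term of the weak
  equation is only integrable: the equation cannot be differentiated again, and f has no values at
  points to begin with. Integrated increments ask for neither, and averaging them with Fubini leaves
  only averages of |f|. The a priori bound for such an average blows up as the cube shrinks; it only
  ensures that a supremum is finite. On a cube with 4 C R at most 1 an increment is at most half of
  that supremum, and absorbing it gives constants independent of the radius, which is what survives
  the limit. Cubes fit both coordinate segments and tensor products, and every iterated partial
  derivative of a tensor product is again one. The two dimensions are compared at a single point: a
  parallel section is determined by its value there, so the dimension of E_x is the same throughout
  the connected domain. Smoothness of the boundary enters through the boundedness of parallel
  sections.\<close>

primrec Cn :: "nat \<Rightarrow> (real \<Rightarrow> real) \<Rightarrow> bool" where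
  "Cn 0 f \<longleftrightarrow> continuous_on UNIV f"
| "Cn (Suc n) f \<longleftrightarrow> (\<exists>f'. (\<forall>x. (f has_real_derivative f' x) (at x)) \<and> Cn n f')"

definition smooth :: "(real \<Rightarrow> real) \<Rightarrow> bool" where
  "smooth f \<longleftrightarrow> (\<forall>n. Cn n f)"

lemma Cn_SucD: "Cn (Suc n) f \<Longrightarrow> Cn n f"
proof (induction n arbitrary: f)
  case 0
  then obtain f' where "\<And>x. (f has_real_derivative f' x) (at x)" by auto
  then have "isCont f x" for x by (rule DERIV_isCont)
  then show ?case by (simp add: continuous_at_imp_continuous_on)
next
  case (Suc n)
  then show ?case by (metis Cn.simps(2))
qed

lemma Cn_add: "Cn n f \<Longrightarrow> Cn n g \<Longrightarrow> Cn n (\<lambda>x. f x + g x)"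
proof (induction n arbitrary: f g)
  case 0
  then show ?case by (auto intro: continuous_intros)
next
  case (Suc n)
  then obtain f' g' where "\<forall>x. (f has_real_derivative f' x) (at x)" "Cn n f'"
    "\<forall>x. (g has_real_derivative g' x) (at x)" "Cn n g'" by auto
  then show ?case
    using Suc.IH by (auto intro!: exI[of _ "\<lambda>x. f' x + g' x"] derivative_intros)
qed

lemma Cn_mult: "Cn n f \<Longrightarrow> Cn n g \<Longrightarrow> Cn n (\<lambda>x. f x * g x)"
proof (induction n arbitrary: f g)
  case 0
  then show ?case by (auto intro: continuous_intros)
next
  case (Suc n)
  then obtain f' g' where *: "\<forall>x. (f has_real_derivative f' x) (at x)" "Cn n f'"
    "\<forall>x. (g has_real_derivative g' x) (at x)" "Cn n g'" by auto
  \<comment> \<open>The product rule contains f and g undifferentiated; \<open>Cn_SucD\<close>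
    brings them down to level n for the induction hypothesis.\<close>
  have "Cn n (\<lambda>x. f' x * g x + f x * g' x)"
    using Suc * by (intro Cn_add Suc.IH) (auto simp del: Cn.simps intro: Cn_SucD)
  moreover have "((\<lambda>x. f x * g x) has_real_derivative f' x * g x + f x * g' x) (at x)" for x
    using DERIV_mult[OF *(1)[rule_format, of x] *(3)[rule_format, of x]] by (simp add: mult.commute)
  ultimately show ?case unfolding Cn.simps by (intro exI conjI allI)
qed

lemma Cn_const: "Cn n (\<lambda>_. c)"
proof (induction n arbitrary: c)
  case (Suc n)
  then show ?case by (auto intro!: exI[of _ "\<lambda>_. 0"])
qed auto

lemma Cn_affine: "Cn n f \<Longrightarrow> Cn n (\<lambda>x. f (a * x + b))"
proof (induction n arbitrary: f)
  case 0
  then show ?case by (auto intro!: continuous_intros continuous_on_compose2[of UNIV f])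
next
  case (Suc n)
  then obtain f' where *: "\<forall>x. (f has_real_derivative f' x) (at x)" "Cn n f'" by auto
  have "((\<lambda>x. f (a * x + b)) has_real_derivative f' (a * x + b) * a) (at x)" for x
    by (rule DERIV_chain2[where g="\<lambda>x. a * x + b"]) (use * in \<open>auto intro!: derivative_eq_intros\<close>)
  moreover have "Cn n (\<lambda>x. f' (a * x + b) * a)"
    using Cn_mult[OF Suc.IH[OF *(2)] Cn_const] .
  ultimately show ?case unfolding Cn.simps by (intro exI conjI allI)
qed

lemma smooth_mult: "smooth f \<Longrightarrow> smooth g \<Longrightarrow> smooth (\<lambda>x. f x * g x)"
  by (simp add: smooth_def Cn_mult)

lemma smooth_diff: "smooth f \<Longrightarrow> smooth g \<Longrightarrow> smooth (\<lambda>x. f x - g x)"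
  using Cn_add[of _ f "\<lambda>x. (-1) * g x"] Cn_mult[OF Cn_const, of _ g "-1"]
  by (simp add: smooth_def)

lemma smooth_affine: "smooth f \<Longrightarrow> smooth (\<lambda>x. f (a * x + b))"
  by (simp add: smooth_def Cn_affine)

lemma smooth_continuous: "smooth f \<Longrightarrow> continuous_on UNIV f"
  by (metis smooth_def Cn.simps(1))

lemma smooth_has_deriv:
  assumes "smooth f" shows "(f has_real_derivative deriv f x) (at x)"
  using assms unfolding smooth_def by (metis Cn.simps(2) DERIV_imp_deriv)

lemma smooth_deriv:
  assumes "smooth f" shows "smooth (deriv f)"
  unfolding smooth_def
proof
  fix n
  obtain f' where f': "\<forall>x. (f has_real_derivative f' x) (at x)" "Cn n f'"
    using assms unfolding smooth_def by (metis Cn.simps(2))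
  then have "deriv f = f'" by (auto simp: DERIV_imp_deriv)
  then show "Cn n (deriv f)" using f' by simp
qed

lemma smooth_funpow_deriv: "smooth f \<Longrightarrow> smooth ((deriv ^^ n) f)"
  by (induction n) (auto simp: smooth_deriv)

lemma smooth_antideriv:
  assumes "\<And>x. (f has_real_derivative f' x) (at x)" "smooth f'"
  shows "smooth f"
  unfolding smooth_def
proof
  fix n show "Cn n f"
    by (rule Cn_SucD, unfold Cn.simps) (use assms smooth_def in blast)
qed

section \<open>Flat functions and bumps on the line\<close>

lemma poly_times_exp_minus_tendsto_0: "((\<lambda>x. poly p x * exp (- x)) \<longlongrightarrow> (0::real)) at_top"
proof -
  have "((\<lambda>x. \<Sum>i\<le>degree p. coeff p i * (x ^ i / exp x)) \<longlongrightarrow> (\<Sum>i\<le>degree p. coeff p i * (0::real))) at_top"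
    by (intro tendsto_intros tendsto_power_div_exp_0)
  then show ?thesis
    by (simp add: poly_altdef sum_distrib_right exp_minus divide_inverse mult.assoc)
qed

text \<open>Carrying a polynomial in 1/t in front of the flat exponential makes the class closed
  under differentiation, so smoothness of all its members follows from one induction.\<close>

definition exp_germ :: "real poly \<Rightarrow> real \<Rightarrow> real" where
  "exp_germ p t = (if t > 0 then poly p (1 / t) * exp (- (1 / t)) else 0)"

lemma exp_germ_tendsto_0: "(exp_germ p \<longlongrightarrow> 0) (at 0)"
proof -
  have "((\<lambda>t. poly p (inverse t) * exp (- (inverse t))) \<longlongrightarrow> 0) (at_right 0)"
    using filterlim_compose[OF poly_times_exp_minus_tendsto_0 filterlim_inverse_at_top_right] .
  then have "(exp_germ p \<longlongrightarrow> 0) (at_right 0)"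
    by (rule Lim_transform_eventually)
      (auto simp: exp_germ_def eventually_at_right_field field_simps intro!: exI[of _ 1])
  moreover have "(exp_germ p \<longlongrightarrow> 0) (at_left 0)"
    by (rule Lim_transform_eventually[OF tendsto_const])
      (auto simp: exp_germ_def eventually_at_left_field intro!: exI[of _ "-1"])
  ultimately show ?thesis
    by (simp add: filterlim_at_split)
qed

text \<open>For positive t, both the inner derivative of p(1/t) and that of the exponential produce
  a factor 1/t^2, which is the polynomial \<open>[:0, 0, 1:]\<close> in 1/t.\<close>

lemma exp_germ_deriv:
  "(exp_germ p has_real_derivative exp_germ ([:0, 0, 1:] * (p - pderiv p)) t) (at t)"
proof -
  consider "t > 0" | "t < 0" | "t = 0" by linarith
  then show ?thesis
  proof cases
    case 1
    have i: "((\<lambda>t. 1 / t) has_real_derivative - (1 / t * (1 / t))) (at t)"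
      using 1 by (auto intro!: derivative_eq_intros)
    note DERIV_mult[OF DERIV_chain2[OF poly_DERIV[of p] i] DERIV_chain2[OF DERIV_exp DERIV_minus[OF i]]]
    moreover have "poly (pderiv p) (1 / t) * - (1 / t * (1 / t)) * exp (- (1 / t)) +
        exp (- (1 / t)) * (- (- (1 / t * (1 / t)))) * poly p (1 / t) = exp_germ ([:0, 0, 1:] * (p - pderiv p)) t"
      using 1 by (simp add: exp_germ_def algebra_simps)
    ultimately have "((\<lambda>t. poly p (1 / t) * exp (- (1 / t))) has_real_derivative
        exp_germ ([:0, 0, 1:] * (p - pderiv p)) t) (at t)" by simp
    then show ?thesis
      by (rule has_field_derivative_transform_within_open[of _ _ _ "{0<..}"]) (use 1 in \<open>auto simp: exp_germ_def\<close>)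
  next
    case 2
    have "((\<lambda>t. 0) has_real_derivative exp_germ ([:0, 0, 1:] * (p - pderiv p)) t) (at t)"
      using 2 by (simp add: exp_germ_def)
    then show ?thesis
      by (rule has_field_derivative_transform_within_open[of _ _ _ "{..<0}"]) (use 2 in \<open>auto simp: exp_germ_def\<close>)
  next
    case 3
    \<comment> \<open>Dividing by h multiplies the polynomial by its variable 1/h, so the difference
      quotient at 0 is itself a germ and tends to 0.\<close>
    have "(\<lambda>h. (exp_germ p (0 + h) - exp_germ p 0) / h) = exp_germ (pCons 0 p)"
      by (auto simp: exp_germ_def field_simps)
    then show ?thesis
      using 3 exp_germ_tendsto_0 by (simp add: DERIV_def exp_germ_def)
  qed
qed

lemma smooth_exp_germ: "smooth (exp_germ p)"
proof -
  have "Cn n (exp_germ p)" for n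
  proof (induction n arbitrary: p)
    case 0
    have "isCont (exp_germ p) x" for x using exp_germ_deriv by (rule DERIV_isCont)
    then show ?case by (simp add: continuous_at_imp_continuous_on)
  next
    case (Suc n)
    show ?case unfolding Cn.simps
      by (rule exI[of _ "exp_germ ([:0, 0, 1:] * (p - pderiv p))"]) (intro conjI allI exp_germ_deriv Suc)
  qed
  then show ?thesis by (simp add: smooth_def)
qed

text \<open>The index m only steepens the edges: the bump stays between 0 and 1 and vanishes off the
  same interval for every m, as dominated convergence towards the indicator requires.\<close>

definition bump :: "real \<Rightarrow> real \<Rightarrow> nat \<Rightarrow> real \<Rightarrow> real" where
  "bump a b m t = exp_germ 1 (real (Suc m) * (t - a)) * exp_germ 1 (real (Suc m) * (b - t))"

lemma smooth_bump: "smooth (bump a b m)"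
proof -
  have "smooth (\<lambda>t. exp_germ 1 (real (Suc m) * t + - (real (Suc m) * a)) *
      exp_germ 1 (- (real (Suc m)) * t + real (Suc m) * b))"
    by (intro smooth_mult smooth_affine smooth_exp_germ)
  then show ?thesis
    by (simp add: bump_def[abs_def] algebra_simps)
qed

lemma bump_bounds: "0 \<le> bump a b m t" "bump a b m t \<le> 1"
  by (auto simp: bump_def exp_germ_def intro!: mult_le_one)

lemma bump_eq_0: "t \<notin> {a<..<b} \<Longrightarrow> bump a b m t = 0"
  by (auto simp: bump_def exp_germ_def zero_less_mult_iff not_less)

lemma bump_tendsto: "(\<lambda>m. bump a b m t) \<longlonglongrightarrow> indicator {a<..<b} t"
proof (cases "t \<in> {a<..<b}")
  case True
  have *: "(\<lambda>m. exp_germ 1 (real (Suc m) * s)) \<longlonglongrightarrow> 1" if "s > 0" for s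
  proof -
    have "(\<lambda>m. exp (- (inverse (real (Suc m)) * (1 / s)))) \<longlonglongrightarrow> exp (- (0 * (1 / s)))"
      by (intro tendsto_intros LIMSEQ_inverse_real_of_nat)
    moreover have "exp_germ 1 (real (Suc m) * s) = exp (- (inverse (real (Suc m)) * (1 / s)))" for m
      using that by (auto simp: exp_germ_def zero_less_mult_iff divide_simps simp del: of_nat_Suc)
    ultimately show ?thesis by simp
  qed
  have "(\<lambda>m. bump a b m t) \<longlonglongrightarrow> 1 * 1"
    unfolding bump_def using True by (intro tendsto_mult *) auto
  then show ?thesis using True by simp
next
  case False
  then show ?thesis by (simp add: bump_eq_0)
qed

section \<open>Tensor products of smooth functions of one variable\<close>

definition tens :: "('d::finite \<Rightarrow> real \<Rightarrow> real) \<Rightarrow> real^'d \<Rightarrow> real" where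
  "tens h x = (\<Prod>i\<in>UNIV. h i (x $ i))"

lemma tens_axis: "tens h (x + t *\<^sub>R axis j 1) = h j (x $ j + t) * (\<Prod>i\<in>UNIV - {j}. h i (x $ i))"
proof -
  have "tens h (x + t *\<^sub>R axis j 1) = h j (x $ j + t) * (\<Prod>i\<in>UNIV - {j}. h i ((x + t *\<^sub>R axis j 1) $ i))"
    by (simp add: tens_def prod.remove[of UNIV j] axis_def)
  also have "(\<Prod>i\<in>UNIV - {j}. h i ((x + t *\<^sub>R axis j 1) $ i)) = (\<Prod>i\<in>UNIV - {j}. h i (x $ i))"
    by (intro prod.cong) (auto simp: axis_def)
  finally show ?thesis .
qed

lemma tens_has_deriv:
  assumes "\<And>i. smooth (h i)"
  shows "((\<lambda>t. tens h (x + t *\<^sub>R axis j 1)) has_real_derivative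
           tens (h(j := deriv (h j))) (x + s *\<^sub>R axis j 1)) (at s)"
proof -
  have "((\<lambda>t. h j (x $ j + t)) has_real_derivative deriv (h j) (x $ j + s) * 1) (at s)"
    by (rule DERIV_chain2[OF smooth_has_deriv[OF assms]]) (auto intro!: derivative_eq_intros)
  from DERIV_cmult_right[OF this, of "\<Prod>i\<in>UNIV - {j}. h i (x $ i)"]
  show ?thesis
    unfolding tens_axis by (simp add: mult.commute)
qed

lemma partial_deriv_tens:
  assumes "\<And>i. smooth (h i)"
  shows "partial_deriv j (tens h) = tens (h(j := deriv (h j)))"
proof
  fix x
  show "partial_deriv j (tens h) x = tens (h(j := deriv (h j))) x"
    using DERIV_imp_deriv[OF tens_has_deriv[of h x j 0]] assms by (simp add: partial_deriv_def)
qed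

lemma continuous_tens:
  assumes "\<And>i. smooth (h i)"
  shows "continuous_on S (tens h)"
  unfolding tens_def
  by (intro continuous_intros continuous_on_compose2[OF smooth_continuous[OF assms]]) auto

text \<open>A derivative in direction j acts on factor j alone, so only the number of occurrences of
  each index counts. This disposes of the quantification over all index lists in
  \<open>Cinf_on\<close>.\<close>

lemma iter_partial_tens:
  assumes "\<And>i. smooth (h i)"
  shows "iter_partial js (tens h) = tens (\<lambda>i. (deriv ^^ count_list js i) (h i))"
proof (induction js)
  case (Cons j js)
  have "iter_partial (j # js) (tens h) = partial_deriv j (tens (\<lambda>i. (deriv ^^ count_list js i) (h i)))"
    using Cons by simp
  also have "\<dots> = tens ((\<lambda>i. (deriv ^^ count_list js i) (h i))(j := deriv ((deriv ^^ count_list js j) (h j))))"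
    by (rule partial_deriv_tens) (rule smooth_funpow_deriv[OF assms])
  also have "(\<lambda>i. (deriv ^^ count_list js i) (h i))(j := deriv ((deriv ^^ count_list js j) (h j))) =
      (\<lambda>i. (deriv ^^ count_list (j # js) i) (h i))"
    by (rule ext) simp
  finally show ?case .
qed simp

lemma Cinf_on_tens:
  assumes "\<And>i. smooth (h i)"
  shows "Cinf_on UNIV (tens h)"
proof -
  have *: "\<And>i js. smooth ((deriv ^^ count_list js i) (h i))" using assms smooth_funpow_deriv by blast
  have "(\<lambda>t. tens (\<lambda>i. (deriv ^^ count_list js i) (h i)) (x + t *\<^sub>R axis j 1)) differentiable at 0" for js x j
    using tens_has_deriv[where s=0 and x=x and j=j and h="\<lambda>i. (deriv ^^ count_list js i) (h i)", OF *]
    unfolding real_differentiable_def by blast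
  then show ?thesis
    unfolding Cinf_on_def iter_partial_tens[OF assms] by (intro allI conjI ballI continuous_tens *)
qed

lemma test_function_tens:
  assumes "\<And>i. smooth (h i)" "\<And>i t. t \<notin> {a$i..b$i} \<Longrightarrow> h i t = 0" "cbox a b \<subseteq> \<Omega>"
  shows "test_function \<Omega> (tens h)"
proof -
  have "{x. tens h x \<noteq> 0} \<subseteq> cbox a b"
    using assms(2) by (force simp: tens_def mem_box_cart)
  then have *: "closure {x. tens h x \<noteq> 0} \<subseteq> cbox a b"
    by (rule closure_minimal) (rule closed_cbox)
  then have "compact (closure {x. tens h x \<noteq> 0})"
    by (metis closed_closure compact_cbox compact_Int_closed inf.absorb2)
  then show ?thesis using * assms(3) Cinf_on_tens[of h, OF assms(1)] unfolding test_function_def by blast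
qed

section \<open>Increments of a weak solution along an axis\<close>

lemma lborel_integrable_shift:
  fixes g :: "'a::euclidean_space \<Rightarrow> 'b::{banach, second_countable_topology}"
  assumes "integrable lborel g"
  shows "integrable lborel (\<lambda>y. g (y + c))"
proof -
  have "integrable (distr lborel borel ((+) c)) g" using assms by (simp add: lborel_distr_plus)
  then show ?thesis
    by (subst (asm) integrable_distr_eq) (use assms in \<open>auto simp: add.commute\<close>)
qed

lemma lborel_integral_shift:
  fixes g :: "'a::euclidean_space \<Rightarrow> 'b::{banach, second_countable_topology}"
  assumes [measurable]: "g \<in> borel_measurable borel"
  shows "(\<integral>y. g (y + c) \<partial>lborel) = (\<integral>y. g y \<partial>lborel)"
proof -
  have "(\<integral>y. g y \<partial>distr lborel borel ((+) c)) = (\<integral>y. g (c + y) \<partial>lborel)"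
    by (rule integral_distr) auto
  then show ?thesis by (simp add: lborel_distr_plus add.commute)
qed

text \<open>Translation invariance makes the inner L1 norm constant in s, so finiteness of P gives
  joint integrability by Tonelli. P will be Lebesgue measure on a segment.\<close>

lemma integrable_pair_shift:
  fixes g :: "'a::euclidean_space \<Rightarrow> 'b::{banach, second_countable_topology}"
  assumes P: "finite_measure P" and T[measurable]: "T \<in> borel_measurable P"
    and g: "integrable lborel g"
  shows "integrable (P \<Otimes>\<^sub>M lborel) (\<lambda>(s, y). g (y + T s))"
proof -
  interpret P: finite_measure P by fact
  interpret pair_sigma_finite P "lborel :: 'a measure" ..
  have [measurable]: "g \<in> borel_measurable borel" using g by auto
  show ?thesis
  proof (rule Fubini_integrable)
    show "(\<lambda>(s, y). g (y + T s)) \<in> borel_measurable (P \<Otimes>\<^sub>M lborel)" by measurable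
    have "(\<integral>y. norm (g (y + T s)) \<partial>lborel) = (\<integral>y. norm (g y) \<partial>lborel)" for s
      by (rule lborel_integral_shift) measurable
    then show "integrable P (\<lambda>s. \<integral>y. norm (case (s, y) of (s, y) \<Rightarrow> g (y + T s)) \<partial>lborel)"
      by simp
    show "AE s in P. integrable lborel (\<lambda>y. case (s, y) of (s, y) \<Rightarrow> g (y + T s))"
      using lborel_integrable_shift[OF g] by simp
  qed
qed

lemma integrable_pair_shift_mult:
  fixes g w :: "'a::euclidean_space \<Rightarrow> real"
  assumes P: "finite_measure P" and T[measurable]: "T \<in> borel_measurable P"
    and g: "integrable lborel g"
    and [measurable]: "w \<in> borel_measurable borel" and b: "\<And>x. \<bar>w x\<bar> \<le> 1"
  shows "integrable (P \<Otimes>\<^sub>M lborel) (\<lambda>(s, y). g (y + T s) * w y)"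
    and "integrable (P \<Otimes>\<^sub>M lborel) (\<lambda>(s, y). g y * w (y - T s))"
proof -
  have [measurable]: "g \<in> borel_measurable borel" using g by auto
  have b': "\<bar>g x * w y\<bar> \<le> \<bar>g x\<bar>" for x y
    using b[of y] by (simp add: abs_mult mult_left_le)
  show "integrable (P \<Otimes>\<^sub>M lborel) (\<lambda>(s, y). g (y + T s) * w y)"
    by (rule Bochner_Integration.integrable_bound[OF integrable_pair_shift[OF P T g]]) (auto simp: b')
  have "integrable (P \<Otimes>\<^sub>M lborel) (\<lambda>(s, y). g (y + 0))"
    by (rule integrable_pair_shift[OF P _ g]) auto
  then show "integrable (P \<Otimes>\<^sub>M lborel) (\<lambda>(s, y). g y * w (y - T s))"
    by (rule Bochner_Integration.integrable_bound) (measurable, auto simp: b')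
qed

text \<open>Averaging over translates has as adjoint the averaging over opposite translates. This
  moves an average along a segment from the rough function g onto the test function.\<close>

lemma integral_shift_dual:
  fixes g w :: "'a::euclidean_space \<Rightarrow> real"
  assumes P: "finite_measure P" and T[measurable]: "T \<in> borel_measurable P"
    and g: "integrable lborel g"
    and [measurable]: "w \<in> borel_measurable borel" and b: "\<And>x. \<bar>w x\<bar> \<le> 1"
  shows "(\<integral>y. (\<integral>s. g (y + T s) \<partial>P) * w y \<partial>lborel) = (\<integral>x. g x * (\<integral>s. w (x - T s) \<partial>P) \<partial>lborel)"
proof -
  interpret P: finite_measure P by fact
  interpret pair_sigma_finite P "lborel :: 'a measure" ..
  have [measurable]: "g \<in> borel_measurable borel" using g by auto
  note int = integrable_pair_shift_mult[OF assms]
  have "(\<integral>y. (\<integral>s. g (y + T s) \<partial>P) * w y \<partial>lborel) = (\<integral>y. (\<integral>s. g (y + T s) * w y \<partial>P) \<partial>lborel)"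
    by simp
  also have "\<dots> = (\<integral>s. (\<integral>y. g (y + T s) * w y \<partial>lborel) \<partial>P)"
    by (rule Fubini_integral[OF int(1)])
  also have "\<dots> = (\<integral>s. (\<integral>y. g y * w (y - T s) \<partial>lborel) \<partial>P)"
  proof (rule Bochner_Integration.integral_cong)
    fix s
    show "(\<integral>y. g (y + T s) * w y \<partial>lborel) = (\<integral>y. g y * w (y - T s) \<partial>lborel)"
      using lborel_integral_shift[of "\<lambda>y. g y * w (y - T s)" "T s"] by simp
  qed simp
  also have "\<dots> = (\<integral>y. (\<integral>s. g y * w (y - T s) \<partial>P) \<partial>lborel)"
    by (rule Fubini_integral[OF int(2), symmetric])
  finally show ?thesis by simp
qed

text \<open>The positive and negative parts are densities of two measures that agree on all boxes.
  Boxes are stable under intersection and generate the Borel sets, so the measures coincide, and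
  then so do the densities almost everywhere.\<close>

lemma AE_zero_if_box_integrals_zero:
  fixes H :: "'a::euclidean_space \<Rightarrow> real"
  assumes H: "integrable lborel H"
    and box: "\<And>a b. box a b \<subseteq> box a0 b0 \<Longrightarrow> (\<integral>x. H x * indicator (box a b) x \<partial>lborel) = 0"
  shows "AE x in lborel. x \<in> box a0 b0 \<longrightarrow> H x = 0"
proof -
  \<comment> \<open>Boxes intersect in boxes, so after this cutoff the hypothesis on subboxes of
    \<open>box a0 b0\<close> holds for all boxes.\<close>
  define K where "K x = H x * indicator (box a0 b0) x" for x
  have K: "integrable lborel K"
    unfolding K_def by (rule integrable_real_mult_indicator) (use H in auto)
  have [measurable]: "H \<in> borel_measurable borel" using H by auto
  have [measurable]: "K \<in> borel_measurable borel" using K by auto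
  have Kb: "(\<integral>x. K x * indicator (box a b) x \<partial>lborel) = 0" for a b
  proof -
    have "box a b \<inter> box a0 b0 = box (\<Sum>i\<in>Basis. max (a \<bullet> i) (a0 \<bullet> i) *\<^sub>R i) (\<Sum>i\<in>Basis. min (b \<bullet> i) (b0 \<bullet> i) *\<^sub>R i)"
      by (rule box_Int_box)
    then obtain c d where cd: "box a b \<inter> box a0 b0 = box c d" by blast
    have "(\<lambda>x. K x * indicator (box a b) x) = (\<lambda>x. H x * indicator (box c d) x)"
      unfolding K_def cd[symmetric] by (auto simp: indicator_def)
    then show ?thesis using box[of c d] cd by auto
  qed
  have int: "integrable lborel (\<lambda>x. max 0 (K x))" "integrable lborel (\<lambda>x. max 0 (- K x))"
    using K by auto
  have em: "emeasure (density lborel (\<lambda>x. ennreal (k x))) A = ennreal (\<integral>x. max 0 (k x) * indicator A x \<partial>lborel)"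
    if "integrable lborel k" "A \<in> sets borel" for k and A :: "'a set"
  proof -
    have "emeasure (density lborel (\<lambda>x. ennreal (k x))) A = (\<integral>\<^sup>+x. ennreal (k x) * indicator A x \<partial>lborel)"
      by (rule emeasure_density) (use that in auto)
    also have "\<dots> = (\<integral>\<^sup>+x. ennreal (max 0 (k x) * indicator A x) \<partial>lborel)"
      by (intro nn_integral_cong) (auto simp: indicator_def max_def ennreal_neg)
    also have "\<dots> = ennreal (\<integral>x. max 0 (k x) * indicator A x \<partial>lborel)"
      by (intro nn_integral_eq_integral integrable_real_mult_indicator) (use that in auto)
    finally show ?thesis .
  qed
  have "density lborel (\<lambda>x. ennreal (K x)) = density lborel (\<lambda>x. ennreal (- K x))"
  proof (rule measure_eqI_generator_eq[where E="range (\<lambda>(a, b). box a b)" and \<Omega>=UNIV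
        and A="\<lambda>i. box (- real i *\<^sub>R One) (real i *\<^sub>R One)"])
    show "Int_stable (range (\<lambda>(a, b). box a b :: 'a set))"
      by (auto simp: Int_stable_def box_Int_box)
    fix X :: "'a set" assume "X \<in> range (\<lambda>(a, b). box a b)"
    then obtain a b where X: "X = box a b" by auto
    have "(\<integral>x. max 0 (K x) * indicator X x \<partial>lborel) - (\<integral>x. max 0 (- K x) * indicator X x \<partial>lborel)
        = (\<integral>x. max 0 (K x) * indicator X x - max 0 (- K x) * indicator X x \<partial>lborel)"
      by (intro Bochner_Integration.integral_diff[symmetric] integrable_real_mult_indicator int) (auto simp: X)
    also have "\<dots> = (\<integral>x. K x * indicator X x \<partial>lborel)"
      by (intro Bochner_Integration.integral_cong) (auto simp: max_def indicator_def)
    also have "\<dots> = 0" by (simp add: X Kb)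
    finally show "emeasure (density lborel (\<lambda>x. ennreal (K x))) X = emeasure (density lborel (\<lambda>x. ennreal (- K x))) X"
      using em[OF K, of X] em[of "\<lambda>x. - K x" X] K X by simp
  next
    show "(\<Union>i. box (- real i *\<^sub>R One) (real i *\<^sub>R One)) = (UNIV :: 'a set)"
      using UN_box_eq_UNIV by simp
  next
    fix i :: nat
    show "emeasure (density lborel (\<lambda>x. ennreal (K x))) (box (- real i *\<^sub>R One) (real i *\<^sub>R One)) \<noteq> \<infinity>"
      using em[OF K] by simp
  qed (auto simp: borel_eq_box)
  then have "AE x in lborel. ennreal (K x) = ennreal (- K x)"
    by (rule sigma_finite_measure.density_unique_iff[THEN iffD1, rotated -1])
      (rule lborel.sigma_finite_measure_axioms, measurable)
  then show ?thesis
  proof eventually_elim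
    case (elim x)
    \<comment> \<open>One of \<open>K x\<close> and \<open>- K x\<close> is nonpositive and is
      truncated to 0 by \<open>ennreal\<close>; their equality therefore forces
      \<open>K x = 0\<close>.\<close>
    then show ?case
    proof (cases "K x \<ge> 0")
      case True
      then have "ennreal (K x) = 0" using elim by (simp add: ennreal_neg)
      then show ?thesis using True by (auto simp: K_def)
    next
      case False
      then have "ennreal (- K x) = 0" using elim by (simp add: ennreal_neg)
      then show ?thesis using False by simp
    qed
  qed
qed


text \<open>Integration along a segment is given a finite measure of its own, so that the Fubini
  lemmas above apply to it directly.\<close>

definition seg_measure :: "real \<Rightarrow> real measure" where
  "seg_measure t = restrict_space lborel {0..t}"

lemma finite_seg_measure: "finite_measure (seg_measure t)"
  unfolding seg_measure_def
  by (cases "0 \<le> t") (auto intro!: finite_measureI simp: emeasure_restrict_space space_restrict_space)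

lemma borel_measurable_seg [measurable (raw)]: "f \<in> borel_measurable borel \<Longrightarrow> f \<in> borel_measurable (seg_measure t)"
  unfolding seg_measure_def by (simp add: measurable_restrict_space1)

lemma integral_seg_measure:
  fixes f :: "real \<Rightarrow> 'a::euclidean_space"
  assumes "continuous_on {0..t} f"
  shows "(\<integral>s. f s \<partial>seg_measure t) = integral {0..t} f"
proof -
  have "set_integrable lborel {0..t} f"
    using borel_integrable_compact[OF _ assms] by (simp add: set_integrable_def)
  then show ?thesis
    unfolding seg_measure_def
    by (simp add: integral_restrict_space set_lebesgue_integral_def[symmetric] set_borel_integral_eq_integral)
qed

text \<open>With an antiderivative X of h the average is X(\<tau>) - X(\<tau> - t). Its derivative
  is thus a difference of two values of h, which is how the partial derivative of a test function
  becomes an increment.\<close>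

lemma smooth_average:
  assumes "smooth h" "0 \<le> t"
  shows "smooth (\<lambda>\<tau>. \<integral>s. h (\<tau> - s) \<partial>seg_measure t)"
    and "deriv (\<lambda>\<tau>. \<integral>s. h (\<tau> - s) \<partial>seg_measure t) \<tau> = h \<tau> - h (\<tau> - t)"
proof -
  have "\<exists>X. \<forall>x. - \<infinity> < ereal x \<longrightarrow> ereal x < \<infinity> \<longrightarrow> (X has_vector_derivative h x) (at x)"
    by (rule einterval_antiderivative)
       (use smooth_continuous[OF assms(1)] in \<open>auto simp: continuous_on_eq_continuous_at\<close>)
  then obtain X where X: "\<And>x. (X has_real_derivative h x) (at x)"
    by (auto simp: has_real_derivative_iff_has_vector_derivative)
  have eq: "(\<integral>s. h (\<tau> - s) \<partial>seg_measure t) = X \<tau> - X (\<tau> - t)" for \<tau>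
  proof -
    have "((\<lambda>s. h (\<tau> - s)) has_integral - X (\<tau> - t) - (- X (\<tau> - 0))) {0..t}"
    proof (rule fundamental_theorem_of_calculus[OF assms(2)])
      fix s
      have "((\<lambda>s. - X (\<tau> - s)) has_real_derivative - (h (\<tau> - s) * (0 - 1))) (at s within {0..t})"
        by (intro DERIV_minus DERIV_chain2[OF X] DERIV_diff) (auto intro!: derivative_eq_intros)
      then show "((\<lambda>s. - X (\<tau> - s)) has_vector_derivative h (\<tau> - s)) (at s within {0..t})"
        by (simp add: has_real_derivative_iff_has_vector_derivative)
    qed
    moreover have "continuous_on {0..t} (\<lambda>s. h (\<tau> - s))"
      by (intro continuous_on_compose2[OF smooth_continuous[OF assms(1)]] continuous_intros) auto
    ultimately show ?thesis by (simp add: integral_seg_measure integral_unique)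
  qed
  have D: "((\<lambda>\<tau>. X \<tau> - X (\<tau> - t)) has_real_derivative h \<tau> - h (\<tau> - t) * (1 - 0)) (at \<tau>)" for \<tau>
    by (intro DERIV_diff X DERIV_chain2[OF X]) (auto intro!: derivative_eq_intros)
  have "smooth (\<lambda>\<tau>. h \<tau> - h (1 * \<tau> + - t))"
    by (intro smooth_diff smooth_affine assms)
  then show "smooth (\<lambda>\<tau>. \<integral>s. h (\<tau> - s) \<partial>seg_measure t)"
    unfolding eq by (intro smooth_antideriv[OF D]) simp
  show "deriv (\<lambda>\<tau>. \<integral>s. h (\<tau> - s) \<partial>seg_measure t) \<tau> = h \<tau> - h (\<tau> - t)"
    unfolding eq using DERIV_imp_deriv[OF D] by simp
qed

text \<open>Testing the weak equation with a smooth bump averaged along the segment from 0 to t e_j.\<close>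

lemma weak_increment_test:
  fixes f g :: "real^'d::finite \<Rightarrow> real"
  assumes f: "integrable lborel f" and g: "integrable lborel g"
    and weak: "\<And>\<phi>. test_function \<Omega> \<phi> \<Longrightarrow>
      (\<integral>x. f x * partial_deriv j \<phi> x \<partial>lborel) = (\<integral>x. g x * \<phi> x \<partial>lborel)"
    and t: "0 \<le> t" and sub: "cbox a (b + t *\<^sub>R axis j 1) \<subseteq> \<Omega>"
    and h: "\<And>i. smooth (h i)" "\<And>i s. 0 \<le> h i s" "\<And>i s. h i s \<le> 1" "\<And>i s. s \<notin> {a$i..b$i} \<Longrightarrow> h i s = 0"
  shows "(\<integral>y. (f (y + t *\<^sub>R axis j 1) - f y + (\<integral>s. g (y + s *\<^sub>R axis j 1) \<partial>seg_measure t)) * tens h y \<partial>lborel) = 0"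
proof -
  define e :: "real^'d" where "e = axis j 1"
  \<comment> \<open>Only factor j is averaged, so the test function remains a tensor product. Its
    support grows by t in direction j, whence the shifted corner in \<open>sub\<close>.\<close>
  define \<psi> where "\<psi> \<tau> = (\<integral>s. h j (\<tau> - s) \<partial>seg_measure t)" for \<tau>
  define h' where "h' = h(j := \<psi>)"
  have [measurable]: "f \<in> borel_measurable borel" "g \<in> borel_measurable borel" using f g by auto
  have tm[measurable]: "tens h \<in> borel_measurable borel"
    by (intro borel_measurable_continuous_onI continuous_tens h)
  have tb: "\<bar>tens h x\<bar> \<le> 1" for x
    unfolding tens_def using h by (auto simp: abs_prod intro!: prod_le_1)
  have sm: "smooth (h' i)" for i
    using smooth_average(1)[OF h(1) t, of j] h(1) by (simp add: h'_def \<psi>_def[abs_def])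
  have supp: "s \<notin> {a$i..(b + t *\<^sub>R e)$i} \<Longrightarrow> h' i s = 0" for i s
  proof (cases "i = j")
    case True
    assume s: "s \<notin> {a$i..(b + t *\<^sub>R e)$i}"
    have "h j (s - r) = 0" if "r \<in> {0..t}" for r
      by (rule h(4)) (use s that True in \<open>auto simp: e_def axis_def\<close>)
    then have "\<psi> s = (\<integral>r. 0 \<partial>seg_measure t)"
      unfolding \<psi>_def by (intro Bochner_Integration.integral_cong) (auto simp: seg_measure_def space_restrict_space)
    then show ?thesis by (simp add: h'_def True)
  next
    case False
    then show "s \<notin> {a$i..(b + t *\<^sub>R e)$i} \<Longrightarrow> ?thesis"
      using h(4)[of s i] by (simp add: h'_def e_def axis_def)
  qed
  have test: "test_function \<Omega> (tens h')"
    by (rule test_function_tens[OF sm supp]) (use sub e_def in auto)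
  have shift: "tens h (x - s *\<^sub>R e) = h j (x $ j - s) * (\<Prod>i\<in>UNIV - {j}. h i (x $ i))" for x s
    using tens_axis[of h x "-s" j] by (simp add: e_def)
  have h'_eq: "tens h' x = (\<integral>s. tens h (x - s *\<^sub>R e) \<partial>seg_measure t)" for x
  proof -
    have "tens h' x = \<psi> (x $ j) * (\<Prod>i\<in>UNIV - {j}. h i (x $ i))"
      using tens_axis[of h' x 0 j] by (simp add: h'_def)
    then show ?thesis unfolding shift \<psi>_def by simp
  qed
  have d_eq: "partial_deriv j (tens h') x = tens h x - tens h (x - t *\<^sub>R e)" for x
  proof -
    have "partial_deriv j (tens h') x = tens (h'(j := deriv (h' j))) x"
      by (simp add: partial_deriv_tens sm)
    also have "\<dots> = deriv \<psi> (x $ j) * (\<Prod>i\<in>UNIV - {j}. h i (x $ i))"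
      using tens_axis[of "h'(j := deriv (h' j))" x 0 j] by (simp add: h'_def)
    also have "\<dots> = tens h x - tens h (x - t *\<^sub>R e)"
      using shift[of x 0] shift[of x t] smooth_average(2)[OF h(1) t, of j "x $ j"]
      by (simp add: \<psi>_def[abs_def] left_diff_distrib)
    finally show ?thesis .
  qed
  have bi: "integrable lborel (\<lambda>x. k x * tens h (x - c))" if k: "integrable lborel k" for k c
  proof (rule Bochner_Integration.integrable_bound[OF k])
    show "(\<lambda>x. k x * tens h (x - c)) \<in> borel_measurable lborel" using k by measurable
    show "AE x in lborel. norm (k x * tens h (x - c)) \<le> norm (k x)"
      using tb by (auto simp: abs_mult mult_left_le)
  qed
  have f0: "integrable lborel (\<lambda>x. f x * tens h x)" using bi[OF f, of 0] by simp
  have ft: "integrable lborel (\<lambda>y. f (y + t *\<^sub>R e) * tens h y)"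
    using bi[OF lborel_integrable_shift[OF f], of "t *\<^sub>R e" 0] by simp
  interpret seg: finite_measure "seg_measure t" by (rule finite_seg_measure)
  interpret pair_sigma_finite "seg_measure t" "lborel :: (real^'d) measure" ..
  have "integrable lborel (\<lambda>y. \<integral>s. g (y + s *\<^sub>R e) * tens h y \<partial>seg_measure t)"
    using integrable_snd[OF integrable_pair_shift_mult(1)[OF finite_seg_measure _ g tm tb, of "\<lambda>s. s *\<^sub>R e" t]]
    by simp
  then have gi: "integrable lborel (\<lambda>y. (\<integral>s. g (y + s *\<^sub>R e) \<partial>seg_measure t) * tens h y)"
    by simp
  \<comment> \<open>The average passes to the test function, the weak equation trades g for f and a
    partial derivative, and \<open>d_eq\<close> turns that derivative into a difference of
    translates.\<close>
  have "(\<integral>y. (\<integral>s. g (y + s *\<^sub>R e) \<partial>seg_measure t) * tens h y \<partial>lborel) = (\<integral>x. g x * tens h' x \<partial>lborel)"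
    unfolding h'_eq by (rule integral_shift_dual[OF finite_seg_measure _ g tm tb]) simp
  also have "\<dots> = (\<integral>x. f x * partial_deriv j (tens h') x \<partial>lborel)"
    using weak[OF test] by simp
  also have "\<dots> = (\<integral>x. f x * tens h x - f x * tens h (x - t *\<^sub>R e) \<partial>lborel)"
    by (simp add: d_eq right_diff_distrib)
  also have "\<dots> = (\<integral>x. f x * tens h x \<partial>lborel) - (\<integral>x. f x * tens h (x - t *\<^sub>R e) \<partial>lborel)"
    by (rule Bochner_Integration.integral_diff[OF f0 bi[OF f]])
  also have "(\<integral>x. f x * tens h (x - t *\<^sub>R e) \<partial>lborel) = (\<integral>y. f (y + t *\<^sub>R e) * tens h y \<partial>lborel)"
    using lborel_integral_shift[of "\<lambda>x. f x * tens h (x - t *\<^sub>R e)" "t *\<^sub>R e"] by simp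
  finally have *: "(\<integral>y. (\<integral>s. g (y + s *\<^sub>R e) \<partial>seg_measure t) * tens h y \<partial>lborel) =
    (\<integral>x. f x * tens h x \<partial>lborel) - (\<integral>y. f (y + t *\<^sub>R e) * tens h y \<partial>lborel)" .
  have "(\<integral>y. (f (y + t *\<^sub>R e) - f y + (\<integral>s. g (y + s *\<^sub>R e) \<partial>seg_measure t)) * tens h y \<partial>lborel)
    = (\<integral>y. f (y + t *\<^sub>R e) * tens h y - f y * tens h y + (\<integral>s. g (y + s *\<^sub>R e) \<partial>seg_measure t) * tens h y \<partial>lborel)"
    by (simp add: algebra_simps)
  also have "\<dots> = 0"
    by (subst Bochner_Integration.integral_add[OF Bochner_Integration.integrable_diff[OF ft f0] gi],
        subst Bochner_Integration.integral_diff[OF ft f0]) (simp add: *)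
  finally show ?thesis by (simp add: e_def)
qed

text \<open>The bumps converge boundedly to the indicator of any subbox, so the defect H of the
  increment formula has integral 0 over every subbox and vanishes almost everywhere.\<close>

lemma weak_increment_AE:
  fixes f g :: "real^'d::finite \<Rightarrow> real"
  assumes f: "integrable lborel f" and g: "integrable lborel g"
    and weak: "\<And>\<phi>. test_function \<Omega> \<phi> \<Longrightarrow>
      (\<integral>x. f x * partial_deriv j \<phi> x \<partial>lborel) = (\<integral>x. g x * \<phi> x \<partial>lborel)"
    and t: "0 \<le> t" and sub: "cbox a (b + t *\<^sub>R axis j 1) \<subseteq> \<Omega>"
  shows "AE y in lborel. y \<in> box a b \<longrightarrow>
    f (y + t *\<^sub>R axis j 1) - f y = - (\<integral>s. g (y + s *\<^sub>R axis j 1) \<partial>seg_measure t)"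
proof -
  define e :: "real^'d" where "e = axis j 1"
  define H where "H y = f (y + t *\<^sub>R e) - f y + (\<integral>s. g (y + s *\<^sub>R e) \<partial>seg_measure t)" for y
  interpret seg: finite_measure "seg_measure t" by (rule finite_seg_measure)
  interpret pair_sigma_finite "seg_measure t" "lborel :: (real^'d) measure" ..
  have "integrable lborel (\<lambda>y. \<integral>s. g (y + s *\<^sub>R e) \<partial>seg_measure t)"
    using integrable_snd[OF integrable_pair_shift[OF finite_seg_measure _ g, of "\<lambda>s. s *\<^sub>R e" t]]
    by simp
  then have H: "integrable lborel H"
    unfolding H_def using f lborel_integrable_shift[OF f] by (intro Bochner_Integration.integrable_add Bochner_Integration.integrable_diff)
  have "AE y in lborel. y \<in> box a b \<longrightarrow> H y = 0"
  proof (rule AE_zero_if_box_integrals_zero[OF H])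
    fix c d assume cd: "box c d \<subseteq> box a b"
    show "(\<integral>x. H x * indicator (box c d) x \<partial>lborel) = 0"
    \<comment> \<open>Inclusion of boxes compares their corners only when the smaller box is
      nonempty.\<close>
    proof (cases "box c d = {}")
      case False
      then have le: "a $ i \<le> c $ i" "d $ i \<le> b $ i" for i
        using False cd by (auto simp: subset_interval_cart interval_eq_empty_cart not_le)
      define h where "h m i = bump (c $ i) (d $ i) m" for m i
      have hb: "\<bar>tens (h m) x\<bar> \<le> 1" for m x
        unfolding tens_def using bump_bounds by (auto simp: abs_prod h_def intro!: prod_le_1)
      have cdsub: "cbox c (d + t *\<^sub>R axis j 1) \<subseteq> \<Omega>"
        proof -
        have "cbox c (d + t *\<^sub>R axis j 1) \<subseteq> cbox a (b + t *\<^sub>R axis j 1)"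
          by (rule subset_interval_imp_cart) (simp add: le)
        then show ?thesis using sub by blast
      qed
      have hm: "tens (h m) \<in> borel_measurable borel" for m
        by (intro borel_measurable_continuous_onI continuous_tens) (simp add: h_def smooth_bump)
      have "(\<integral>y. H y * tens (h m) y \<partial>lborel) = 0" for m
        unfolding H_def e_def
        by (rule weak_increment_test[OF f g weak t cdsub])
          (auto simp: h_def smooth_bump bump_bounds intro!: bump_eq_0)
      moreover have "(\<lambda>m. \<integral>y. H y * tens (h m) y \<partial>lborel) \<longlonglongrightarrow> (\<integral>x. H x * indicator (box c d) x \<partial>lborel)"
      proof (rule integral_dominated_convergence[where w="\<lambda>x. norm (H x)"])
        have "(\<lambda>m. tens (h m) x) \<longlonglongrightarrow> (\<Prod>i\<in>UNIV. indicator {c$i<..<d$i} (x $ i))" for x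
          unfolding tens_def h_def by (intro tendsto_prod bump_tendsto)
        moreover have "(\<Prod>i\<in>UNIV. indicator {c$i<..<d$i} (x $ i)) = (indicator (box c d) x :: real)" for x
          by (auto simp: indicator_def mem_box_cart prod_eq_1_iff intro!: prod_zero prod.neutral)
        ultimately show "AE x in lborel. (\<lambda>m. H x * tens (h m) x) \<longlonglongrightarrow> H x * indicator (box c d) x"
          by (auto intro!: tendsto_mult)
        show "AE x in lborel. norm (H x * tens (h m) x) \<le> norm (H x)" for m
          using hb by (auto simp: abs_mult mult_left_le)
      qed (use H hm in auto)
      ultimately show ?thesis using LIMSEQ_unique[OF _ tendsto_const] by simp
    qed simp
  qed
  then show ?thesis by eventually_elim (auto simp: H_def e_def)
qed

section \<open>Averages over cubes\<close>

definition cube :: "real^'d::finite \<Rightarrow> real \<Rightarrow> (real^'d) set" where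
  "cube x r = {y. \<forall>i. \<bar>y $ i - x $ i\<bar> < r}"

lemma cube_eq_box: "cube x r = box (x - vec r) (x + vec r)"
  by (auto simp: cube_def mem_box_cart abs_less_iff algebra_simps)

lemma open_cube: "open (cube x r)"
  by (simp add: cube_eq_box open_box)

lemma center_in_cube: "0 < r \<Longrightarrow> x \<in> cube x r"
  by (simp add: cube_def)

lemma cube_add: "p \<in> cube x r \<Longrightarrow> y \<in> cube 0 s \<Longrightarrow> p + y \<in> cube x (r + s)"
proof -
  assume "p \<in> cube x r" "y \<in> cube 0 s"
  then have "\<bar>p $ i - x $ i\<bar> < r" "\<bar>y $ i\<bar> < s" for i by (auto simp: cube_def)
  then have "\<bar>(p + y) $ i - x $ i\<bar> < r + s" for i by (smt (verit) vector_add_component)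
  then show ?thesis by (simp add: cube_def)
qed

lemma cube_mono: "r \<le> s \<Longrightarrow> cube x r \<subseteq> cube x s"
  by (auto simp: cube_def intro: less_le_trans)

lemma cube_shift: "x + y \<in> cube x r \<longleftrightarrow> y \<in> cube 0 r"
  by (simp add: cube_def)

text \<open>The type argument carries the dimension, which neither r nor the result would
  determine.\<close>

definition vol :: "'d::finite itself \<Rightarrow> real \<Rightarrow> real" where
  "vol _ r = measure lborel (cube (0::real^'d) r)"

lemma vol_pos: "0 < r \<Longrightarrow> 0 < vol TYPE('d::finite) r"
  by (auto simp: vol_def cube_eq_box measure_lborel_box_eq Basis_vec_def inner_axis intro!: prod_pos)

text \<open>The uniform probability measure on the cube around the origin. Averages around p are
  integrals of translates, so one measure serves all centres and Fubini can exchange averages with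
  each other.\<close>

definition unif :: "real \<Rightarrow> (real^'d::finite) measure" where
  "unif r = density lborel (\<lambda>x. ennreal (indicator (cube 0 r) x / vol TYPE('d) r))"

lemma sets_unif [simp, measurable_cong]: "sets (unif r) = sets borel"
  and space_unif [simp]: "space (unif r) = UNIV"
  by (simp_all add: unif_def)

lemma cube_sets [measurable]: "cube x r \<in> sets borel"
  by (simp add: open_cube)

lemma integrable_cube_indicator: "integrable lborel (indicator (cube x r) :: _ \<Rightarrow> real)"
  by (intro integrable_real_indicator) (auto simp: open_cube, simp add: cube_eq_box emeasure_lborel_box_finite[unfolded infinity_ennreal_def])

lemma integrable_unif:
  fixes h :: "real^'d::finite \<Rightarrow> 'b::{banach, second_countable_topology}"
  assumes "integrable lborel h" "0 < r"
  shows "integrable (unif r) h"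
proof -
  have [measurable]: "h \<in> borel_measurable borel" using assms by auto
  have "integrable lborel (\<lambda>x. (indicator (cube 0 r) x / vol TYPE('d) r) *\<^sub>R h x)"
    using integrable_mult_indicator[OF _ assms(1), of "cube 0 r"]
    by (simp add: divide_inverse_commute flip: scaleR_scaleR)
  then show ?thesis
    unfolding unif_def by (subst integrable_density) (use vol_pos[OF assms(2), where 'd='d] in auto)
qed

lemma integral_unif:
  fixes h :: "real^'d::finite \<Rightarrow> 'b::{banach, second_countable_topology}"
  assumes [measurable]: "h \<in> borel_measurable borel" and "0 < r"
  shows "(\<integral>x. h x \<partial>unif r) = (\<integral>x. (indicator (cube 0 r) x / vol TYPE('d) r) *\<^sub>R h x \<partial>lborel)"
  unfolding unif_def by (subst integral_density) (use vol_pos[OF assms(2), where 'd='d] in auto)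

lemma emeasure_unif_UNIV:
  assumes "0 < r" shows "emeasure (unif r :: (real^'d::finite) measure) UNIV = 1"
proof -
  have v: "vol TYPE('d) r > 0" by (rule vol_pos[OF assms])
  have "emeasure (unif r :: (real^'d) measure) UNIV = (\<integral>\<^sup>+x. ennreal (indicator (cube (0::real^'d) r) x / vol TYPE('d) r) \<partial>lborel)"
    unfolding unif_def by (subst emeasure_density) auto
  also have "\<dots> = ennreal (\<integral>x. indicator (cube (0::real^'d) r) x / vol TYPE('d) r \<partial>lborel)"
    by (rule nn_integral_eq_integral) (use v integrable_cube_indicator[of 0 r] in auto)
  also have "\<dots> = 1" using v by (simp add: vol_def)
  finally show ?thesis .
qed

lemma finite_unif: "0 < r \<Longrightarrow> finite_measure (unif r :: (real^'d::finite) measure)"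
  by (rule finite_measureI) (simp add: emeasure_unif_UNIV)

lemma integral_unif_const:
  fixes c :: "'b::{banach, second_countable_topology}"
  shows "0 < r \<Longrightarrow> (\<integral>y. c \<partial>(unif r :: (real^'d::finite) measure)) = c"
  by (simp add: measure_def emeasure_unif_UNIV)

lemma AE_unif:
  assumes "0 < r"
  shows "(AE x in unif r. P x) \<longleftrightarrow> (AE x in lborel. x \<in> cube (0::real^'d::finite) r \<longrightarrow> P x)"
  unfolding unif_def
  by (subst AE_density) (use vol_pos[OF assms, where 'd='d] in \<open>auto simp: indicator_def\<close>)

lemma AE_lborel_shift:
  fixes c :: "'a::euclidean_space"
  assumes "AE y in lborel. P y" shows "AE y in lborel. P (c + y)"
proof -
  have "AE y in distr lborel borel ((+) c). P y" unfolding lborel_distr_plus by (rule assms)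
  then show ?thesis by (rule AE_distrD[rotated]) simp
qed

text \<open>The bound is uniform in the centre but blows up as r tends to 0. For small r it only
  provides finiteness; at the fixed radius R it enters the constant \<open>K\<close>.\<close>

lemma unif_norm_bound:
  fixes h :: "real^'d::finite \<Rightarrow> 'b::{banach, second_countable_topology}"
  assumes h: "integrable lborel h" and r: "0 < r"
  shows "(\<integral>y. norm (h (y + c)) \<partial>unif r) \<le> (\<integral>y. norm (h y) \<partial>lborel) / vol TYPE('d) r"
proof -
  have v: "vol TYPE('d) r > 0" by (rule vol_pos[OF r])
  have [measurable]: "h \<in> borel_measurable borel" using h by auto
  have ih: "integrable lborel (\<lambda>y. norm (h (y + c)))" using lborel_integrable_shift[OF h] by auto
  have "(\<integral>y. norm (h (y + c)) \<partial>unif r) = (\<integral>y. (indicator (cube 0 r) y / vol TYPE('d) r) *\<^sub>R norm (h (y + c)) \<partial>lborel)"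
    by (rule integral_unif) (use r in auto)
  also have "\<dots> \<le> (\<integral>y. norm (h (y + c)) / vol TYPE('d) r \<partial>lborel)"
  proof (rule integral_mono')
    show "integrable lborel (\<lambda>y. norm (h (y + c)) / vol TYPE('d) r)" using ih by auto
  qed (use v in \<open>auto simp: indicator_def\<close>)
  also have "\<dots> = (\<integral>y. norm (h y) \<partial>lborel) / vol TYPE('d) r"
    using lborel_integral_shift[of "\<lambda>y. norm (h y)" c] by simp
  finally show ?thesis .
qed

text \<open>Over a fixed cube the inner integral varies with the shift; the bound of
  \<open>unif_norm_bound\<close>, uniform in the shift, replaces translation invariance.\<close>

lemma integrable_pair_unif:
  fixes h :: "real^'d::finite \<Rightarrow> 'b::{banach, second_countable_topology}"
  assumes Q: "finite_measure Q" and T[measurable]: "T \<in> borel_measurable Q"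
    and h: "integrable lborel h" and r: "0 < r"
  shows "integrable (Q \<Otimes>\<^sub>M unif r) (\<lambda>(s, y). h (y + T s))"
proof -
  interpret Q: finite_measure Q by fact
  interpret U: finite_measure "unif r :: (real^'d) measure" by (rule finite_unif[OF r])
  interpret pair_sigma_finite Q "unif r :: (real^'d) measure" ..
  have [measurable]: "h \<in> borel_measurable borel" using h by auto
  show ?thesis
  proof (rule Fubini_integrable)
    show "(\<lambda>(s, y). h (y + T s)) \<in> borel_measurable (Q \<Otimes>\<^sub>M unif r)" by measurable
    have "integrable Q (\<lambda>s. \<integral>y. norm (h (y + T s)) \<partial>unif r)"
      by (rule Q.integrable_const_bound[where B="(\<integral>y. norm (h y) \<partial>lborel) / vol TYPE('d) r"])
         (use unif_norm_bound[OF h r] in auto)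
    then show "integrable Q (\<lambda>s. \<integral>y. norm (case (s, y) of (s, y) \<Rightarrow> h (y + T s)) \<partial>unif r)"
      by simp
    show "AE s in Q. integrable (unif r) (\<lambda>y. case (s, y) of (s, y) \<Rightarrow> h (y + T s))"
      using integrable_unif[OF lborel_integrable_shift[OF h] r] by simp
  qed
qed

text \<open>Replace the coordinates of p by those of q one at a time. The intermediate points stay
  in the cube because each of their coordinates belongs to p or to q. Symmetry of D covers the
  coordinates that decrease.\<close>

lemma coordinate_chain:
  fixes D :: "real^'d::finite \<Rightarrow> real^'d \<Rightarrow> real"
  assumes step: "\<And>p j t. p \<in> cube x r \<Longrightarrow> p + t *\<^sub>R axis j 1 \<in> cube x r \<Longrightarrow> 0 \<le> t \<Longrightarrow>
      D p (p + t *\<^sub>R axis j 1) \<le> c * t"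
    and sym: "\<And>p q. D p q = D q p" and tri: "\<And>p q s. D p s \<le> D p q + D q s" and refl: "\<And>p. D p p = 0"
    and p: "p \<in> cube x r" and q: "q \<in> cube x r"
  shows "D p q \<le> c * (\<Sum>i\<in>UNIV. \<bar>q $ i - p $ i\<bar>)"
proof -
  define w where "w S = (\<chi> i. if i \<in> S then q $ i else p $ i)" for S
  have wc: "w S \<in> cube x r" for S using p q by (auto simp: w_def cube_def)
  have "D p (w S) \<le> c * (\<Sum>i\<in>S. \<bar>q $ i - p $ i\<bar>)" if "finite S" for S
    using that
  proof induction
    case empty
    have "w {} = p" by (simp add: w_def)
    then show ?case by (simp add: refl)
  next
    case (insert j S)
    have *: "w (insert j S) = w S + (q $ j - p $ j) *\<^sub>R axis j 1"
      using insert by (auto simp: w_def vec_eq_iff axis_def)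
    have "D (w S) (w (insert j S)) \<le> c * \<bar>q $ j - p $ j\<bar>"
    proof (cases "q $ j \<ge> p $ j")
      case True
      then show ?thesis using step[of "w S" "q $ j - p $ j" j] wc[of S] wc[of "insert j S"] * by simp
    next
      case False
      have "w S = w (insert j S) + (p $ j - q $ j) *\<^sub>R axis j 1"
        unfolding * by (simp add: algebra_simps)
      then show ?thesis
        using step[of "w (insert j S)" "p $ j - q $ j" j] wc[of S] wc[of "insert j S"] False sym by simp
    qed
    then show ?case using insert tri[of p "w (insert j S)" "w S"] by (simp add: distrib_left)
  qed
  moreover have "w UNIV = q" by (simp add: w_def)
  ultimately show ?thesis by (metis finite)
qed

text \<open>The multiplicative version of the same walk, with a factor 2 for each coordinate
  changed.\<close>

lemma coordinate_chain_mult: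
  fixes A :: "real^'d::finite \<Rightarrow> real"
  assumes step: "\<And>p j t. p \<in> cube x r \<Longrightarrow> p + t *\<^sub>R axis j 1 \<in> cube x r \<Longrightarrow>
      A p \<le> 2 * A (p + t *\<^sub>R axis j 1)"
    and p: "p \<in> cube x r" and q: "q \<in> cube x r"
  shows "A p \<le> 2 ^ CARD('d) * A q"
proof -
  define w where "w S = (\<chi> i. if i \<in> S then q $ i else p $ i)" for S
  have wc: "w S \<in> cube x r" for S using p q by (auto simp: w_def cube_def)
  have "A p \<le> 2 ^ card S * A (w S)" if "finite S" for S
    using that
  proof induction
    case empty
    have "w {} = p" by (simp add: w_def)
    then show ?case by simp
  next
    case (insert j S)
    have *: "w (insert j S) = w S + (q $ j - p $ j) *\<^sub>R axis j 1"
      using insert by (auto simp: w_def vec_eq_iff axis_def)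
    have "A (w S) \<le> 2 * A (w (insert j S))"
      using step[of "w S" "q $ j - p $ j" j] wc[of S] wc[of "insert j S"] * by simp
    then have "2 ^ card S * A (w S) \<le> 2 ^ card S * (2 * A (w (insert j S)))"
      by (intro mult_left_mono) auto
    also have "\<dots> = 2 ^ card (insert j S) * A (w (insert j S))" using insert by simp
    finally show ?case using insert.IH by linarith
  qed
  from this[of UNIV] have "A p \<le> 2 ^ CARD('d) * A (w UNIV)" by simp
  moreover have "w UNIV = q" by (simp add: w_def)
  ultimately show ?thesis by simp
qed

section \<open>Local regularity of weak solutions\<close>

text \<open>Increments are assumed on the cube of radius 2 R, which leaves room for averaging cubes
  of radius at most R around points of \<open>cube x0 R\<close>. The condition \<open>CR\<close>
  makes increments across that cube small enough to be absorbed.\<close>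

locale local_weak_solution =
  fixes f :: "real^'d::finite \<Rightarrow> real^'n::finite" and L :: "'d \<Rightarrow> real^'d \<Rightarrow> real^'n \<Rightarrow> real^'n"
    and C R :: real and x0 :: "real^'d"
  assumes f: "integrable lborel f"
    and Lf: "\<And>j. integrable lborel (\<lambda>x. L j x (f x))"
    and lin: "\<And>j x. linear (L j x)"
    and L_le: "\<And>j x v. norm (L j x v) \<le> C * norm v"
    and incr: "\<And>j a b t. 0 \<le> t \<Longrightarrow> cbox a (b + t *\<^sub>R axis j 1) \<subseteq> cbox (x0 - vec (2 * R)) (x0 + vec (2 * R)) \<Longrightarrow>
      AE y in lborel. y \<in> box a b \<longrightarrow>
        f (y + t *\<^sub>R axis j 1) - f y = - (\<integral>s. L j (y + s *\<^sub>R axis j 1) (f (y + s *\<^sub>R axis j 1)) \<partial>seg_measure t)"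
    and C: "0 \<le> C" and R: "0 < R" and CR: "4 * C * R \<le> 1"
begin

abbreviation drift :: "'d \<Rightarrow> real^'d \<Rightarrow> real^'n" where
  "drift j x \<equiv> L j x (f x)"

definition absavg :: "real \<Rightarrow> real^'d \<Rightarrow> real" where
  "absavg r p = (\<integral>y. norm (f (p + y)) \<partial>unif r)"

definition osc :: "real \<Rightarrow> real^'d \<Rightarrow> real^'d \<Rightarrow> real" where
  "osc r p q = (\<integral>y. norm (f (q + y) - f (p + y)) \<partial>unif r)"

definition avg :: "real \<Rightarrow> real^'d \<Rightarrow> real^'n" where
  "avg r p = (\<integral>y. f (p + y) \<partial>unif r)"

text \<open>The factor 2^d is the cost of comparing two points of the cube coordinate by coordinate;
  the quotient bounds averages of |f| over cubes of the fixed radius R.\<close>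

definition K :: real where
  "K = 2 ^ CARD('d) * ((\<integral>y. norm (f y) \<partial>lborel) / vol TYPE('d) R)"

lemma f_meas [measurable]: "f \<in> borel_measurable borel"
  using f by auto

lemma Lf_meas [measurable]: "drift j \<in> borel_measurable borel"
  using Lf by auto

lemma shift_int: "0 < r \<Longrightarrow> integrable (unif r) (\<lambda>y. f (p + y))"
  using integrable_unif[OF lborel_integrable_shift[OF f, of p]] by (simp add: add.commute)

lemma shift_int_L: "0 < r \<Longrightarrow> integrable (unif r) (\<lambda>y. drift j (p + y))"
  using integrable_unif[OF lborel_integrable_shift[OF Lf, where c=p]] by (simp add: add.commute)

lemma absavg_nonneg: "0 \<le> absavg r p"
  by (simp add: absavg_def)

lemma absavg_bound: "0 < r \<Longrightarrow> absavg r p \<le> (\<integral>y. norm (f y) \<partial>lborel) / vol TYPE('d) r"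
  using unif_norm_bound[OF f, of r p] by (simp add: absavg_def add.commute)

lemma K_nonneg: "0 \<le> K"
  using vol_pos[OF R, where 'd='d] by (auto simp: K_def)

lemma pair_int:
  assumes Q: "finite_measure Q" and T: "T \<in> borel_measurable Q" and r: "0 < r"
  shows "integrable (Q \<Otimes>\<^sub>M unif r) (\<lambda>(s, y). f (T s + y))"
    and "integrable (Q \<Otimes>\<^sub>M unif r) (\<lambda>(s, y). norm (f (T s + y)))"
    and "integrable (Q \<Otimes>\<^sub>M unif r) (\<lambda>(s, y). drift j (T s + y))"
    and "integrable (Q \<Otimes>\<^sub>M unif r) (\<lambda>(s, y). norm (drift j (T s + y)))"
  using integrable_pair_unif[OF Q T f r] integrable_pair_unif[OF Q T integrable_norm[OF f] r]
    integrable_pair_unif[OF Q T Lf[of j] r] integrable_pair_unif[OF Q T integrable_norm[OF Lf[of j]] r]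
  by (simp_all add: add.commute)

lemma incr_unif:
  assumes p: "p \<in> cube x0 R" and q: "p + t *\<^sub>R axis j 1 \<in> cube x0 R" and t: "0 \<le> t" and r: "0 < r" "r \<le> R"
  shows "AE y in unif r. f (p + t *\<^sub>R axis j 1 + y) - f (p + y) =
    - (\<integral>s. drift j (p + s *\<^sub>R axis j 1 + y) \<partial>seg_measure t)"
proof -
  have "cbox (p - vec r) (p + vec r + t *\<^sub>R axis j 1) \<subseteq> cbox (x0 - vec (2 * R)) (x0 + vec (2 * R))"
  proof (rule subset_interval_imp_cart, intro allI conjI)
    fix i
    have "\<bar>p $ i - x0 $ i\<bar> < R" "\<bar>(p + t *\<^sub>R axis j 1) $ i - x0 $ i\<bar> < R" using p q by (auto simp: cube_def)
    then show "(x0 - vec (2 * R)) $ i \<le> (p - vec r) $ i" "(p + vec r + t *\<^sub>R axis j 1) $ i \<le> (x0 + vec (2 * R)) $ i"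
      using r by (auto simp: abs_less_iff)
  qed
  from AE_lborel_shift[OF incr[OF t this], of p]
  moreover have "p + y \<in> box (p - vec r) (p + vec r)" if "y \<in> cube 0 r" for y
    using that by (simp add: cube_shift flip: cube_eq_box)
  ultimately show ?thesis
    unfolding AE_unif[OF r(1)] by (auto simp: add_ac elim!: eventually_mono)
qed

text \<open>After moving the norm inside the segment integral, Fubini takes the cube average first.
  Hence only averages of |f| along the segment have to be bounded by S, never f itself.\<close>

lemma osc_le:
  assumes p: "p \<in> cube x0 R" and q: "p + t *\<^sub>R axis j 1 \<in> cube x0 R" and t: "0 \<le> t" and r: "0 < r" "r \<le> R"
    and S: "\<And>s. 0 \<le> s \<Longrightarrow> s \<le> t \<Longrightarrow> absavg r (p + s *\<^sub>R axis j 1) \<le> S"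
  shows "osc r p (p + t *\<^sub>R axis j 1) \<le> C * S * t"
proof -
  define e :: "real^'d" where "e = axis j 1"
  interpret U: finite_measure "unif r :: (real^'d) measure" by (rule finite_unif[OF r(1)])
  interpret seg: finite_measure "seg_measure t" by (rule finite_seg_measure)
  interpret pair_sigma_finite "seg_measure t" "unif r :: (real^'d) measure" ..
  have T: "(\<lambda>s. p + s *\<^sub>R e) \<in> borel_measurable (seg_measure t)" by measurable
  note int = pair_int[OF finite_seg_measure T r(1)]
  have "osc r p (p + t *\<^sub>R e) = (\<integral>y. norm (\<integral>s. drift j (p + s *\<^sub>R e + y) \<partial>seg_measure t) \<partial>unif r)"
    unfolding osc_def
  proof (rule integral_cong_AE)
    show "AE y in unif r. norm (f (p + t *\<^sub>R e + y) - f (p + y)) = norm (\<integral>s. drift j (p + s *\<^sub>R e + y) \<partial>seg_measure t)"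
      using incr_unif[OF p q t r] unfolding e_def by eventually_elim simp
    have "(\<lambda>y. \<integral>s. drift j (p + s *\<^sub>R e + y) \<partial>seg_measure t) \<in> borel_measurable (unif r)"
      using integrable_snd[OF int(3)] by auto
    then show "(\<lambda>y. norm (\<integral>s. drift j (p + s *\<^sub>R e + y) \<partial>seg_measure t)) \<in> borel_measurable (unif r)"
      by measurable
  qed simp
  also have "\<dots> \<le> (\<integral>y. (\<integral>s. norm (drift j (p + s *\<^sub>R e + y)) \<partial>seg_measure t) \<partial>unif r)"
    using integrable_snd[OF int(3)] integrable_snd[OF int(4)]
    by (intro integral_mono integrable_norm integral_norm_bound) auto
  also have "\<dots> = (\<integral>s. (\<integral>y. norm (drift j (p + s *\<^sub>R e + y)) \<partial>unif r) \<partial>seg_measure t)"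
    using Fubini_integral[OF int(4)] by simp
  also have "\<dots> \<le> (\<integral>s. C * S \<partial>seg_measure t)"
  proof (rule integral_mono)
    show "integrable (seg_measure t) (\<lambda>s. \<integral>y. norm (drift j (p + s *\<^sub>R e + y)) \<partial>unif r)"
      using integrable_fst[OF int(4)] by simp
    fix s assume "s \<in> space (seg_measure t)"
    then have s: "0 \<le> s" "s \<le> t" by (auto simp: seg_measure_def space_restrict_space)
    have "(\<integral>y. norm (drift j (p + s *\<^sub>R e + y)) \<partial>unif r) \<le> (\<integral>y. C * norm (f (p + s *\<^sub>R e + y)) \<partial>unif r)"
      by (intro integral_mono integrable_norm shift_int_L integrable_mult_right shift_int r L_le)
    also have "\<dots> \<le> C * S" using S[OF s] C by (auto simp: absavg_def e_def intro!: mult_left_mono)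
    finally show "(\<integral>y. norm (drift j (p + s *\<^sub>R e + y)) \<partial>unif r) \<le> C * S" .
  qed auto
  also have "\<dots> = C * S * t"
    using t by (simp add: measure_def seg_measure_def emeasure_restrict_space space_restrict_space)
  finally show ?thesis by (simp add: e_def)
qed

lemma absavg_diff_le: "0 < r \<Longrightarrow> \<bar>absavg r p - absavg r q\<bar> \<le> osc r p q"
proof -
  assume r: "0 < r"
  have "absavg r p - absavg r q = (\<integral>y. norm (f (p + y)) - norm (f (q + y)) \<partial>unif r)"
    unfolding absavg_def by (intro Bochner_Integration.integral_diff[symmetric] integrable_norm shift_int r)
  also have "\<bar>\<dots>\<bar> \<le> (\<integral>y. \<bar>norm (f (p + y)) - norm (f (q + y))\<bar> \<partial>unif r)"
    using integral_norm_bound[of "unif r" "\<lambda>y. norm (f (p + y)) - norm (f (q + y))"] by simp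
  also have "\<dots> \<le> osc r p q"
    unfolding osc_def
    by (intro integral_mono integrable_abs integrable_norm Bochner_Integration.integrable_diff shift_int r)
       (metis norm_triangle_ineq3 norm_minus_commute)
  finally show ?thesis .
qed

lemma osc_sym: "osc r p q = osc r q p"
  by (simp add: osc_def norm_minus_commute)

text \<open>The short side of the cube makes the growth along an axis at most half of the maximum,
  which is finite because f is integrable; hence averages on an axis-parallel line are comparable.\<close>

lemma absavg_step:
  assumes p: "p \<in> cube x0 R" and q: "p + t *\<^sub>R axis j 1 \<in> cube x0 R" and r: "0 < r" "r \<le> R"
  shows "absavg r p \<le> 2 * absavg r (p + t *\<^sub>R axis j 1)"
proof -
  define e :: "real^'d" where "e = axis j 1"
  define I where "I = {s. p + s *\<^sub>R e \<in> cube x0 R}"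
  \<comment> \<open>The supremum runs over the whole chord of the cube through p in direction e. It
    is finite since \<open>absavg_bound\<close> holds with one bound for all centres.\<close>
  define S where "S = (SUP s\<in>I. absavg r (p + s *\<^sub>R e))"
  have bdd: "bdd_above ((\<lambda>s. absavg r (p + s *\<^sub>R e)) ` I)"
    using absavg_bound[OF r(1)] by (intro bdd_aboveI) blast
  have I: "s \<in> I \<longleftrightarrow> (\<forall>i. \<bar>(p + s *\<^sub>R e) $ i - x0 $ i\<bar> < R)" for s by (simp add: I_def cube_def)
  have conv: "s \<in> I" if "a \<in> I" "b \<in> I" "a \<le> s" "s \<le> b" for a b s
    unfolding I
  proof
    fix i
    have "e $ i = 0 \<or> e $ i = 1" by (auto simp: e_def axis_def)
    then show "\<bar>(p + s *\<^sub>R e) $ i - x0 $ i\<bar> < R"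
      using that I[of a] I[of b] by (elim disjE) (auto dest!: spec[of _ i])
  qed
  have upper: "absavg r (p + s *\<^sub>R e) \<le> S" if "s \<in> I" for s
    unfolding S_def by (rule cSUP_upper[OF that bdd])
  have S0: "0 \<le> S" using upper[of 0] absavg_nonneg[of r p] p by (auto simp: I_def)
  have half: "osc r (p + a *\<^sub>R e) (p + b *\<^sub>R e) \<le> S / 2" if ab: "a \<in> I" "b \<in> I" "a \<le> b" for a b
  proof -
    have ba: "p + b *\<^sub>R e = (p + a *\<^sub>R e) + (b - a) *\<^sub>R axis j 1" by (simp add: e_def algebra_simps)
    have "\<bar>(p + a *\<^sub>R e) $ j - x0 $ j\<bar> < R" "\<bar>(p + b *\<^sub>R e) $ j - x0 $ j\<bar> < R" using ab I by auto
    \<comment> \<open>The chord has length at most 2 R, so \<open>CR\<close> brings the increment C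
      S (b - a) down to S / 2.\<close>
    then have len: "b - a \<le> 2 * R" by (simp add: e_def)
    have "osc r (p + a *\<^sub>R e) (p + a *\<^sub>R e + (b - a) *\<^sub>R axis j 1) \<le> C * S * (b - a)"
    proof (rule osc_le)
      fix s assume "0 \<le> s" "s \<le> b - a"
      then have "a + s \<in> I" using conv[of a b "a + s"] ab by auto
      from upper[OF this] show "absavg r (p + a *\<^sub>R e + s *\<^sub>R axis j 1) \<le> S"
        by (simp add: e_def algebra_simps)
    qed (use ab r ba I_def in auto)
    also have "\<dots> \<le> C * S * (2 * R)" using len C S0 by (intro mult_left_mono) auto
    also have "\<dots> = (4 * C * R) * S / 2" by simp
    also have "\<dots> \<le> 1 * S / 2" using CR S0 by (intro divide_right_mono mult_right_mono) auto
    finally show ?thesis by (simp add: ba)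
  qed
  have tI: "t \<in> I" and oI: "0 \<in> I" using p q by (auto simp: I_def e_def)
  have "absavg r (p + s *\<^sub>R e) \<le> absavg r (p + t *\<^sub>R e) + S / 2" if s: "s \<in> I" for s
    using half[OF s tI] half[OF tI s] absavg_diff_le[OF r(1), of "p + s *\<^sub>R e" "p + t *\<^sub>R e"]
      osc_sym[of r "p + s *\<^sub>R e" "p + t *\<^sub>R e"] by linarith
  \<comment> \<open>Taking the supremum over s puts S on both sides; absorbing S / 2, legitimate as
    S is finite, gives the factor 2 independently of r.\<close>
  then have "S \<le> absavg r (p + t *\<^sub>R e) + S / 2"
    unfolding S_def[symmetric] using oI by (subst S_def) (intro cSUP_least, auto)
  then show ?thesis using upper[OF oI] by (simp add: e_def)
qed

text \<open>Averages at p and at any other point of the cube are comparable independently of r, so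
  the one at p is bounded by a multiple of their mean over the cube. Exchanging the two averages
  turns this mean into averages over cubes of radius R, whose bound does not involve r.\<close>

lemma absavg_le_K:
  assumes p: "p \<in> cube x0 R" and r: "0 < r" "r \<le> R"
  shows "absavg r p \<le> K"
proof -
  interpret U: finite_measure "unif r :: (real^'d) measure" by (rule finite_unif[OF r(1)])
  interpret UR: finite_measure "unif R :: (real^'d) measure" by (rule finite_unif[OF R])
  interpret pair_sigma_finite "unif R :: (real^'d) measure" "unif r :: (real^'d) measure" ..
  have T: "(\<lambda>z. x0 + z) \<in> borel_measurable (unif R)" by measurable
  note int = pair_int(2)[OF finite_unif[OF R] T r(1)]
  have step: "absavg r p \<le> 2 ^ CARD('d) * absavg r (x0 + z)" if "z \<in> cube 0 R" for z
    using coordinate_chain_mult[of x0 R "absavg r" p "x0 + z"] absavg_step r p that by (simp add: cube_shift)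
  have "absavg r p = (\<integral>z. absavg r p \<partial>(unif R :: (real^'d) measure))"
    by (rule integral_unif_const[OF R, symmetric])
  also have "\<dots> \<le> (\<integral>z. 2 ^ CARD('d) * absavg r (x0 + z) \<partial>unif R)"
  proof (rule integral_mono_AE)
    show "integrable (unif R) (\<lambda>z. 2 ^ CARD('d) * absavg r (x0 + z))"
      using integrable_fst[OF int] by (simp add: absavg_def)
    show "AE z in unif R. absavg r p \<le> 2 ^ CARD('d) * absavg r (x0 + z)"
      unfolding AE_unif[OF R] using step by simp
  qed simp
  also have "\<dots> = 2 ^ CARD('d) * (\<integral>z. (\<integral>y. norm (f (x0 + z + y)) \<partial>unif r) \<partial>unif R)"
    by (simp add: absavg_def)
  also have "(\<integral>z. (\<integral>y. norm (f (x0 + z + y)) \<partial>unif r) \<partial>unif R) = (\<integral>y. (\<integral>z. norm (f (x0 + z + y)) \<partial>unif R) \<partial>unif r)"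
    using Fubini_integral[OF int] by simp
  also have "\<dots> \<le> (\<integral>y. (\<integral>y. norm (f y) \<partial>lborel) / vol TYPE('d) R \<partial>(unif r :: (real^'d) measure))"
  proof (rule integral_mono)
    show "integrable (unif r) (\<lambda>y. \<integral>z. norm (f (x0 + z + y)) \<partial>unif R)"
      using integrable_snd[OF int] by simp
    fix y
    show "(\<integral>z. norm (f (x0 + z + y)) \<partial>unif R) \<le> (\<integral>y. norm (f y) \<partial>lborel) / vol TYPE('d) R"
      using unif_norm_bound[OF f R, of "x0 + y"] by (simp add: add_ac)
  qed auto
  also have "\<dots> = (\<integral>y. norm (f y) \<partial>lborel) / vol TYPE('d) R" by (rule integral_unif_const[OF r(1)])
  finally show ?thesis by (simp add: K_def)
qed

lemma osc_le_K:
  assumes p: "p \<in> cube x0 R" and q: "q \<in> cube x0 R" and r: "0 < r" "r \<le> R"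
  shows "osc r p q \<le> C * K * (\<Sum>i\<in>UNIV. \<bar>q $ i - p $ i\<bar>)"
proof (rule coordinate_chain[OF _ _ _ _ p q])
  fix p j and t :: real assume pt: "p \<in> cube x0 R" "p + t *\<^sub>R axis j 1 \<in> cube x0 R" "0 \<le> t"
  show "osc r p (p + t *\<^sub>R axis j 1) \<le> C * K * t"
  proof (rule osc_le[OF pt r], rule absavg_le_K[OF _ r])
    fix s :: real assume s: "0 \<le> s" "s \<le> t"
    have *: "axis j (1::real) $ i = 0 \<or> axis j (1::real) $ i = 1" for i by (auto simp: axis_def)
    show "p + s *\<^sub>R axis j 1 \<in> cube x0 R"
      unfolding cube_def
    proof (clarify)
      fix i
      have "\<bar>p $ i - x0 $ i\<bar> < R" "\<bar>(p + t *\<^sub>R axis j 1) $ i - x0 $ i\<bar> < R" using pt by (auto simp: cube_def)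
      then show "\<bar>(p + s *\<^sub>R axis j 1) $ i - x0 $ i\<bar> < R" using *[of i] s by auto
    qed
  qed
next
  fix p q s
  have "osc r p s \<le> (\<integral>y. norm (f (q + y) - f (p + y)) + norm (f (s + y) - f (q + y)) \<partial>unif r)"
    unfolding osc_def
    by (intro integral_mono integrable_norm Bochner_Integration.integrable_add Bochner_Integration.integrable_diff shift_int r)
       (metis add.commute diff_add_cancel norm_triangle_ineq add_diff_eq)
  also have "\<dots> = osc r p q + osc r q s"
    unfolding osc_def
    by (intro Bochner_Integration.integral_add integrable_norm Bochner_Integration.integrable_diff shift_int r)
  finally show "osc r p s \<le> osc r p q + osc r q s" .
qed (simp_all add: osc_def norm_minus_commute)

lemma avg_Lipschitz:
  assumes p: "p \<in> cube x0 R" and q: "q \<in> cube x0 R" and r: "0 < r" "r \<le> R"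
  shows "norm (avg r q - avg r p) \<le> C * K * (\<Sum>i\<in>UNIV. \<bar>q $ i - p $ i\<bar>)"
proof -
  have "avg r q - avg r p = (\<integral>y. f (q + y) - f (p + y) \<partial>unif r)"
    unfolding avg_def by (intro Bochner_Integration.integral_diff[symmetric] shift_int r)
  also have "norm \<dots> \<le> osc r p q" unfolding osc_def by (rule integral_norm_bound)
  finally show ?thesis using osc_le_K[OF assms] by linarith
qed

end

section \<open>Convergence of the averages and differentiability of their limit\<close>

context local_weak_solution
begin

definition lip :: real where
  "lip = C * K * real CARD('d)"

lemma lip_nonneg: "0 \<le> lip"
  using C K_nonneg by (simp add: lip_def)

lemma avg_Lipschitz_cube:
  assumes p: "p \<in> cube x0 R" and q: "q \<in> cube x0 R" and r: "0 < r" "r \<le> R" and qp: "q \<in> cube p s"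
  shows "norm (avg r q - avg r p) \<le> lip * s"
proof -
  have "(\<Sum>i\<in>UNIV. \<bar>q $ i - p $ i\<bar>) \<le> (\<Sum>i\<in>(UNIV::'d set). s)"
    using qp by (intro sum_mono) (auto simp: cube_def less_imp_le)
  then have "C * K * (\<Sum>i\<in>UNIV. \<bar>q $ i - p $ i\<bar>) \<le> C * K * (real CARD('d) * s)"
    using C K_nonneg by (intro mult_left_mono) auto
  then show ?thesis using avg_Lipschitz[OF p q r] by (simp add: lip_def mult_ac)
qed

lemma avg_int:
  assumes "0 < r" "0 < s"
  shows "integrable (unif r) (\<lambda>y. avg s (p + y))"
proof -
  interpret U: finite_measure "unif r :: (real^'d) measure" by (rule finite_unif[OF assms(1)])
  interpret V: finite_measure "unif s :: (real^'d) measure" by (rule finite_unif[OF assms(2)])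
  interpret pair_sigma_finite "unif r :: (real^'d) measure" "unif s :: (real^'d) measure" ..
  have T: "(\<lambda>y. p + y) \<in> borel_measurable (unif r)" by measurable
  show ?thesis
    using integrable_fst[OF pair_int(1)[OF finite_unif[OF assms(1)] T assms(2)]] by (simp add: avg_def)
qed

lemma avg_avg_commute:
  assumes "0 < r" "0 < s"
  shows "(\<integral>y. avg s (p + y) \<partial>unif r) = (\<integral>y. avg r (p + y) \<partial>unif s)"
proof -
  interpret U: finite_measure "unif r :: (real^'d) measure" by (rule finite_unif[OF assms(1)])
  interpret V: finite_measure "unif s :: (real^'d) measure" by (rule finite_unif[OF assms(2)])
  interpret pair_sigma_finite "unif r :: (real^'d) measure" "unif s :: (real^'d) measure" ..
  have T: "(\<lambda>y. p + y) \<in> borel_measurable (unif r)" by measurable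
  show ?thesis
    using Fubini_integral[OF pair_int(1)[OF finite_unif[OF assms(1)] T assms(2)]]
    by (simp add: avg_def add_ac)
qed

lemma avg_avg:
  assumes p: "p \<in> cube x0 (R / 2)" and r: "0 < r" "r \<le> R / 2" and s: "0 < s" "s \<le> R / 2"
  shows "norm ((\<integral>y. avg s (p + y) \<partial>unif r) - avg s p) \<le> lip * r"
proof -
  interpret U: finite_measure "unif r :: (real^'d) measure" by (rule finite_unif[OF r(1)])
  have "(\<integral>y. avg s (p + y) \<partial>unif r) - avg s p = (\<integral>y. avg s (p + y) \<partial>unif r) - (\<integral>y. avg s p \<partial>(unif r :: (real^'d) measure))"
    by (simp only: integral_unif_const[OF r(1)])
  also have "\<dots> = (\<integral>y. avg s (p + y) - avg s p \<partial>unif r)"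
    by (intro Bochner_Integration.integral_diff[symmetric] avg_int r s) simp
  also have "norm \<dots> \<le> (\<integral>y. norm (avg s (p + y) - avg s p) \<partial>unif r)" by (rule integral_norm_bound)
  also have "\<dots> \<le> (\<integral>y. lip * r \<partial>(unif r :: (real^'d) measure))"
  proof (rule integral_mono_AE)
    show "integrable (unif r) (\<lambda>y. norm (avg s (p + y) - avg s p))"
      by (intro integrable_norm Bochner_Integration.integrable_diff avg_int r s) simp
    have "norm (avg s (p + y) - avg s p) \<le> lip * r" if y: "y \<in> cube 0 r" for y
    proof (rule avg_Lipschitz_cube)
      \<comment> \<open>Halving the cube leaves room for the displacement y, so that the Lipschitz
        estimate on \<open>cube x0 R\<close> applies to both points.\<close>
      show "p + y \<in> cube x0 R" using cube_add[OF p y] cube_mono[of "R / 2 + r" R x0] r by auto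
    qed (use p s R y cube_mono[of "R / 2" R x0] in \<open>auto simp: cube_shift\<close>)
    then show "AE y in unif r. norm (avg s (p + y) - avg s p) \<le> lip * r"
      unfolding AE_unif[OF r(1)] by simp
  qed simp
  also have "\<dots> = lip * r" by (rule integral_unif_const[OF r(1)])
  finally show ?thesis .
qed

text \<open>Both averages are close to the double average over the two cubes, which is symmetric in
  r and s by Fubini.\<close>

lemma avg_diff_le:
  assumes p: "p \<in> cube x0 (R / 2)" and r: "0 < r" "r \<le> R / 2" and s: "0 < s" "s \<le> R / 2"
  shows "norm (avg r p - avg s p) \<le> lip * (r + s)"
proof -
  have "norm ((\<integral>y. avg s (p + y) \<partial>unif r) - avg s p) \<le> lip * r" by (rule avg_avg[OF assms])
  moreover have "norm ((\<integral>y. avg s (p + y) \<partial>unif r) - avg r p) \<le> lip * s"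
    using avg_avg[OF p s r] avg_avg_commute[OF r(1) s(1)] by simp
  ultimately show ?thesis
    using norm_triangle_ineq4[of "(\<integral>y. avg s (p + y) \<partial>unif r) - avg s p" "(\<integral>y. avg s (p + y) \<partial>unif r) - avg r p"]
    by (simp add: distrib_left)
qed

definition radius :: "nat \<Rightarrow> real" where
  "radius n = inverse (real (Suc n))"

lemma radius_pos: "0 < radius n"
  by (simp add: radius_def)

lemma radius_tendsto: "radius \<longlonglongrightarrow> 0"
  unfolding radius_def by (rule LIMSEQ_inverse_real_of_nat)

text \<open>Neither x0 nor R occurs in this limit: \<open>rep\<close> depends on f alone, so the
  representatives found near different points are one and the same function.\<close>

definition rep :: "real^'d \<Rightarrow> real^'n" where
  "rep p = lim (\<lambda>n. avg (radius n) p)"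

lemma radius_eventually: "0 < s \<Longrightarrow> \<forall>\<^sub>F n in sequentially. radius n \<le> s"
  by (drule order_tendstoD(2)[OF radius_tendsto]) (auto elim: eventually_mono)

lemma avg_tendsto_rep:
  assumes p: "p \<in> cube x0 (R / 2)"
  shows "(\<lambda>n. avg (radius n) p) \<longlonglongrightarrow> rep p"
proof -
  have "Cauchy (\<lambda>n. avg (radius n) p)"
  proof (rule CauchyI)
    fix e :: real assume e: "0 < e"
    \<comment> \<open>Two radii up to s contribute at most 2 lip s; the added 2 in the denominator
      makes the final estimate strict and covers lip = 0.\<close>
    define s where "s = min (R / 2) (e / (2 * lip + 2))"
    have s: "0 < s" using R e lip_nonneg by (auto simp: s_def)
    obtain N where N: "\<And>n. n \<ge> N \<Longrightarrow> radius n \<le> s"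
      using radius_eventually[OF s] by (auto simp: eventually_sequentially)
    have "norm (avg (radius m) p - avg (radius n) p) < e" if "m \<ge> N" "n \<ge> N" for m n
    proof -
      have "norm (avg (radius m) p - avg (radius n) p) \<le> lip * (radius m + radius n)"
        using N[OF that(1)] N[OF that(2)] by (intro avg_diff_le p radius_pos) (auto simp: s_def)
      also have "\<dots> \<le> lip * (2 * s)" using N[OF that(1)] N[OF that(2)] lip_nonneg by (intro mult_left_mono) auto
      also have "\<dots> < (2 * lip + 2) * s" using s by (simp add: algebra_simps)
      also have "\<dots> \<le> (2 * lip + 2) * (e / (2 * lip + 2))" using lip_nonneg by (intro mult_left_mono) (auto simp: s_def)
      also have "\<dots> = e" using lip_nonneg by (simp add: field_simps)
      finally show ?thesis .
    qed
    then show "\<exists>M. \<forall>m\<ge>M. \<forall>n\<ge>M. norm (avg (radius m) p - avg (radius n) p) < e" by blast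
  qed
  then have "convergent (\<lambda>n. avg (radius n) p)" by (rule Cauchy_convergent)
  then show ?thesis unfolding rep_def by (rule convergent_LIMSEQ_iff[THEN iffD1])
qed

lemma avg_rep_le:
  assumes p: "p \<in> cube x0 (R / 2)" and r: "0 < r" "r \<le> R / 2"
  shows "norm (avg r p - rep p) \<le> lip * r"
proof (rule tendsto_le[OF sequentially_bot])
  show "(\<lambda>n. norm (avg r p - avg (radius n) p)) \<longlonglongrightarrow> norm (avg r p - rep p)"
    by (intro tendsto_intros avg_tendsto_rep p)
  have "(\<lambda>n. lip * (r + radius n)) \<longlonglongrightarrow> lip * (r + 0)"
    by (intro tendsto_intros radius_tendsto)
  then show "(\<lambda>n. lip * (r + radius n)) \<longlonglongrightarrow> lip * r" by simp
  have "0 < R / 2" using R by simp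
  from radius_eventually[OF this]
  show "\<forall>\<^sub>F n in sequentially. norm (avg r p - avg (radius n) p) \<le> lip * (r + radius n)"
    by eventually_elim (intro avg_diff_le p r radius_pos)
qed

text \<open>Fubini exchanges the roles of the two variables: z becomes a displacement of the centre
  x0, y the averaging variable at radius R / 2. The L1 distance is then at most a mean of
  oscillations, which are Lipschitz in z.\<close>

lemma avg_L1_le:
  assumes r: "0 < r" "r \<le> R / 2"
  shows "(\<integral>y. norm (avg r (x0 + y) - f (x0 + y)) \<partial>unif (R / 2)) \<le> lip * r"
proof -
  have R2: "0 < R / 2" using R by simp
  interpret U: finite_measure "unif r :: (real^'d) measure" by (rule finite_unif[OF r(1)])
  interpret V: finite_measure "unif (R / 2) :: (real^'d) measure" by (rule finite_unif[OF R2])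
  interpret pair_sigma_finite "unif r :: (real^'d) measure" "unif (R / 2) :: (real^'d) measure" ..
  have T: "(\<lambda>z. x0 + z) \<in> borel_measurable (unif r)" "(\<lambda>z. x0) \<in> borel_measurable (unif r)" by measurable
  note int1 = pair_int(1)[OF finite_unif[OF r(1)] T(1) R2]
  note int2 = pair_int(1)[OF finite_unif[OF r(1)] T(2) R2]
  have int: "integrable (unif r \<Otimes>\<^sub>M unif (R / 2)) (\<lambda>(z, y). f (x0 + z + y) - f (x0 + y))"
    using Bochner_Integration.integrable_diff[OF int1 int2] by (simp add: case_prod_beta')
  then have intn: "integrable (unif r \<Otimes>\<^sub>M unif (R / 2)) (\<lambda>(z, y). norm (f (x0 + z + y) - f (x0 + y)))"
    using integrable_norm[OF int] by (simp add: case_prod_beta')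
  have "(\<integral>y. norm (avg r (x0 + y) - f (x0 + y)) \<partial>unif (R / 2)) =
      (\<integral>y. norm (\<integral>z. f (x0 + z + y) - f (x0 + y) \<partial>unif r) \<partial>unif (R / 2))"
  proof (intro Bochner_Integration.integral_cong refl arg_cong[of _ _ norm])
    fix y
    have "(\<integral>z. f (x0 + z + y) - f (x0 + y) \<partial>unif r) = (\<integral>z. f ((x0 + y) + z) - f (x0 + y) \<partial>unif r)"
      by (simp add: add_ac)
    also have "\<dots> = (\<integral>z. f ((x0 + y) + z) \<partial>unif r) - (\<integral>z. f (x0 + y) \<partial>(unif r :: (real^'d) measure))"
      by (intro Bochner_Integration.integral_diff shift_int r) simp
    also have "\<dots> = avg r (x0 + y) - f (x0 + y)"
      by (simp only: integral_unif_const[OF r(1)] avg_def)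
    finally show "avg r (x0 + y) - f (x0 + y) = (\<integral>z. f (x0 + z + y) - f (x0 + y) \<partial>unif r)" ..
  qed
  also have "\<dots> \<le> (\<integral>y. (\<integral>z. norm (f (x0 + z + y) - f (x0 + y)) \<partial>unif r) \<partial>unif (R / 2))"
    using integrable_snd[OF int] integrable_snd[OF intn]
    by (intro integral_mono integrable_norm integral_norm_bound) auto
  also have "\<dots> = (\<integral>z. osc (R / 2) x0 (x0 + z) \<partial>unif r)"
    unfolding osc_def using Fubini_integral[OF intn] by simp
  also have "\<dots> \<le> (\<integral>z. lip * r \<partial>(unif r :: (real^'d) measure))"
  proof (rule integral_mono_AE)
    show "integrable (unif r) (\<lambda>z. osc (R / 2) x0 (x0 + z))"
      using integrable_fst[OF intn] by (simp add: osc_def)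
    have "osc (R / 2) x0 (x0 + z) \<le> lip * r" if z: "z \<in> cube 0 r" for z
    proof -
      have "osc (R / 2) x0 (x0 + z) \<le> C * K * (\<Sum>i\<in>UNIV. \<bar>(x0 + z) $ i - x0 $ i\<bar>)"
        using z cube_mono[of r R 0] r R by (intro osc_le_K) (auto simp: center_in_cube cube_shift)
      also have "\<dots> \<le> C * K * (\<Sum>i\<in>(UNIV::'d set). r)"
        using z C K_nonneg by (intro mult_left_mono sum_mono) (auto simp: cube_def less_imp_le)
      finally show ?thesis by (simp add: lip_def mult_ac)
    qed
    then show "AE z in unif r. osc (R / 2) x0 (x0 + z) \<le> lip * r"
      unfolding AE_unif[OF r(1)] by simp
  qed simp
  also have "\<dots> = lip * r" by (rule integral_unif_const[OF r(1)])
  finally show ?thesis .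
qed

text \<open>The averages converge to f in L1 and to \<open>rep\<close> pointwise; a subsequence
  converging almost everywhere identifies the two limits.\<close>

lemma AE_eq_rep: "AE y in lborel. y \<in> cube x0 (R / 2) \<longrightarrow> f y = rep y"
proof -
  have R2: "0 < R / 2" using R by simp
  define h where "h n y = avg (radius n) (x0 + y) - f (x0 + y)" for n y
  have hi: "integrable (unif (R / 2)) (h n)" for n
    unfolding h_def by (intro Bochner_Integration.integrable_diff avg_int shift_int radius_pos R2)
  have "(\<lambda>n. \<integral>y. norm (h n y) \<partial>unif (R / 2)) \<longlonglongrightarrow> 0"
  proof (rule tendsto_sandwich[OF _ _ tendsto_const])
    show "\<forall>\<^sub>F n in sequentially. 0 \<le> (\<integral>y. norm (h n y) \<partial>unif (R / 2))" by simp
    show "\<forall>\<^sub>F n in sequentially. (\<integral>y. norm (h n y) \<partial>unif (R / 2)) \<le> lip * radius n"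
      using radius_eventually[OF R2] by eventually_elim (simp add: h_def avg_L1_le radius_pos)
    show "(\<lambda>n. lip * radius n) \<longlonglongrightarrow> 0"
      using tendsto_mult_left[OF radius_tendsto, of lip] by simp
  qed
  from tendsto_L1_AE_subseq[OF hi this] obtain k where k: "strict_mono k"
    and lim: "AE y in unif (R / 2). (\<lambda>n. h (k n) y) \<longlonglongrightarrow> 0" by blast
  have "AE y in unif (R / 2). y \<in> cube 0 (R / 2)" unfolding AE_unif[OF R2] by simp
  with lim have "AE y in unif (R / 2). f (x0 + y) = rep (x0 + y)"
  proof eventually_elim
    case (elim y)
    have "(\<lambda>n. avg (radius n) (x0 + y)) \<longlonglongrightarrow> rep (x0 + y)"
      by (rule avg_tendsto_rep) (use elim cube_shift in auto)
    from LIMSEQ_subseq_LIMSEQ[OF this k]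
    have "(\<lambda>n. avg (radius (k n)) (x0 + y)) \<longlonglongrightarrow> rep (x0 + y)" by (simp add: o_def)
    moreover have "(\<lambda>n. h (k n) y + f (x0 + y)) \<longlonglongrightarrow> 0 + f (x0 + y)"
      using elim by (intro tendsto_add) auto
    ultimately show ?case using LIMSEQ_unique by (auto simp: h_def)
  qed
  then have "AE y in lborel. y \<in> cube 0 (R / 2) \<longrightarrow> f (x0 + y) = rep (x0 + y)"
    unfolding AE_unif[OF R2] .
  from AE_lborel_shift[OF this, of "- x0"] show ?thesis
    by eventually_elim (use cube_shift[of x0 "- x0 + y" "R / 2" for y] in auto)
qed

text \<open>By Fubini the averages satisfy the integrated equation with averaged drift. The vector v
  stands for that drift frozen at the centre of the expansion.\<close>

lemma avg_increment:
  assumes p: "p \<in> cube x0 R" and q: "p + t *\<^sub>R axis j 1 \<in> cube x0 R" and t: "0 \<le> t" and r: "0 < r" "r \<le> R"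
    and \<epsilon>: "\<And>s. 0 \<le> s \<Longrightarrow> s \<le> t \<Longrightarrow>
      norm ((\<integral>y. drift j (p + s *\<^sub>R axis j 1 + y) \<partial>unif r) - v) \<le> \<epsilon>"
  shows "norm (avg r (p + t *\<^sub>R axis j 1) - avg r p + t *\<^sub>R v) \<le> \<epsilon> * t"
proof -
  define e :: "real^'d" where "e = axis j 1"
  interpret U: finite_measure "unif r :: (real^'d) measure" by (rule finite_unif[OF r(1)])
  interpret seg: finite_measure "seg_measure t" by (rule finite_seg_measure)
  interpret pair_sigma_finite "seg_measure t" "unif r :: (real^'d) measure" ..
  have mt: "measure (seg_measure t) (space (seg_measure t)) = t"
    using t by (simp add: measure_def seg_measure_def emeasure_restrict_space space_restrict_space)
  have T: "(\<lambda>s. p + s *\<^sub>R e) \<in> borel_measurable (seg_measure t)" by measurable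
  note int = pair_int(3)[OF finite_seg_measure T r(1)]
  have fsti: "integrable (seg_measure t) (\<lambda>s. \<integral>y. drift j (p + s *\<^sub>R e + y) \<partial>unif r)"
    using integrable_fst[OF int] by simp
  have "avg r (p + t *\<^sub>R e) - avg r p = (\<integral>y. f (p + t *\<^sub>R e + y) - f (p + y) \<partial>unif r)"
    unfolding avg_def by (intro Bochner_Integration.integral_diff[symmetric] shift_int r)
  also have "\<dots> = (\<integral>y. - (\<integral>s. drift j (p + s *\<^sub>R e + y) \<partial>seg_measure t) \<partial>unif r)"
  proof (rule integral_cong_AE)
    show "AE y in unif r. f (p + t *\<^sub>R e + y) - f (p + y) = - (\<integral>s. drift j (p + s *\<^sub>R e + y) \<partial>seg_measure t)"
      using incr_unif[OF p q t r] unfolding e_def .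
    show "(\<lambda>y. - (\<integral>s. drift j (p + s *\<^sub>R e + y) \<partial>seg_measure t)) \<in> borel_measurable (unif r)"
      using integrable_snd[OF int] by auto
  qed simp
  also have "\<dots> = - (\<integral>s. (\<integral>y. drift j (p + s *\<^sub>R e + y) \<partial>unif r) \<partial>seg_measure t)"
    using Fubini_integral[OF int] by simp
  finally have "avg r (p + t *\<^sub>R e) - avg r p + t *\<^sub>R v =
     - ((\<integral>s. (\<integral>y. drift j (p + s *\<^sub>R e + y) \<partial>unif r) \<partial>seg_measure t) - (\<integral>s. v \<partial>seg_measure t))"
    by (simp add: mt)
  also have "\<dots> = - (\<integral>s. (\<integral>y. drift j (p + s *\<^sub>R e + y) \<partial>unif r) - v \<partial>seg_measure t)"
    by (subst Bochner_Integration.integral_diff[OF fsti]) auto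
  finally have "norm (avg r (p + t *\<^sub>R e) - avg r p + t *\<^sub>R v) \<le>
      (\<integral>s. norm ((\<integral>y. drift j (p + s *\<^sub>R e + y) \<partial>unif r) - v) \<partial>seg_measure t)"
    by (simp add: integral_norm_bound)
  also have "\<dots> \<le> (\<integral>s. \<epsilon> \<partial>seg_measure t)"
  proof (rule integral_mono)
    show "integrable (seg_measure t) (\<lambda>s. norm ((\<integral>y. drift j (p + s *\<^sub>R e + y) \<partial>unif r) - v))"
      by (intro integrable_norm Bochner_Integration.integrable_diff fsti) simp
    show "integrable (seg_measure t) (\<lambda>s. \<epsilon>)" by simp
  qed (use \<epsilon> in \<open>auto simp: seg_measure_def space_restrict_space e_def\<close>)
  also have "\<dots> = \<epsilon> * t" by (simp add: mt)
  finally show ?thesis by (simp add: e_def)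
qed

text \<open>Near x0 the averaged drift is uniformly close to its frozen value, for all small radii
  at once. So the averages differ from an affine map by a small multiple of the distance, uniformly
  in the radius, and this first-order estimate passes to the limit.\<close>

lemma rep_has_derivative:
  assumes cont: "\<And>\<eta>. 0 < \<eta> \<Longrightarrow> \<exists>s>0. \<forall>x\<in>cube x0 s. \<forall>j v. norm (L j x v - L j x0 v) \<le> \<eta> * norm v"
  shows "(rep has_derivative (\<lambda>z. - (\<Sum>j\<in>UNIV. z $ j *\<^sub>R L j x0 (rep x0)))) (at x0)"
proof -
  define d where "d = real CARD('d)"
  have d: "d > 0" by (simp add: d_def)
  define v where "v j = L j x0 (rep x0)" for j
  have key: "\<exists>s>0. \<forall>q\<in>cube x0 s. norm (rep q - rep x0 + (\<Sum>j\<in>UNIV. (q - x0) $ j *\<^sub>R v j)) \<le> \<epsilon> * (\<Sum>i\<in>UNIV. \<bar>q $ i - x0 $ i\<bar>)"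
    if \<epsilon>: "\<epsilon> > 0" for \<epsilon>
  proof -
    \<comment> \<open>Half of the allowed error goes to freezing the operators L, whose effect is at
      most \<eta> K; the 1 keeps the denominator positive.\<close>
    define \<eta> where "\<eta> = \<epsilon> / (2 * (K + 1))"
    have \<eta>: "\<eta> > 0" "\<eta> * K \<le> \<epsilon> / 2"
      using \<epsilon> K_nonneg by (auto simp: \<eta>_def field_simps)
    obtain s0 where s0: "s0 > 0" "\<And>x j v. x \<in> cube x0 s0 \<Longrightarrow> norm (L j x v - L j x0 v) \<le> \<eta> * norm v"
      using cont[OF \<eta>(1)] by blast
    \<comment> \<open>Points q + y with q and y in cubes of radius at most s lie within 2 s of x0,
      hence s0 / 2. The last bound spends the other half of the error on the difference of
      \<open>avg r q\<close> and \<open>rep x0\<close>, at most 2 lip s.\<close>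
    define s where "s = min (min (R / 2) (s0 / 2)) (\<epsilon> / (4 * (C * lip + 1)))"
    have Cl: "0 \<le> C * lip" using C lip_nonneg by simp
    have s: "s > 0" "s \<le> R / 2" "2 * s \<le> s0" "C * (2 * lip * s) \<le> \<epsilon> / 2"
    proof -
      show "s > 0" using R s0 \<epsilon> Cl by (simp add: s_def)
      show "s \<le> R / 2" unfolding s_def by (rule min.coboundedI1[OF min.cobounded1])
      have "s \<le> s0 / 2" unfolding s_def by (rule min.coboundedI1[OF min.cobounded2])
      then show "2 * s \<le> s0" by simp
      have "s \<le> \<epsilon> / (4 * (C * lip + 1))" by (simp add: s_def)
      then have "s * (4 * (C * lip + 1)) \<le> \<epsilon>" using Cl by (simp add: pos_le_divide_eq)
      then show "C * (2 * lip * s) \<le> \<epsilon> / 2" using \<open>s > 0\<close> by (simp add: algebra_simps)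
    qed
    have sR: "cube x0 s \<subseteq> cube x0 R" using s R by (intro cube_mono) auto
    have x0c: "x0 \<in> cube x0 (R / 2)" "x0 \<in> cube x0 R" "x0 \<in> cube x0 s" using R s by (auto simp: center_in_cube)
    have G: "norm ((\<integral>y. drift j (q + y) \<partial>unif r) - v j) \<le> \<epsilon>"
      if q: "q \<in> cube x0 s" and r: "0 < r" "r \<le> s" for q r j
    proof -
      interpret U: finite_measure "unif r :: (real^'d) measure" by (rule finite_unif[OF r(1)])
      have bl: "bounded_linear (L j x0)" using lin by (simp add: linear_conv_bounded_linear)
      have qR: "q \<in> cube x0 R" and rR: "r \<le> R" "r \<le> R / 2" using q sR r s R by auto
      have i0: "integrable (unif r) (\<lambda>y. L j x0 (f (q + y)))"
        by (rule integrable_bounded_linear[OF bl shift_int[OF r(1)]])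
      have "(\<integral>y. drift j (q + y) \<partial>unif r) - L j x0 (avg r q) =
          (\<integral>y. drift j (q + y) \<partial>unif r) - (\<integral>y. L j x0 (f (q + y)) \<partial>unif r)"
        unfolding avg_def by (simp add: integral_bounded_linear[OF bl shift_int[OF r(1)]])
      also have "\<dots> = (\<integral>y. drift j (q + y) - L j x0 (f (q + y)) \<partial>unif r)"
        by (intro Bochner_Integration.integral_diff[symmetric] shift_int_L i0 r)
      also have "norm \<dots> \<le> (\<integral>y. norm (drift j (q + y) - L j x0 (f (q + y))) \<partial>unif r)"
        by (rule integral_norm_bound)
      also have "\<dots> \<le> (\<integral>y. \<eta> * norm (f (q + y)) \<partial>unif r)"
      proof (rule integral_mono_AE)
        show "integrable (unif r) (\<lambda>y. norm (drift j (q + y) - L j x0 (f (q + y))))"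
          by (intro integrable_norm Bochner_Integration.integrable_diff shift_int_L i0 r)
        show "integrable (unif r) (\<lambda>y. \<eta> * norm (f (q + y)))"
          by (intro integrable_mult_right integrable_norm shift_int r)
        have "q + y \<in> cube x0 s0" if "y \<in> cube 0 r" for y
          using cube_add[OF q that] cube_mono[of "s + r" s0 x0] r s by auto
        then show "AE y in unif r. norm (drift j (q + y) - L j x0 (f (q + y))) \<le> \<eta> * norm (f (q + y))"
          unfolding AE_unif[OF r(1)] using s0(2) by auto
      qed
      also have "\<dots> \<le> \<eta> * K"
        using absavg_le_K[OF qR r(1) rR(1)] \<eta>(1) by (simp add: absavg_def)
      finally have 1: "norm ((\<integral>y. drift j (q + y) \<partial>unif r) - L j x0 (avg r q)) \<le> \<epsilon> / 2"
        using \<eta> by linarith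
      have "norm (avg r q - rep x0) \<le> norm (avg r q - avg r x0) + norm (avg r x0 - rep x0)"
        using norm_triangle_ineq[of "avg r q - avg r x0" "avg r x0 - rep x0"] by simp
      also have "\<dots> \<le> lip * s + lip * r"
        by (intro add_mono avg_Lipschitz_cube avg_rep_le x0c qR r rR q)
      also have "\<dots> \<le> lip * s + lip * s" using r lip_nonneg by (intro add_mono mult_left_mono) auto
      finally have "C * norm (avg r q - rep x0) \<le> C * (2 * lip * s)" using C by (intro mult_left_mono) (simp_all add: mult_ac)
      moreover have "norm (L j x0 (avg r q) - v j) \<le> C * norm (avg r q - rep x0)"
        unfolding v_def linear_diff[OF lin, symmetric] by (rule L_le)
      ultimately have 2: "norm (L j x0 (avg r q) - v j) \<le> \<epsilon> / 2" using s by linarith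
      show ?thesis
        using norm_triangle_ineq[of "(\<integral>y. drift j (q + y) \<partial>unif r) - L j x0 (avg r q)" "L j x0 (avg r q) - v j"] 1 2
        by simp
    qed
    have A: "norm (avg r q - avg r x0 + (\<Sum>j\<in>UNIV. (q - x0) $ j *\<^sub>R v j)) \<le> \<epsilon> * (\<Sum>i\<in>UNIV. \<bar>q $ i - x0 $ i\<bar>)"
      if q: "q \<in> cube x0 s" and r: "0 < r" "r \<le> s" for q r
    proof -
      \<comment> \<open>Removing the expected linear part leaves a function whose axis-parallel
        increments are at most \<epsilon> times their length, ready for
        \<open>coordinate_chain\<close>.\<close>
      define G where "G q = avg r q + (\<Sum>j\<in>UNIV. (q - x0) $ j *\<^sub>R v j)" for q
      have "norm (G q - G x0) \<le> \<epsilon> * (\<Sum>i\<in>UNIV. \<bar>q $ i - x0 $ i\<bar>)"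
      proof (rule coordinate_chain[where D="\<lambda>p q. norm (G q - G p)", OF _ _ _ _ x0c(3) q])
        fix p j and t :: real
        assume p: "p \<in> cube x0 s" and pt: "p + t *\<^sub>R axis j 1 \<in> cube x0 s" and t: "0 \<le> t"
        have "(\<Sum>i\<in>UNIV. (p + t *\<^sub>R axis j 1 - x0) $ i *\<^sub>R v i) - (\<Sum>i\<in>UNIV. (p - x0) $ i *\<^sub>R v i)
            = (\<Sum>i\<in>UNIV. if i = j then t *\<^sub>R v j else 0)"
          by (subst sum_subtractf[symmetric], rule sum.cong) (auto simp: axis_def algebra_simps)
        then have "G (p + t *\<^sub>R axis j 1) - G p = avg r (p + t *\<^sub>R axis j 1) - avg r p + t *\<^sub>R v j"
          by (simp add: G_def algebra_simps)
        also have "norm \<dots> \<le> \<epsilon> * t"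
        proof (rule avg_increment[OF _ _ t r(1)])
          fix u :: real assume u: "0 \<le> u" "u \<le> t"
          have *: "axis j (1::real) $ i = 0 \<or> axis j (1::real) $ i = 1" for i by (auto simp: axis_def)
          have "p + u *\<^sub>R axis j 1 \<in> cube x0 s"
            unfolding cube_def
          proof (clarify)
            fix i
            have "\<bar>p $ i - x0 $ i\<bar> < s" "\<bar>(p + t *\<^sub>R axis j 1) $ i - x0 $ i\<bar> < s" using p pt by (auto simp: cube_def)
            then show "\<bar>(p + u *\<^sub>R axis j 1) $ i - x0 $ i\<bar> < s" using *[of i] u by auto
          qed
          from G[OF this r]
          show "norm ((\<integral>y. drift j (p + u *\<^sub>R axis j 1 + y) \<partial>unif r) - v j) \<le> \<epsilon>" .
        qed (use p pt sR r s R in auto)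
        finally show "norm (G (p + t *\<^sub>R axis j 1) - G p) \<le> \<epsilon> * t" .
      next
        fix p q u
        show "norm (G u - G p) \<le> norm (G q - G p) + norm (G u - G q)"
          using norm_triangle_ineq[of "G q - G p" "G u - G q"] by simp
      qed (simp_all add: norm_minus_commute)
      then show ?thesis by (simp add: G_def algebra_simps)
    qed
    have "norm (rep q - rep x0 + (\<Sum>j\<in>UNIV. (q - x0) $ j *\<^sub>R v j)) \<le> \<epsilon> * (\<Sum>i\<in>UNIV. \<bar>q $ i - x0 $ i\<bar>)"
      if q: "q \<in> cube x0 s" for q
    proof (rule tendsto_le[OF sequentially_bot tendsto_const])
      have "q \<in> cube x0 (R / 2)" using q s cube_mono by blast
      then show "(\<lambda>n. norm (avg (radius n) q - avg (radius n) x0 + (\<Sum>j\<in>UNIV. (q - x0) $ j *\<^sub>R v j)))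
          \<longlonglongrightarrow> norm (rep q - rep x0 + (\<Sum>j\<in>UNIV. (q - x0) $ j *\<^sub>R v j))"
        by (intro tendsto_intros avg_tendsto_rep x0c)
      show "\<forall>\<^sub>F n in sequentially. norm (avg (radius n) q - avg (radius n) x0 + (\<Sum>j\<in>UNIV. (q - x0) $ j *\<^sub>R v j))
          \<le> \<epsilon> * (\<Sum>i\<in>UNIV. \<bar>q $ i - x0 $ i\<bar>)"
        using radius_eventually[OF s(1)] by eventually_elim (intro A q radius_pos)
    qed
    then show ?thesis using s(1) by blast
  qed
  show ?thesis
    unfolding has_derivative_at_alt
  proof (intro conjI allI impI)
    have "linear (\<lambda>z. - (\<Sum>j\<in>UNIV. z $ j *\<^sub>R L j x0 (rep x0)))"
      by (rule linearI) (simp_all add: algebra_simps sum.distrib scaleR_sum_right)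
    then show "bounded_linear (\<lambda>z. - (\<Sum>j\<in>UNIV. z $ j *\<^sub>R L j x0 (rep x0)))"
      by (simp add: linear_conv_bounded_linear)
    fix e :: real assume e: "0 < e"
    \<comment> \<open>The l1 norm is at most d times the Euclidean norm; e / d compensates for
      this.\<close>
    obtain s where s: "s > 0" "\<And>q. q \<in> cube x0 s \<Longrightarrow>
        norm (rep q - rep x0 + (\<Sum>j\<in>UNIV. (q - x0) $ j *\<^sub>R v j)) \<le> e / d * (\<Sum>i\<in>UNIV. \<bar>q $ i - x0 $ i\<bar>)"
      using key[of "e / d"] e d by auto
    have "norm (rep q - rep x0 - - (\<Sum>j\<in>UNIV. (q - x0) $ j *\<^sub>R L j x0 (rep x0))) \<le> e * norm (q - x0)"
      if q: "norm (q - x0) < s" for q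
    proof -
      have le: "\<bar>q $ i - x0 $ i\<bar> \<le> norm (q - x0)" for i using component_le_norm_cart[of "q - x0" i] by simp
      then have "q \<in> cube x0 s" unfolding cube_def using q by (auto intro: le_less_trans)
      from s(2)[OF this] have "norm (rep q - rep x0 + (\<Sum>j\<in>UNIV. (q - x0) $ j *\<^sub>R v j)) \<le> e / d * (\<Sum>i\<in>UNIV. \<bar>q $ i - x0 $ i\<bar>)" .
      also have "\<dots> \<le> e / d * (\<Sum>i\<in>(UNIV :: 'd set). norm (q - x0))"
        using e d by (intro mult_left_mono sum_mono le) auto
      also have "\<dots> = e * norm (q - x0)" using d by (simp add: d_def)
      finally show ?thesis by (simp add: v_def)
    qed
    then show "\<exists>da>0. \<forall>y. norm (y - x0) < da \<longrightarrow>
        norm (rep y - rep x0 - - (\<Sum>j\<in>UNIV. (y - x0) $ j *\<^sub>R L j x0 (rep x0))) \<le> e * norm (y - x0)"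
      using s(1) by blast
  qed
qed

end

section \<open>Linear ordinary differential equations\<close>

text \<open>The matrix-valued one-form b evaluated in direction h and applied to v. The order of the
  factors matches the equation in \<open>transport\<close>.\<close>

definition contr :: "real^'n^'d^'n \<Rightarrow> real^'d::finite \<Rightarrow> real^'n \<Rightarrow> real^'n::finite" where
  "contr b h v = (\<chi> i. \<Sum>j\<in>UNIV. \<Sum>k\<in>UNIV. b $ i $ j $ k * v $ k * h $ j)"

lemma contr_add: "contr (b + b') h v = contr b h v + contr b' h v"
    "contr b (h + h') v = contr b h v + contr b h' v"
    "contr b h (v + v') = contr b h v + contr b h v'"
  by (simp_all add: contr_def vec_eq_iff sum.distrib algebra_simps)

lemma contr_scaleR: "contr (c *\<^sub>R b) h v = c *\<^sub>R contr b h v"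
    "contr b (c *\<^sub>R h) v = c *\<^sub>R contr b h v"
    "contr b h (c *\<^sub>R v) = c *\<^sub>R contr b h v"
  by (simp_all add: contr_def vec_eq_iff sum_distrib_left mult_ac)

lemma contr_diff: "contr (b - b') h v = contr b h v - contr b' h v"
    "contr b (h - h') v = contr b h v - contr b h' v"
    "contr b h (v - v') = contr b h v - contr b h v'"
  by (simp_all add: contr_def vec_eq_iff sum_subtractf algebra_simps)

lemma contr_zero [simp]: "contr 0 h v = 0" "contr b 0 v = 0" "contr b h 0 = 0"
  by (simp_all add: contr_def vec_eq_iff)

lemma contr_axis_nth: "contr b (axis j 1) v $ i = (\<Sum>k\<in>UNIV. b $ i $ j $ k * v $ k)"
proof -
  have "contr b (axis j 1) v $ i = (\<Sum>j'\<in>UNIV. \<Sum>k\<in>UNIV. b $ i $ j' $ k * v $ k * axis j 1 $ j')"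
    by (simp add: contr_def)
  also have "\<dots> = (\<Sum>j'\<in>UNIV. if j' = j then \<Sum>k\<in>UNIV. b $ i $ j $ k * v $ k else 0)"
    by (intro sum.cong refl) (auto simp: axis_def)
  finally show ?thesis by simp
qed

lemma contr_axis: "contr b h v = (\<Sum>j\<in>UNIV. h $ j *\<^sub>R contr b (axis j 1) v)"
  by (simp add: vec_eq_iff contr_axis_nth) (simp add: contr_def sum_distrib_left mult_ac)

lemma abs_sum_UNIV_le:
  fixes f :: "'a::finite \<Rightarrow> real"
  assumes "\<And>i. \<bar>f i\<bar> \<le> K"
  shows "\<bar>\<Sum>i\<in>UNIV. f i\<bar> \<le> real CARD('a) * K"
proof -
  have "(\<Sum>i\<in>UNIV. \<bar>f i\<bar>) \<le> real CARD('a) * K"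
    using sum_bounded_above[of UNIV "\<lambda>i. \<bar>f i\<bar>" K] assms by simp
  then show ?thesis using sum_abs[of f UNIV] by linarith
qed

lemma norm_contr_le:
  fixes b :: "real^'n::finite^'d::finite^'n"
  shows "norm (contr b h v) \<le> real CARD('n) * (real CARD('d) * (real CARD('n) * (norm b * norm v * norm h)))"
proof -
  have le: "\<bar>b $ i $ j $ k * v $ k * h $ j\<bar> \<le> norm b * norm v * norm h" for i j k
  proof -
    have 1: "\<bar>b $ i $ j $ k\<bar> \<le> norm b"
      using component_le_norm_cart[of "b $ i $ j" k] Finite_Cartesian_Product.norm_nth_le[of "b $ i" j]
        Finite_Cartesian_Product.norm_nth_le[of b i] by linarith
    show ?thesis
      unfolding abs_mult
      by (rule mult_mono[OF mult_mono[OF 1 component_le_norm_cart] component_le_norm_cart]) simp_all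
  qed
  have "\<bar>contr b h v $ i\<bar> \<le> real CARD('d) * (real CARD('n) * (norm b * norm v * norm h))" for i
    unfolding contr_def vec_lambda_beta by (rule abs_sum_UNIV_le, rule abs_sum_UNIV_le, rule le)
  then have "\<bar>\<Sum>i\<in>UNIV. \<bar>contr b h v $ i\<bar>\<bar> \<le> real CARD('n) * (real CARD('d) * (real CARD('n) * (norm b * norm v * norm h)))"
    by (intro abs_sum_UNIV_le) simp
  then show ?thesis using norm_le_l1_cart[of "contr b h v"] by linarith
qed

lemma continuous_on_contr [continuous_intros]:
  assumes "continuous_on S b" "continuous_on S h" "continuous_on S v"
  shows "continuous_on S (\<lambda>x. contr (b x) (h x) (v x))"
  unfolding contr_def
  by (intro continuous_on_vec_lambda continuous_intros assms)

lemma linear_contr: "linear (contr b h)" "linear (\<lambda>h. contr b h v)"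
  by (auto intro!: linearI simp: contr_add contr_scaleR)

text \<open>The squared norm is differentiable even where \<phi> vanishes. Weighted with exp(-2 L t)
  it has nonpositive derivative by Cauchy-Schwarz, and the mean value theorem compares its end
  values.\<close>

lemma gronwall:
  fixes \<phi> :: "real \<Rightarrow> 'a::real_inner"
  assumes ab: "a \<le> b"
    and d: "\<And>t. t \<in> {a..b} \<Longrightarrow> (\<phi> has_vector_derivative \<phi>' t) (at t within {a..b})"
    and le: "\<And>t. t \<in> {a..b} \<Longrightarrow> norm (\<phi>' t) \<le> L * norm (\<phi> t)"
  shows "norm (\<phi> b) \<le> exp (L * (b - a)) * norm (\<phi> a)"
proof -
  define g where "g t = exp (- (2 * L * t)) * (\<phi> t \<bullet> \<phi> t)" for t
  define g' where "g' t = exp (- (2 * L * t)) * (2 * (\<phi> t \<bullet> \<phi>' t) - 2 * L * (\<phi> t \<bullet> \<phi> t))" for t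
  have "g b \<le> g a"
  proof (cases "a = b")
    case False
    then have "a < b" using ab by simp
    have dg: "(g has_derivative (\<lambda>h. h * g' t)) (at t within {a..b})" if "t \<in> {a..b}" for t
    proof -
      have "(\<phi> has_derivative (\<lambda>h. h *\<^sub>R \<phi>' t)) (at t within {a..b})"
        using d[OF that] by (simp add: has_vector_derivative_def)
      moreover have "((\<lambda>t. exp (- (2 * L * t))) has_real_derivative exp (- (2 * L * t)) * - (2 * L)) (at t within {a..b})"
        by (auto intro!: derivative_eq_intros)
      ultimately have "(g has_derivative (\<lambda>h. exp (- (2 * L * t)) * (\<phi> t \<bullet> (h *\<^sub>R \<phi>' t) + (h *\<^sub>R \<phi>' t) \<bullet> \<phi> t) +
          exp (- (2 * L * t)) * - (2 * L) * h * (\<phi> t \<bullet> \<phi> t))) (at t within {a..b})"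
        unfolding g_def has_field_derivative_def by (intro has_derivative_mult has_derivative_inner)
      then show ?thesis
        by (rule has_derivative_eq_rhs) (auto simp: g'_def algebra_simps inner_commute)
    qed
    then obtain t where t: "t \<in> {a<..<b}" "g b - g a = (b - a) * g' t"
      using mvt_simple[OF \<open>a < b\<close>, of g "\<lambda>t h. h * g' t"] by auto
    have "\<phi> t \<bullet> \<phi>' t \<le> norm (\<phi> t) * norm (\<phi>' t)" by (rule norm_cauchy_schwarz)
    also have "\<dots> \<le> norm (\<phi> t) * (L * norm (\<phi> t))" using le[of t] t by (intro mult_left_mono) auto
    also have "\<dots> = L * (\<phi> t \<bullet> \<phi> t)" by (simp add: power2_norm_eq_inner[symmetric] power2_eq_square)
    finally have "g' t \<le> 0" unfolding g'_def by (intro mult_nonneg_nonpos) auto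
    then have "(b - a) * g' t \<le> 0" using ab by (intro mult_nonneg_nonpos) auto
    then show ?thesis using t by simp
  qed simp
  then have "exp (2 * L * b) * g b \<le> exp (2 * L * b) * g a" by (intro mult_left_mono) auto
  moreover have "exp (2 * L * b) * g b = \<phi> b \<bullet> \<phi> b"
    by (simp add: g_def exp_minus)
  moreover have "exp (2 * L * b) * g a = (exp (L * (b - a)))\<^sup>2 * (\<phi> a \<bullet> \<phi> a)"
  proof -
    have "exp (2 * L * b) * exp (- (2 * L * a)) = exp (2 * (L * (b - a)))"
      by (subst exp_add[symmetric]) (simp add: algebra_simps)
    then show ?thesis by (simp add: g_def exp_double)
  qed
  ultimately have "(norm (\<phi> b))\<^sup>2 \<le> (exp (L * (b - a)) * norm (\<phi> a))\<^sup>2"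
    by (simp add: power2_norm_eq_inner power_mult_distrib)
  then show ?thesis by (rule power2_le_imp_le) simp
qed

text \<open>Constant continuation beyond the unit interval places the fixed point problem in the
  complete space of bounded continuous functions on the line.\<close>

lemma bcontfun_extend:
  fixes g :: "real \<Rightarrow> 'a::real_normed_vector"
  assumes "continuous_on {0..1} g"
  shows "(\<lambda>t. g (max 0 (min 1 t))) \<in> bcontfun"
  unfolding bcontfun_def
proof (intro CollectI conjI)
  show "continuous_on UNIV (\<lambda>t. g (max 0 (min 1 t)))"
    by (rule continuous_on_compose2[OF assms]) (auto intro!: continuous_intros)
  have "bounded (g ` {0..1})"
    by (intro compact_imp_bounded compact_continuous_image assms) simp
  then show "bounded (range (\<lambda>t. g (max 0 (min 1 t))))"
    by (rule bounded_subset) auto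
qed

text \<open>The solution is sought in the form exp (c t) times the fixed point of an integral operator, which
  is a contraction for the sup norm as soon as c exceeds the bound L of the equation.\<close>

lemma linear_ode_exists:
  fixes F :: "real \<Rightarrow> 'a::euclidean_space \<Rightarrow> 'a"
  assumes lin: "\<And>t. linear (F t)"
    and bound: "\<And>t x. t \<in> {0..1} \<Longrightarrow> norm (F t x) \<le> L * norm x"
    and cont: "\<And>\<psi>. continuous_on {0..1} \<psi> \<Longrightarrow> continuous_on {0..1} (\<lambda>t. F t (\<psi> t))"
    and L: "0 \<le> L"
  obtains \<phi> where "\<phi> 0 = v" "\<And>t. t \<in> {0..1} \<Longrightarrow> (\<phi> has_vector_derivative F t (\<phi> t)) (at t within {0..1})"
proof -
  \<comment> \<open>This choice makes the contraction constant L / c at most 1 / 2; the summand 1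
    keeps c positive when L = 0.\<close>
  define c where "c = 2 * L + 1"
  have c: "c > 0" "L / c \<le> 1 / 2" using L by (auto simp: c_def field_simps)
  define H where "H \<psi> s = exp (c * s) *\<^sub>R F s (apply_bcontfun \<psi> s)" for \<psi> s
  define G where "G \<psi> \<tau> = exp (- (c * \<tau>)) *\<^sub>R (v + integral {0..\<tau>} (H \<psi>))" for \<psi> \<tau>
  define Op where "Op \<psi> = Bcontfun (\<lambda>t. G \<psi> (max 0 (min 1 t)))" for \<psi>
  have ci: "continuous_on {0..1} (H \<psi>)" for \<psi>
    unfolding H_def by (intro continuous_intros cont continuous_on_apply_bcontfun)
  have int: "H \<psi> integrable_on {0..\<tau>}" if "\<tau> \<in> {0..1}" for \<psi> \<tau>
    using that by (intro integrable_continuous_real continuous_on_subset[OF ci]) auto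
  have "continuous_on {0..1} (G \<psi>)" for \<psi>
    unfolding G_def
    by (intro continuous_intros indefinite_integral_continuous_1 integrable_continuous_real ci)
  then have Op: "apply_bcontfun (Op \<psi>) t = G \<psi> (max 0 (min 1 t))" for \<psi> t
    unfolding Op_def by (subst Bcontfun_inverse[OF bcontfun_extend]) auto
  have contraction: "dist (Op \<psi>) (Op \<theta>) \<le> 1 / 2 * dist \<psi> \<theta>" for \<psi> \<theta>
  proof (rule dist_bound)
    fix t :: real
    define \<tau> where "\<tau> = max 0 (min 1 t)"
    have \<tau>: "\<tau> \<in> {0..1}" by (simp add: \<tau>_def max_def min_def)
    define d where "d = dist \<psi> \<theta>"
    have "G \<psi> \<tau> - G \<theta> \<tau> = exp (- (c * \<tau>)) *\<^sub>R (integral {0..\<tau>} (H \<psi>) - integral {0..\<tau>} (H \<theta>))"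
      by (simp add: G_def algebra_simps)
    also have "\<dots> = exp (- (c * \<tau>)) *\<^sub>R integral {0..\<tau>} (\<lambda>s. H \<psi> s - H \<theta> s)"
      by (subst Henstock_Kurzweil_Integration.integral_diff[OF int[OF \<tau>] int[OF \<tau>]]) simp
    also have "norm \<dots> = exp (- (c * \<tau>)) * norm (integral {0..\<tau>} (\<lambda>s. H \<psi> s - H \<theta> s))"
      by simp
    also have "\<dots> \<le> exp (- (c * \<tau>)) * (L * d * ((exp (c * \<tau>) - 1) / c))"
    proof (intro mult_left_mono)
      have I: "((\<lambda>s. L * d * exp (c * s)) has_integral L * d * (exp (c * \<tau>) / c) - L * d * (exp (c * 0) / c)) {0..\<tau>}"
        by (rule fundamental_theorem_of_calculus)
           (use \<tau> c in \<open>auto intro!: derivative_eq_intros simp flip: has_real_derivative_iff_has_vector_derivative\<close>)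
      have "norm (integral {0..\<tau>} (\<lambda>s. H \<psi> s - H \<theta> s))
        \<le> integral {0..\<tau>} (\<lambda>s. L * d * exp (c * s))"
      proof (rule integral_norm_bound_integral)
        show "(\<lambda>s. H \<psi> s - H \<theta> s) integrable_on {0..\<tau>}"
          by (intro integrable_diff int \<tau>)
        show "(\<lambda>s. L * d * exp (c * s)) integrable_on {0..\<tau>}" using I by blast
        fix s assume s: "s \<in> {0..\<tau>}"
        have "norm (F s (apply_bcontfun \<psi> s - apply_bcontfun \<theta> s)) \<le> L * norm (apply_bcontfun \<psi> s - apply_bcontfun \<theta> s)"
          using s \<tau> by (intro bound) auto
        also have "\<dots> \<le> L * d"
          using dist_bounded[of \<psi> s \<theta>] L by (intro mult_left_mono) (auto simp: d_def dist_norm)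
        finally have *: "norm (F s (apply_bcontfun \<psi> s - apply_bcontfun \<theta> s)) \<le> L * d" .
        have "norm (H \<psi> s - H \<theta> s) = exp (c * s) * norm (F s (apply_bcontfun \<psi> s - apply_bcontfun \<theta> s))"
          by (simp add: H_def linear_diff[OF lin] flip: scaleR_diff_right)
        also have "\<dots> \<le> exp (c * s) * (L * d)" using * by (intro mult_left_mono) auto
        finally show "norm (H \<psi> s - H \<theta> s) \<le> L * d * exp (c * s)"
          by (simp add: mult_ac)
      qed
      also have "\<dots> = L * d * ((exp (c * \<tau>) - 1) / c)"
        using integral_unique[OF I] by (simp add: diff_divide_distrib right_diff_distrib)
      finally show "norm (integral {0..\<tau>} (\<lambda>s. H \<psi> s - H \<theta> s))
        \<le> L * d * ((exp (c * \<tau>) - 1) / c)" .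
    qed simp
    also have "\<dots> = L / c * d * (1 - exp (- (c * \<tau>)))"
      by (simp add: exp_minus field_simps)
    also have "\<dots> \<le> 1 / 2 * d * 1" using c L \<tau> by (intro mult_mono) (auto simp: d_def)
    finally show "dist (apply_bcontfun (Op \<psi>) t) (apply_bcontfun (Op \<theta>) t) \<le> 1 / 2 * dist \<psi> \<theta>"
      by (simp add: Op dist_norm \<tau>_def d_def)
  qed
  then have "\<exists>!\<psi>. Op \<psi> = \<psi>" by (intro banach_fix_type[of "1 / 2"]) auto
  then obtain \<psi> where \<psi>: "Op \<psi> = \<psi>" by blast
  define \<phi> where "\<phi> t = exp (c * t) *\<^sub>R apply_bcontfun \<psi> t" for t
  \<comment> \<open>Linearity pulls the weight inside F, so the fixed point equation for \<psi> is
    the integral equation for \<phi>.\<close>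
  have lin_eq: "H \<psi> = (\<lambda>s. F s (\<phi> s))"
    by (rule ext) (simp add: H_def \<phi>_def linear_scale[OF lin])
  have \<phi>: "\<phi> t = v + integral {0..t} (\<lambda>s. F s (\<phi> s))" if "t \<in> {0..1}" for t
  proof -
    have "apply_bcontfun \<psi> t = G \<psi> t" using Op[of \<psi> t] \<psi> that by (simp add: max_absorb2 min_absorb2)
    then show ?thesis by (simp add: \<phi>_def[of t] G_def lin_eq exp_minus)
  qed
  have c\<phi>: "continuous_on {0..1} (\<lambda>s. F s (\<phi> s))" using ci[of \<psi>] unfolding lin_eq .
  show ?thesis
  proof
    show "\<phi> 0 = v" using \<phi>[of 0] by simp
    fix t :: real assume t: "t \<in> {0..1}"
    have "((\<lambda>t. v + integral {0..t} (\<lambda>s. F s (\<phi> s))) has_vector_derivative F t (\<phi> t)) (at t within {0..1})"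
      using has_vector_derivative_add[OF has_vector_derivative_const integral_has_vector_derivative[OF c\<phi> t]] by simp
    then show "(\<phi> has_vector_derivative F t (\<phi> t)) (at t within {0..1})"
      by (rule has_vector_derivative_transform[OF t, rotated]) (use \<phi> in auto)
  qed
qed

section \<open>Parallel transport and parallel sections\<close>

definition smoothstep :: "real \<Rightarrow> real" where
  "smoothstep t = t * t * (3 - 2 * t)"

lemma smoothstep_in: "t \<in> {0..1} \<Longrightarrow> smoothstep t \<in> {0..1}"
proof -
  assume t: "t \<in> {0..1}"
  have "0 \<le> (1 - t) * (1 - t) * (1 + 2 * t)" using t by (intro mult_nonneg_nonneg) auto
  also have "\<dots> = 1 - smoothstep t" by (simp add: smoothstep_def algebra_simps)
  finally have "smoothstep t \<le> 1" by simp
  moreover have "0 \<le> smoothstep t" using t unfolding smoothstep_def by (intro mult_nonneg_nonneg) auto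
  ultimately show ?thesis by simp
qed

lemma smoothstep_0_1 [simp]: "smoothstep 0 = 0" "smoothstep 1 = 1"
  by (simp_all add: smoothstep_def)

lemma smoothstep_deriv: "(smoothstep has_real_derivative 6 * t * (1 - t)) (at t within S)"
  unfolding smoothstep_def by (auto intro!: derivative_eq_intros simp: algebra_simps)

text \<open>Slowing both curves down to speed 0 at the junction keeps the concatenation C1.\<close>

definition joinc :: "(real \<Rightarrow> 'a) \<Rightarrow> (real \<Rightarrow> 'a) \<Rightarrow> real \<Rightarrow> 'a" where
  "joinc f g t = (if t \<in> {0..1/2} then f (smoothstep (2 * t)) else g (smoothstep (2 * t - 1)))"

text \<open>The scalar factors are the chain-rule speeds of the two reparametrisations. Both vanish
  at t = 1/2, so D and E may disagree at the junction.\<close>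

definition joinc_deriv :: "(real \<Rightarrow> 'a::real_vector) \<Rightarrow> (real \<Rightarrow> 'a) \<Rightarrow> real \<Rightarrow> 'a" where
  "joinc_deriv D E t = (if t \<in> {0..1/2} then (24 * t * (1 - 2 * t)) *\<^sub>R D (smoothstep (2 * t))
     else (24 * (2 * t - 1) * (1 - t)) *\<^sub>R E (smoothstep (2 * t - 1)))"

text \<open>The general target type matters: the lemma is applied to the curves in the domain and to
  the solutions transported along them.\<close>

lemma joinc_has_deriv:
  fixes f g :: "real \<Rightarrow> 'a::real_normed_vector"
  assumes f: "\<And>t. t \<in> {0..1} \<Longrightarrow> (f has_vector_derivative D t) (at t within {0..1})"
    and g: "\<And>t. t \<in> {0..1} \<Longrightarrow> (g has_vector_derivative E t) (at t within {0..1})"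
    and fg: "f 1 = g 0" and t: "t \<in> {0..1}"
  shows "(joinc f g has_vector_derivative joinc_deriv D E t) (at t within {0..1})"
proof -
  have cl: "closure {0..1/2::real} \<inter> closure {1/2<..1} = {1/2}" by auto
  have S: "{0..1/2} \<union> {1/2} = {0..1/2::real}" "{1/2<..1} \<union> {1/2} = {1/2..1::real}" by auto
  have "((\<lambda>t. if t \<in> {0..1/2} then f (smoothstep (2 * t)) else g (smoothstep (2 * t - 1)))
      has_vector_derivative joinc_deriv D E t) (at t within {0..1})"
    unfolding joinc_deriv_def
  proof (rule has_vector_derivative_If_within_closures[where T="{1/2<..1}"])
    show "t \<in> {0..1/2} \<union> {1/2<..1}" "{0..1} = {0..1/2} \<union> {1/2<..1::real}" using t by auto
    assume "t \<in> {0..1/2} \<union> closure {0..1/2} \<inter> closure {1/2<..1}"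
    then have t: "t \<in> {0..1/2}" unfolding cl by auto
    have "((\<lambda>t. smoothstep (2 * t)) has_real_derivative 6 * (2 * t) * (1 - 2 * t) * 2) (at t within {0..1/2})"
      by (rule DERIV_chain2[OF smoothstep_deriv]) (auto intro!: derivative_eq_intros)
    then have 1: "((\<lambda>t. smoothstep (2 * t)) has_vector_derivative 24 * t * (1 - 2 * t)) (at t within {0..1/2})"
      by (simp add: has_real_derivative_iff_has_vector_derivative mult_ac)
    have "smoothstep (2 * t) \<in> {0..1}" using t by (intro smoothstep_in) auto
    from has_vector_derivative_within_subset[OF f[OF this], of "(\<lambda>t. smoothstep (2 * t)) ` {0..1/2}"]
    have 2: "(f has_vector_derivative D (smoothstep (2 * t))) (at (smoothstep (2 * t)) within (\<lambda>t. smoothstep (2 * t)) ` {0..1/2})"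
      using smoothstep_in[of "2 * s" for s] by force
    show "((\<lambda>t. f (smoothstep (2 * t))) has_vector_derivative (24 * t * (1 - 2 * t)) *\<^sub>R D (smoothstep (2 * t)))
        (at t within {0..1/2} \<union> closure {0..1/2} \<inter> closure {1/2<..1})"
      using vector_diff_chain_within[OF 1 2] unfolding cl S by (simp add: o_def)
  next
    assume "t \<in> {1/2<..1} \<union> closure {0..1/2} \<inter> closure {1/2<..1}"
    then have t: "t \<in> {1/2..1}" unfolding cl by auto
    have "((\<lambda>t. smoothstep (2 * t - 1)) has_real_derivative 6 * (2 * t - 1) * (1 - (2 * t - 1)) * 2) (at t within {1/2..1})"
      by (rule DERIV_chain2[OF smoothstep_deriv]) (auto intro!: derivative_eq_intros)
    moreover have "6 * (2 * t - 1) * (1 - (2 * t - 1)) * 2 = 24 * (2 * t - 1) * (1 - t)" by (simp add: algebra_simps)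
    ultimately have 1: "((\<lambda>t. smoothstep (2 * t - 1)) has_vector_derivative 24 * (2 * t - 1) * (1 - t)) (at t within {1/2..1})"
      by (simp only: has_real_derivative_iff_has_vector_derivative)
    have "smoothstep (2 * t - 1) \<in> {0..1}" using t by (intro smoothstep_in) auto
    from has_vector_derivative_within_subset[OF g[OF this], of "(\<lambda>t. smoothstep (2 * t - 1)) ` {1/2..1}"]
    have 2: "(g has_vector_derivative E (smoothstep (2 * t - 1))) (at (smoothstep (2 * t - 1)) within (\<lambda>t. smoothstep (2 * t - 1)) ` {1/2..1})"
      using smoothstep_in[of "2 * s - 1" for s] by force
    show "((\<lambda>t. g (smoothstep (2 * t - 1))) has_vector_derivative (24 * (2 * t - 1) * (1 - t)) *\<^sub>R E (smoothstep (2 * t - 1)))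
        (at t within {1/2<..1} \<union> closure {0..1/2} \<inter> closure {1/2<..1})"
      using vector_diff_chain_within[OF 1 2] unfolding cl S by (simp add: o_def)
  next
    assume "t \<in> closure {0..1/2}" "t \<in> closure {1/2<..1}"
    then have t2: "t = 1/2" using cl by blast
    show "f (smoothstep (2 * t)) = g (smoothstep (2 * t - 1))"
      "(24 * t * (1 - 2 * t)) *\<^sub>R D (smoothstep (2 * t)) = (24 * (2 * t - 1) * (1 - t)) *\<^sub>R E (smoothstep (2 * t - 1))"
      unfolding t2 using fg by simp_all
  qed
  then show ?thesis by (simp add: joinc_def[abs_def])
qed

lemma joinc_deriv_continuous:
  fixes D E :: "real \<Rightarrow> 'a::real_normed_vector"
  assumes "continuous_on {0..1} D" "continuous_on {0..1} E"
  shows "continuous_on {0..1} (joinc_deriv D E)"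
proof -
  have "continuous_on ({0..1/2} \<union> {1/2..1}) (joinc_deriv D E)"
    unfolding joinc_deriv_def[abs_def]
  proof (rule continuous_on_cases)
    show "continuous_on {0..1/2} (\<lambda>t. (24 * t * (1 - 2 * t)) *\<^sub>R D (smoothstep (2 * t)))"
    proof (intro continuous_intros continuous_on_compose2[OF assms(1)])
      show "continuous_on {0..1/2} (\<lambda>t. smoothstep (2 * t))" unfolding smoothstep_def by (intro continuous_intros)
    qed (use smoothstep_in[of "2 * t" for t] in force)
    show "continuous_on {1/2..1} (\<lambda>t. (24 * (2 * t - 1) * (1 - t)) *\<^sub>R E (smoothstep (2 * t - 1)))"
    proof (intro continuous_intros continuous_on_compose2[OF assms(2)])
      show "continuous_on {1/2..1} (\<lambda>t. smoothstep (2 * t - 1))" unfolding smoothstep_def by (intro continuous_intros)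
    qed (use smoothstep_in[of "2 * t - 1" for t] in force)
    show "\<forall>t. t \<in> {0..1/2} \<and> t \<notin> {0..1/2} \<or> t \<in> {1/2..1} \<and> t \<in> {0..1/2} \<longrightarrow>
      (24 * t * (1 - 2 * t)) *\<^sub>R D (smoothstep (2 * t)) = (24 * (2 * t - 1) * (1 - t)) *\<^sub>R E (smoothstep (2 * t - 1))"
    proof (intro allI impI)
      fix t :: real assume "t \<in> {0..1/2} \<and> t \<notin> {0..1/2} \<or> t \<in> {1/2..1} \<and> t \<in> {0..1/2}"
      then have t2: "t = 1/2" by auto
      show "(24 * t * (1 - 2 * t)) *\<^sub>R D (smoothstep (2 * t)) = (24 * (2 * t - 1) * (1 - t)) *\<^sub>R E (smoothstep (2 * t - 1))"
        unfolding t2 by simp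
    qed
  qed auto
  moreover have "{0..1/2} \<union> {1/2..1} = {0..1::real}" by auto
  ultimately show ?thesis by simp
qed

lemma joinc_ends: "joinc f g 0 = f 0" "joinc f g 1 = g 1"
  by (simp_all add: joinc_def)

lemma joinc_image: "joinc f g ` {0..1} \<subseteq> f ` {0..1} \<union> g ` {0..1}"
proof -
  have "joinc f g t \<in> f ` {0..1} \<union> g ` {0..1}" if "t \<in> {0..1}" for t
    using smoothstep_in[of "2 * t"] smoothstep_in[of "2 * t - 1"] that by (auto simp: joinc_def)
  then show ?thesis by blast
qed

text \<open>The velocity D is an explicit argument, so solutions can be handled without
  \<open>vector_derivative\<close>; \<open>transport_eqI\<close> reconnects the two.\<close>

definition parallel_along ::
  "(real^'d \<Rightarrow> real^'n^'d^'n::finite) \<Rightarrow> (real \<Rightarrow> real^'d::finite) \<Rightarrow> (real \<Rightarrow> real^'d) \<Rightarrow> (real \<Rightarrow> real^'n) \<Rightarrow> bool" where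
  "parallel_along B \<gamma> D \<phi> \<longleftrightarrow> (\<forall>t\<in>{0..1}. (\<gamma> has_vector_derivative D t) (at t within {0..1})) \<and>
     (\<forall>t\<in>{0..1}. (\<phi> has_vector_derivative - contr (B (\<gamma> t)) (D t) (\<phi> t)) (at t within {0..1}))"

definition parallel_section :: "(real^'d::finite) set \<Rightarrow> (real^'d \<Rightarrow> real^'n^'d^'n::finite) \<Rightarrow> (real^'d \<Rightarrow> real^'n) \<Rightarrow> bool" where
  "parallel_section \<Omega> B u \<longleftrightarrow> (\<forall>x\<in>\<Omega>. (u has_derivative (\<lambda>h. - contr (B x) h (u x))) (at x))"

lemma onorm_scaleR_le:
  assumes "norm v \<le> c" shows "onorm (\<lambda>s::real. s *\<^sub>R v) \<le> c"
proof (rule onorm_le)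
  show "norm (s *\<^sub>R v) \<le> c * norm s" for s :: real
    using mult_left_mono[OF assms, of "norm s"] by (simp add: mult.commute)
qed

locale connection =
  fixes \<Omega> :: "(real^'d::finite) set" and B :: "real^'d \<Rightarrow> real^'n^'d^'n::finite" and C :: real
  assumes op: "open \<Omega>" and conn: "connected \<Omega>" and contB: "continuous_on \<Omega> B"
    and C: "0 \<le> C" and B_le: "\<And>x h v. x \<in> \<Omega> \<Longrightarrow> norm (contr (B x) h v) \<le> C * norm h * norm v"
begin

section \<open>Well-posedness and composition of transport\<close>

lemma parallel_unique:
  assumes "parallel_along B \<gamma> D \<phi>" "parallel_along B \<gamma> D \<psi>" "continuous_on {0..1} D" "\<gamma> ` {0..1} \<subseteq> \<Omega>" "\<phi> 0 = \<psi> 0"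
  shows "\<phi> 1 = \<psi> 1"
proof -
  have "bounded (D ` {0..1})" by (intro compact_imp_bounded compact_continuous_image assms) simp
  then have "\<exists>M. \<forall>t\<in>{0..1}. norm (D t) \<le> M" by (simp add: bounded_iff)
  then obtain M where M: "\<And>t. t \<in> {0..1} \<Longrightarrow> norm (D t) \<le> M" by blast
  have "norm (\<phi> 1 - \<psi> 1) \<le> exp (C * M * (1 - 0)) * norm (\<phi> 0 - \<psi> 0)"
  proof (rule gronwall)
    fix t :: real assume t: "t \<in> {0..1}"
    show "((\<lambda>t. \<phi> t - \<psi> t) has_vector_derivative - contr (B (\<gamma> t)) (D t) (\<phi> t) - (- contr (B (\<gamma> t)) (D t) (\<psi> t))) (at t within {0..1})"
      using assms t by (intro has_vector_derivative_diff) (auto simp: parallel_along_def)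
    have "norm (- contr (B (\<gamma> t)) (D t) (\<phi> t) - (- contr (B (\<gamma> t)) (D t) (\<psi> t))) = norm (contr (B (\<gamma> t)) (D t) (\<phi> t - \<psi> t))"
      by (simp add: contr_diff norm_minus_commute)
    also have "\<dots> \<le> C * norm (D t) * norm (\<phi> t - \<psi> t)" using assms t by (intro B_le) auto
    also have "\<dots> \<le> C * M * norm (\<phi> t - \<psi> t)" using C M[OF t] by (intro mult_right_mono mult_left_mono) auto
    finally show "norm (- contr (B (\<gamma> t)) (D t) (\<phi> t) - (- contr (B (\<gamma> t)) (D t) (\<psi> t))) \<le> C * M * norm (\<phi> t - \<psi> t)" .
  qed simp
  then show ?thesis using assms by simp
qed

text \<open>Uniqueness resolves the definite description in \<open>transport\<close>; from here on a
  transport is computed by exhibiting one solution.\<close>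

lemma transport_eqI:
  assumes par: "parallel_along B \<gamma> D \<phi>" and D: "continuous_on {0..1} D" and im: "\<gamma> ` {0..1} \<subseteq> \<Omega>"
  shows "transport B \<gamma> (\<phi> 0) = \<phi> 1"
proof -
  have vd: "vector_derivative \<gamma> (at t within {0..1}) = D t" if "t \<in> {0..1}" for t
    using par that by (intro vector_derivative_within_closed_interval) (auto simp: parallel_along_def)
  have eq: "(\<forall>t\<in>{0..1}. (\<psi> has_vector_derivative
        (\<chi> i. - (\<Sum>j\<in>UNIV. \<Sum>k\<in>UNIV. B (\<gamma> t) $ i $ j $ k * \<psi> t $ k
                   * vector_derivative \<gamma> (at t within {0..1}) $ j))) (at t within {0..1})) \<longleftrightarrow> parallel_along B \<gamma> D \<psi>" for \<psi>
  proof -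
    have "(\<chi> i. - (\<Sum>j\<in>UNIV. \<Sum>k\<in>UNIV. B (\<gamma> t) $ i $ j $ k * \<psi> t $ k * vector_derivative \<gamma> (at t within {0..1}) $ j))
        = - contr (B (\<gamma> t)) (D t) (\<psi> t)" if "t \<in> {0..1}" for t
      using vd[OF that] by (simp add: contr_def vec_eq_iff)
    then show ?thesis using par by (simp add: parallel_along_def)
  qed
  show ?thesis
    unfolding transport_def eq
  proof (rule the_equality)
    show "\<exists>\<psi>. \<psi> 0 = \<phi> 0 \<and> \<psi> 1 = \<phi> 1 \<and> parallel_along B \<gamma> D \<psi>" using par by blast
    show "w = \<phi> 1" if "\<exists>\<psi>. \<psi> 0 = \<phi> 0 \<and> \<psi> 1 = w \<and> parallel_along B \<gamma> D \<psi>" for w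
      using that parallel_unique[OF _ par D im] by blast
  qed
qed

lemma transport_exists:
  assumes "\<gamma> \<in> C1_curves \<Omega> x y"
  obtains D \<phi> where "parallel_along B \<gamma> D \<phi>" "continuous_on {0..1} D" "\<phi> 0 = v" "transport B \<gamma> v = \<phi> 1"
proof -
  obtain D where im: "\<gamma> ` {0..1} \<subseteq> \<Omega>" and D: "continuous_on {0..1} D"
    and vd: "\<And>t. t \<in> {0..1} \<Longrightarrow> (\<gamma> has_vector_derivative D t) (at t within {0..1})"
    using assms by (auto simp: C1_curves_def)
  have c\<gamma>: "continuous_on {0..1} \<gamma>"
    unfolding continuous_on_eq_continuous_within using has_vector_derivative_continuous[OF vd] by blast
  have "bounded (D ` {0..1})" by (intro compact_imp_bounded compact_continuous_image D) simp
  then have "\<exists>M. \<forall>t\<in>{0..1}. norm (D t) \<le> M" by (simp add: bounded_iff)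
  then obtain M where M: "\<And>t. t \<in> {0..1} \<Longrightarrow> norm (D t) \<le> M" by blast
  have M0: "0 \<le> M" by (rule order_trans[OF norm_ge_zero M[of 0]]) simp
  obtain \<phi> where \<phi>: "\<phi> 0 = v" "\<And>t. t \<in> {0..1} \<Longrightarrow> (\<phi> has_vector_derivative - contr (B (\<gamma> t)) (D t) (\<phi> t)) (at t within {0..1})"
  proof (rule linear_ode_exists[where F="\<lambda>t v. - contr (B (\<gamma> t)) (D t) v" and L="C * M" and v=v])
    show "linear (\<lambda>v. - contr (B (\<gamma> t)) (D t) v)" for t
      by (intro linear_compose_neg linear_contr)
    show "norm (- contr (B (\<gamma> t)) (D t) w) \<le> C * M * norm w" if t: "t \<in> {0..1}" for t w
    proof -
      have "norm (- contr (B (\<gamma> t)) (D t) w) \<le> C * norm (D t) * norm w" using im t by (simp add: B_le image_subset_iff)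
      also have "\<dots> \<le> C * M * norm w" using C M[OF t] by (intro mult_right_mono mult_left_mono) auto
      finally show ?thesis .
    qed
    show "continuous_on {0..1} (\<lambda>t. - contr (B (\<gamma> t)) (D t) (\<psi> t))" if "continuous_on {0..1} \<psi>" for \<psi>
      by (intro continuous_intros continuous_on_compose2[OF contB c\<gamma> im] D that)
  qed (use C M0 in auto)
  then have par: "parallel_along B \<gamma> D \<phi>" using vd by (simp add: parallel_along_def)
  from transport_eqI[OF this D im] \<phi>(1) par D that show ?thesis by metis
qed

text \<open>The equation is linear in the velocity, so reparametrising a curve reparametrises its
  solutions. Joining the two solutions as the curves are joined therefore solves the equation along
  the joined curve.\<close>

lemma C1_curves_join:
  assumes "\<gamma>1 \<in> C1_curves \<Omega> x y" "\<gamma>2 \<in> C1_curves \<Omega> y z"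
  shows "joinc \<gamma>1 \<gamma>2 \<in> C1_curves \<Omega> x z"
    and "transport B (joinc \<gamma>1 \<gamma>2) v = transport B \<gamma>2 (transport B \<gamma>1 v)"
proof -
  have g: "\<gamma>1 ` {0..1} \<subseteq> \<Omega>" "\<gamma>2 ` {0..1} \<subseteq> \<Omega>" "\<gamma>1 0 = x" "\<gamma>1 1 = y" "\<gamma>2 0 = y" "\<gamma>2 1 = z"
    using assms by (auto simp: C1_curves_def)
  obtain D \<phi> where D: "parallel_along B \<gamma>1 D \<phi>" "continuous_on {0..1} D" "\<phi> 0 = v" "transport B \<gamma>1 v = \<phi> 1"
    using transport_exists[OF assms(1)] by blast
  obtain E \<psi> where E: "parallel_along B \<gamma>2 E \<psi>" "continuous_on {0..1} E" "\<psi> 0 = \<phi> 1" "transport B \<gamma>2 (\<phi> 1) = \<psi> 1"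
    using transport_exists[OF assms(2)] by blast
  have im: "joinc \<gamma>1 \<gamma>2 ` {0..1} \<subseteq> \<Omega>" using joinc_image[of \<gamma>1 \<gamma>2] g by auto
  have dc: "continuous_on {0..1} (joinc_deriv D E)" by (rule joinc_deriv_continuous[OF D(2) E(2)])
  have d: "(joinc \<gamma>1 \<gamma>2 has_vector_derivative joinc_deriv D E t) (at t within {0..1})" if "t \<in> {0..1}" for t
    using D(1) E(1) that g by (intro joinc_has_deriv) (auto simp: parallel_along_def)
  show "joinc \<gamma>1 \<gamma>2 \<in> C1_curves \<Omega> x z"
    using d dc im g by (auto simp: C1_curves_def joinc_ends)
  have "(joinc \<phi> \<psi> has_vector_derivative joinc_deriv (\<lambda>t. - contr (B (\<gamma>1 t)) (D t) (\<phi> t)) (\<lambda>t. - contr (B (\<gamma>2 t)) (E t) (\<psi> t)) t) (at t within {0..1})"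
    if "t \<in> {0..1}" for t
    using D(1) E(1,3) that by (intro joinc_has_deriv) (auto simp: parallel_along_def)
  moreover have "joinc_deriv (\<lambda>t. - contr (B (\<gamma>1 t)) (D t) (\<phi> t)) (\<lambda>t. - contr (B (\<gamma>2 t)) (E t) (\<psi> t)) t
     = - contr (B (joinc \<gamma>1 \<gamma>2 t)) (joinc_deriv D E t) (joinc \<phi> \<psi> t)" for t
    by (simp add: joinc_deriv_def joinc_def contr_scaleR)
  ultimately have "parallel_along B (joinc \<gamma>1 \<gamma>2) (joinc_deriv D E) (joinc \<phi> \<psi>)"
    using d by (simp add: parallel_along_def)
  from transport_eqI[OF this dc im] show "transport B (joinc \<gamma>1 \<gamma>2) v = transport B \<gamma>2 (transport B \<gamma>1 v)"
    using D E by (simp add: joinc_ends)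
qed

lemma segment_curve:
  assumes "ball c r \<subseteq> \<Omega>" "x \<in> ball c r" "y \<in> ball c r"
  shows "(\<lambda>t. x + t *\<^sub>R (y - x)) \<in> C1_curves \<Omega> x y"
proof -
  have "x + t *\<^sub>R (y - x) \<in> ball c r" if "t \<in> {0..1}" for t
  proof -
    have "x + t *\<^sub>R (y - x) = (1 - t) *\<^sub>R x + t *\<^sub>R y" by (simp add: algebra_simps)
    then show ?thesis using convexD_alt[OF convex_ball assms(2,3), of t] that by simp
  qed
  moreover have "((\<lambda>t. x + t *\<^sub>R (y - x)) has_vector_derivative (y - x)) (at t within {0..1})" for t
    by (auto intro!: derivative_eq_intros)
  ultimately show ?thesis
    using assms(1) unfolding C1_curves_def by (auto intro!: exI[of _ "\<lambda>_. y - x"])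
qed

text \<open>Inside a ball a straight segment can be appended to any curve, so reachability is
  locally constant, and connectedness makes it global.\<close>

lemma C1_curves_nonempty:
  assumes "x \<in> \<Omega>" "y \<in> \<Omega>" shows "C1_curves \<Omega> x y \<noteq> {}"
proof (rule connected_induction_simple[OF conn assms(1,2), where P="\<lambda>y. C1_curves \<Omega> x y \<noteq> {}"])
  obtain r where "r > 0" "ball x r \<subseteq> \<Omega>" using op assms(1) openE by blast
  then show "C1_curves \<Omega> x x \<noteq> {}" using segment_curve[of x r x x] by auto
next
  fix a assume "a \<in> \<Omega>"
  then obtain r where r: "r > 0" "ball a r \<subseteq> \<Omega>" using op openE by blast
  show "\<exists>T. openin (top_of_set \<Omega>) T \<and> a \<in> T \<and> (\<forall>y\<in>T. \<forall>z\<in>T. C1_curves \<Omega> x y \<noteq> {} \<longrightarrow> C1_curves \<Omega> x z \<noteq> {})"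
  proof (intro exI conjI ballI impI)
    show "openin (top_of_set \<Omega>) (ball a r)" using r op by (simp add: openin_open_eq)
    show "a \<in> ball a r" using r by simp
    fix y z assume yz: "y \<in> ball a r" "z \<in> ball a r" and "C1_curves \<Omega> x y \<noteq> {}"
    then obtain \<gamma> where "\<gamma> \<in> C1_curves \<Omega> x y" by blast
    from C1_curves_join(1)[OF this segment_curve[OF r(2) yz]] show "C1_curves \<Omega> x z \<noteq> {}" by blast
  qed
qed

section \<open>Parallel sections and path-independent vectors\<close>

lemma parallel_section_transport:
  assumes u: "parallel_section \<Omega> B u" and \<gamma>: "\<gamma> \<in> C1_curves \<Omega> x y"
  shows "transport B \<gamma> (u x) = u y"
proof -
  obtain D where im: "\<gamma> ` {0..1} \<subseteq> \<Omega>" and D: "continuous_on {0..1} D" and xy: "\<gamma> 0 = x" "\<gamma> 1 = y"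
    and vd: "\<And>t. t \<in> {0..1} \<Longrightarrow> (\<gamma> has_vector_derivative D t) (at t within {0..1})"
    using \<gamma> by (auto simp: C1_curves_def)
  have "((u \<circ> \<gamma>) has_vector_derivative - contr (B (\<gamma> t)) (D t) (u (\<gamma> t))) (at t within {0..1})" if t: "t \<in> {0..1}" for t
  proof (rule vector_derivative_diff_chain_within[OF vd[OF t]])
    have "\<gamma> t \<in> \<Omega>" using im t by auto
    then show "(u has_derivative (\<lambda>h. - contr (B (\<gamma> t)) h (u (\<gamma> t)))) (at (\<gamma> t) within \<gamma> ` {0..1})"
      using u by (auto simp: parallel_section_def intro: has_derivative_at_withinI)
  qed
  then have "parallel_along B \<gamma> D (u \<circ> \<gamma>)" using vd by (simp add: parallel_along_def o_def)
  from transport_eqI[OF this D im] show ?thesis by (simp add: xy)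
qed

lemma parallel_section_in_E_space:
  "parallel_section \<Omega> B u \<Longrightarrow> u x \<in> E_space \<Omega> B x"
  by (simp add: E_space_def parallel_section_transport)

lemma parallel_section_eq:
  assumes "parallel_section \<Omega> B u" "parallel_section \<Omega> B w" "x \<in> \<Omega>" "u x = w x" "y \<in> \<Omega>"
  shows "u y = w y"
proof -
  obtain \<gamma> where "\<gamma> \<in> C1_curves \<Omega> x y" using C1_curves_nonempty assms by blast
  then show ?thesis using parallel_section_transport assms by metis
qed

text \<open>First-order expansion of transport with B frozen at y. The error has two sources: the
  oscillation \<eta> of B on the ball, and the deviation of the solution from w. The solution itself
  is bounded by exp C times the norm of w, as the segment has length at most 1.\<close>

lemma segment_transport_estimate:
  assumes r: "ball y r \<subseteq> \<Omega>" and y': "y' \<in> ball y r" and y: "y \<in> \<Omega>" and h: "norm (y' - y) \<le> 1"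
    and \<eta>: "\<And>z. z \<in> ball y r \<Longrightarrow> norm (B z - B y) \<le> \<eta>"
    and Kdef: "Kc = real CARD('n) * (real CARD('d) * real CARD('n))"
  shows "norm (transport B (\<lambda>t. y + t *\<^sub>R (y' - y)) w - w + contr (B y) (y' - y) w)
    \<le> (Kc * \<eta> * (exp C * norm w) + C * C * norm (y' - y) * (exp C * norm w)) * norm (y' - y)"
proof -
  define h where "h = y' - y"
  define W where "W = exp C * norm w"
  define \<gamma> where "\<gamma> t = y + t *\<^sub>R h" for t
  have yb: "y \<in> ball y r" using y' by (auto simp: dist_commute) (meson dist_not_less_zero order_le_less_trans zero_le_dist)
  have \<gamma>: "\<gamma> \<in> C1_curves \<Omega> y y'" using segment_curve[OF r yb y'] by (simp add: \<gamma>_def[abs_def] h_def)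
  have gb: "\<gamma> t \<in> ball y r" if "t \<in> {0..1}" for t
  proof -
    have "norm (t *\<^sub>R h) \<le> norm h" using that by (simp add: mult_left_le_one_le)
    moreover have "norm h < r" using y' by (simp add: h_def dist_norm norm_minus_commute)
    ultimately show ?thesis by (simp add: \<gamma>_def dist_norm)
  qed
  have gO: "\<gamma> t \<in> \<Omega>" if "t \<in> {0..1}" for t using gb[OF that] r by auto
  obtain D \<phi> where D: "parallel_along B \<gamma> D \<phi>" "\<phi> 0 = w" "transport B \<gamma> w = \<phi> 1"
    using transport_exists[OF \<gamma>] by blast
  have Dh: "D t = h" if "t \<in> {0..1}" for t
  proof (rule vector_derivative_unique_within_closed_interval[of 0 1 t])
    show "(\<gamma> has_vector_derivative D t) (at t within cbox 0 1)" using D(1) that by (simp add: parallel_along_def)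
    show "(\<gamma> has_vector_derivative h) (at t within cbox 0 1)"
      unfolding \<gamma>_def by (auto intro!: derivative_eq_intros)
  qed (use that in auto)
  have d\<phi>: "(\<phi> has_vector_derivative - contr (B (\<gamma> t)) h (\<phi> t)) (at t within {0..1})" if "t \<in> {0..1}" for t
    using D(1) Dh[OF that] that by (auto simp: parallel_along_def)
  have W0: "0 \<le> W" by (simp add: W_def)
  have h1: "norm h \<le> 1" using h by (simp add: h_def)
  have \<phi>W: "norm (\<phi> t) \<le> W" if t: "t \<in> {0..1}" for t
  proof -
    have "norm (\<phi> t) \<le> exp (C * (t - 0)) * norm (\<phi> 0)"
    proof (rule gronwall)
      fix s assume s: "s \<in> {0..t}"
      then have s1: "s \<in> {0..1}" using t by auto
      show "(\<phi> has_vector_derivative - contr (B (\<gamma> s)) h (\<phi> s)) (at s within {0..t})"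
        by (rule has_vector_derivative_within_subset[OF d\<phi>[OF s1]]) (use t in auto)
      have "norm (- contr (B (\<gamma> s)) h (\<phi> s)) \<le> C * norm h * norm (\<phi> s)" using B_le[OF gO[OF s1]] by simp
      also have "\<dots> \<le> C * 1 * norm (\<phi> s)" using C h1 by (intro mult_right_mono mult_left_mono) auto
      finally show "norm (- contr (B (\<gamma> s)) h (\<phi> s)) \<le> C * norm (\<phi> s)" by simp
    qed (use t in auto)
    also have "\<dots> \<le> exp C * norm w" using t C D(2) by (intro mult_mono) (auto simp: mult_left_le)
    finally show ?thesis by (simp add: W_def)
  qed
  have \<phi>w: "norm (\<phi> t - w) \<le> C * norm h * W" if t: "t \<in> {0..1}" for t
  proof -
    have "norm (\<phi> t - \<phi> 0) \<le> C * norm h * W * norm (t - 0)"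
    proof (rule differentiable_bound[of "{0..1}" \<phi> "\<lambda>t s. s *\<^sub>R (- contr (B (\<gamma> t)) h (\<phi> t))"])
      fix s :: real assume s: "s \<in> {0..1}"
      show "(\<phi> has_derivative (\<lambda>u. u *\<^sub>R (- contr (B (\<gamma> s)) h (\<phi> s)))) (at s within {0..1})"
        using d\<phi>[OF s] by (simp add: has_vector_derivative_def)
      have "norm (contr (B (\<gamma> s)) h (\<phi> s)) \<le> C * norm h * norm (\<phi> s)" using B_le[OF gO[OF s]] by simp
      also have "\<dots> \<le> C * norm h * W" using C \<phi>W[OF s] by (intro mult_left_mono) auto
      finally show "onorm (\<lambda>u. u *\<^sub>R (- contr (B (\<gamma> s)) h (\<phi> s))) \<le> C * norm h * W"
        by (intro onorm_scaleR_le) simp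
    qed (use t in auto)
    also have "\<dots> \<le> C * norm h * W" using t C W0 by (intro mult_left_le) auto
    finally show ?thesis using D(2) by simp
  qed
  \<comment> \<open>With the expected linear term cancelled, the derivative of \<theta> is exactly
    the error, and the mean value inequality integrates it.\<close>
  define \<theta> where "\<theta> t = \<phi> t + t *\<^sub>R contr (B y) h w" for t
  have "norm (\<theta> 1 - \<theta> 0) \<le> (Kc * \<eta> * W + C * C * norm h * W) * norm h * norm (1 - 0 :: real)"
  proof (rule differentiable_bound[of "{0..1}" \<theta> "\<lambda>t s. s *\<^sub>R (- contr (B (\<gamma> t)) h (\<phi> t) + contr (B y) h w)"])
    fix s :: real assume s: "s \<in> {0..1}"
    have "(\<theta> has_vector_derivative - contr (B (\<gamma> s)) h (\<phi> s) + contr (B y) h w) (at s within {0..1})"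
      unfolding \<theta>_def by (intro has_vector_derivative_add d\<phi> s) (auto intro!: derivative_eq_intros)
    then show "(\<theta> has_derivative (\<lambda>u. u *\<^sub>R (- contr (B (\<gamma> s)) h (\<phi> s) + contr (B y) h w))) (at s within {0..1})"
      by (simp add: has_vector_derivative_def)
    have \<eta>0: "0 \<le> \<eta>" using \<eta>[OF yb] by simp
    have "- contr (B (\<gamma> s)) h (\<phi> s) + contr (B y) h w = - contr (B (\<gamma> s) - B y) h (\<phi> s) - contr (B y) h (\<phi> s - w)"
      by (simp add: contr_diff)
    also have "norm \<dots> \<le> norm (contr (B (\<gamma> s) - B y) h (\<phi> s)) + norm (contr (B y) h (\<phi> s - w))"
      using norm_triangle_ineq4[of "- contr (B (\<gamma> s) - B y) h (\<phi> s)"] by simp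
    also have "norm (contr (B (\<gamma> s) - B y) h (\<phi> s)) \<le> Kc * (norm (B (\<gamma> s) - B y) * norm (\<phi> s) * norm h)"
      using norm_contr_le[of "B (\<gamma> s) - B y" h "\<phi> s"] by (simp add: Kdef mult_ac)
    also have "Kc * (norm (B (\<gamma> s) - B y) * norm (\<phi> s) * norm h) \<le> Kc * (\<eta> * W * norm h)"
      using \<phi>W[OF s] \<eta>[OF gb[OF s]] W0 \<eta>0 by (intro mult_left_mono mult_right_mono mult_mono) (auto simp: Kdef)
    also have "norm (contr (B y) h (\<phi> s - w)) \<le> C * norm h * (C * norm h * W)"
      using B_le[OF y, of h "\<phi> s - w"] mult_left_mono[OF \<phi>w[OF s], of "C * norm h"] C by auto
    finally have "norm (- contr (B (\<gamma> s)) h (\<phi> s) + contr (B y) h w) \<le> (Kc * \<eta> * W + C * C * norm h * W) * norm h"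
      by (simp add: algebra_simps)
    then show "onorm (\<lambda>u. u *\<^sub>R (- contr (B (\<gamma> s)) h (\<phi> s) + contr (B y) h w)) \<le> (Kc * \<eta> * W + C * C * norm h * W) * norm h"
      by (intro onorm_scaleR_le) simp
  qed auto
  then show ?thesis
    using D(2,3) by (simp add: \<theta>_def \<gamma>_def[abs_def] h_def W_def algebra_simps)
qed

text \<open>Define u by transporting v from x along arbitrary curves. Path independence lets a
  segment be appended to any of them, so near each point u is a transport along segments, and the
  first-order estimate gives its derivative.\<close>

lemma E_space_section:
  assumes x: "x \<in> \<Omega>" and v: "v \<in> E_space \<Omega> B x"
  obtains u where "parallel_section \<Omega> B u" "u x = v"
proof -
  have "\<forall>y\<in>\<Omega>. \<exists>\<gamma>. \<gamma> \<in> C1_curves \<Omega> x y" using C1_curves_nonempty[OF x] by blast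
  from bchoice[OF this] obtain c where c: "\<forall>y\<in>\<Omega>. c y \<in> C1_curves \<Omega> x y" ..
  define u where "u y = transport B (c y) v" for y
  \<comment> \<open>Membership of v in E_x makes the choice of c immaterial.\<close>
  have u: "u y = transport B \<gamma> v" if \<gamma>: "\<gamma> \<in> C1_curves \<Omega> x y" and y: "y \<in> \<Omega>" for y \<gamma>
    unfolding u_def using v bspec[OF c y] \<gamma> y unfolding E_space_def by blast
  have seg: "u y' = transport B (\<lambda>t. y + t *\<^sub>R (y' - y)) (u y)" if r: "ball y r \<subseteq> \<Omega>" "y' \<in> ball y r" "y \<in> ball y r" for y y' r
  proof -
    have y: "y \<in> \<Omega>" "y' \<in> \<Omega>" using that by auto
    obtain \<gamma> where \<gamma>: "\<gamma> \<in> C1_curves \<Omega> x y" using C1_curves_nonempty x y by blast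
    note s = segment_curve[OF r(1) r(3) r(2)]
    show ?thesis using C1_curves_join[OF \<gamma> s] u[OF \<gamma> y(1)] u[OF C1_curves_join(1)[OF \<gamma> s] y(2)] by simp
  qed
  show ?thesis
  proof
    obtain r where r: "r > 0" "ball x r \<subseteq> \<Omega>" using op x openE by blast
    have c: "(\<lambda>t. x + t *\<^sub>R (x - x)) \<in> C1_curves \<Omega> x x" using segment_curve[OF r(2), of x x] r by simp
    have "parallel_along B (\<lambda>t. x + t *\<^sub>R (x - x)) (\<lambda>_. 0) (\<lambda>_. v)"
      by (simp add: parallel_along_def)
    from transport_eqI[OF this] have "transport B (\<lambda>t. x + t *\<^sub>R (x - x)) v = v"
      using x by (simp add: image_subset_iff)
    then show "u x = v" using u[OF c x] by simp
    show "parallel_section \<Omega> B u"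
      unfolding parallel_section_def
    proof
      fix y assume y: "y \<in> \<Omega>"
      then obtain r where r: "r > 0" "ball y r \<subseteq> \<Omega>" using op openE by blast
      define Kc where "Kc = real CARD('n) * (real CARD('d) * real CARD('n))"
      define W where "W = exp C * norm (u y)"
      have W0: "0 \<le> W" "0 \<le> Kc" by (auto simp: W_def Kc_def)
      show "(u has_derivative (\<lambda>h. - contr (B y) h (u y))) (at y)"
        unfolding has_derivative_at_alt
      proof (intro conjI allI impI)
        have "linear (\<lambda>h. - contr (B y) h (u y))" by (intro linear_compose_neg linear_contr)
        then show "bounded_linear (\<lambda>h. - contr (B y) h (u y))" by (simp add: linear_conv_bounded_linear)
        fix e :: real assume e: "0 < e"
        \<comment> \<open>Half of e is reserved for the oscillation of B, the other half for the
          term quadratic in y' - y, which the last bound in d controls. The added 1 keeps both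
          denominators positive.\<close>
        define \<eta> where "\<eta> = e / (2 * (Kc * W + 1))"
        have KW: "0 \<le> Kc * W" and CW: "0 \<le> C * C * W" using W0 C by auto
        have \<eta>: "0 < \<eta>" "Kc * \<eta> * W \<le> e / 2"
        proof -
          show "0 < \<eta>" using e KW by (simp add: \<eta>_def)
          have "\<eta> * (2 * (Kc * W + 1)) = e" using KW by (simp add: \<eta>_def)
          then show "Kc * \<eta> * W \<le> e / 2" using \<open>0 < \<eta>\<close> by (simp add: algebra_simps)
        qed
        have "continuous (at y) B" using contB op y by (simp add: continuous_on_eq_continuous_at)
        then obtain d1 where d1: "d1 > 0" "\<And>z. dist z y < d1 \<Longrightarrow> dist (B z) (B y) < \<eta>"
          using \<eta>(1) unfolding continuous_at_eps_delta by blast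
        define d where "d = min (min 1 (min r d1)) (e / (2 * (C * C * W + 1)))"
        have d: "0 < d" "d \<le> 1" "d \<le> r" "d \<le> d1" using r d1 e CW by (auto simp: d_def)
        have dC: "C * C * d * W \<le> e / 2"
        proof -
          have "d \<le> e / (2 * (C * C * W + 1))" by (simp add: d_def)
          then have "d * (2 * (C * C * W + 1)) \<le> e" using CW by (simp add: pos_le_divide_eq)
          then show ?thesis using d(1) by (simp add: algebra_simps)
        qed
        have sub: "ball y d \<subseteq> \<Omega>" using r(2) d(3) by (meson subset_ball order_trans)
        show "\<exists>d>0. \<forall>y'. norm (y' - y) < d \<longrightarrow> norm (u y' - u y - - contr (B y) (y' - y) (u y)) \<le> e * norm (y' - y)"
        proof (intro exI conjI allI impI)
          show "0 < d" by (rule d(1))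
          fix y' assume y': "norm (y' - y) < d"
          have yb: "y' \<in> ball y d" "y \<in> ball y d" using y' d(1) by (auto simp: dist_norm norm_minus_commute)
          have "norm (transport B (\<lambda>t. y + t *\<^sub>R (y' - y)) (u y) - u y + contr (B y) (y' - y) (u y))
             \<le> (Kc * \<eta> * W + C * C * norm (y' - y) * W) * norm (y' - y)"
            unfolding W_def
          proof (rule segment_transport_estimate[OF sub yb(1) y _ _ Kc_def])
            show "norm (y' - y) \<le> 1" using y' d(2) by simp
            show "norm (B z - B y) \<le> \<eta>" if "z \<in> ball y d" for z
              using d1(2)[of z] that d(4) by (auto simp: dist_norm norm_minus_commute less_imp_le)
          qed
          also have "\<dots> \<le> e * norm (y' - y)"
          proof (intro mult_right_mono)
            have "C * C * norm (y' - y) * W \<le> C * C * d * W"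
              using y' C W0 by (intro mult_right_mono mult_left_mono) auto
            then show "Kc * \<eta> * W + C * C * norm (y' - y) * W \<le> e" using \<eta>(2) dC by linarith
          qed simp
          finally show "norm (u y' - u y - - contr (B y) (y' - y) (u y)) \<le> e * norm (y' - y)"
            using seg[OF sub yb] by simp
        qed
      qed
    qed
  qed
qed

end

section \<open>Parallel sections belong to the null space\<close>

lemma Cinf_on_has_partial:
  assumes "Cinf_on S f" "x + s *\<^sub>R axis j 1 \<in> S"
  shows "((\<lambda>t. f (x + t *\<^sub>R axis j 1)) has_real_derivative partial_deriv j f (x + s *\<^sub>R axis j 1)) (at s)"
proof -
  have "(\<lambda>t. iter_partial [] f (x + s *\<^sub>R axis j 1 + t *\<^sub>R axis j 1)) differentiable at 0"
    using assms unfolding Cinf_on_def by blast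
  then have "((\<lambda>t. f (x + s *\<^sub>R axis j 1 + t *\<^sub>R axis j 1)) has_real_derivative partial_deriv j f (x + s *\<^sub>R axis j 1)) (at (s + - s))"
    unfolding partial_deriv_def by (simp add: DERIV_deriv_iff_real_differentiable)
  from DERIV_shift[THEN iffD1, OF this]
  have "((\<lambda>t. f (x + s *\<^sub>R axis j 1 + (t + - s) *\<^sub>R axis j 1)) has_real_derivative partial_deriv j f (x + s *\<^sub>R axis j 1)) (at s)" .
  moreover have "x + s *\<^sub>R axis j 1 + (t + - s) *\<^sub>R axis j 1 = x + t *\<^sub>R axis j 1" for t
    by (simp add: algebra_simps)
  ultimately show ?thesis by (simp only:)
qed

lemma Cinf_on_continuous:
  assumes "Cinf_on S f"
  shows "continuous_on S f" "continuous_on S (partial_deriv j f)"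
proof -
  have "continuous_on S (iter_partial [] f)" "continuous_on S (iter_partial [j] f)"
    using assms unfolding Cinf_on_def by blast+
  then show "continuous_on S f" "continuous_on S (partial_deriv j f)" by simp_all
qed

lemma norm_axis_1: "norm (axis j (1::real)) = 1"
  by (simp add: norm_eq_1 inner_axis_axis)

text \<open>Near a boundary point the domain is swept into its interior by a fixed coordinate direction,
  along which the defining function decreases.\<close>

lemma boundary_sweep:
  fixes \<Omega> :: "(real^'d::finite) set"
  assumes sm: "smooth_boundary \<Omega>" and op: "open \<Omega>" and p: "p \<in> frontier \<Omega>"
  obtains \<epsilon> \<delta> e where "0 < \<epsilon>" "0 < \<delta>" "norm e = 1" "cball (p + \<delta> *\<^sub>R e) \<epsilon> \<subseteq> \<Omega>"
    "\<And>y s. y \<in> \<Omega> \<Longrightarrow> y \<in> ball p \<epsilon> \<Longrightarrow> s \<in> {0..\<delta>} \<Longrightarrow> y + s *\<^sub>R e \<in> \<Omega>"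
proof -
  obtain r \<rho> where r: "r > 0" and \<rho>: "Cinf_on (ball p r) \<rho>" and nz: "\<forall>y\<in>ball p r. \<exists>j. partial_deriv j \<rho> y \<noteq> 0"
    and \<Omega>: "\<Omega> \<inter> ball p r = {y\<in>ball p r. \<rho> y < 0}"
    using sm p unfolding smooth_boundary_def by blast
  obtain j where j: "partial_deriv j \<rho> p \<noteq> 0" using bspec[OF nz, of p] r by auto
  \<comment> \<open>The sign is chosen so that the defining function decreases in direction \<sigma>
    times the coordinate vector.\<close>
  define \<sigma> where "\<sigma> = - sgn (partial_deriv j \<rho> p)"
  have \<sigma>: "\<bar>\<sigma>\<bar> = 1" "\<sigma> * \<sigma> = 1" "\<sigma> * partial_deriv j \<rho> p < 0" using j by (auto simp: \<sigma>_def sgn_if)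
  define e where "e = \<sigma> *\<^sub>R axis j (1::real)"
  have e: "norm e = 1" using \<sigma> by (simp add: e_def norm_axis_1)
  have "continuous (at p) (\<lambda>y. \<sigma> * partial_deriv j \<rho> y)"
    using Cinf_on_continuous(2)[OF \<rho>] r by (intro continuous_intros) (auto simp: continuous_on_eq_continuous_at)
  then obtain r0 where r0: "r0 > 0" and r0': "\<And>y. dist y p < r0 \<Longrightarrow>
      dist (\<sigma> * partial_deriv j \<rho> y) (\<sigma> * partial_deriv j \<rho> p) < - (\<sigma> * partial_deriv j \<rho> p)"
    using \<sigma>(3) unfolding continuous_at_eps_delta by (metis neg_0_less_iff_less)
  have r0'': "\<sigma> * partial_deriv j \<rho> y < 0" if "dist y p < r0" for y
    using r0'[OF that] by (simp add: dist_real_def)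
  define r1 where "r1 = min r r0"
  have r1: "r1 > 0" "ball p r1 \<subseteq> ball p r" "\<And>y. y \<in> ball p r1 \<Longrightarrow> \<sigma> * partial_deriv j \<rho> y < 0"
    using r r0 r0'' by (auto simp: r1_def dist_commute)
  \<comment> \<open>A point within 2 \<delta> of p, moved by at most \<delta>, stays within 3
    \<delta>, which is less than r1.\<close>
  define \<delta> where "\<delta> = r1 / 4"
  have \<delta>: "\<delta> > 0" using r1 by (simp add: \<delta>_def)
  have inb: "y + s *\<^sub>R e \<in> ball p r1" if "y \<in> ball p (2 * \<delta>)" "s \<in> {0..\<delta>}" for y s
  proof -
    have "norm (p - (y + s *\<^sub>R e)) \<le> norm (p - y) + norm (s *\<^sub>R e)"
      using norm_triangle_ineq4[of "p - y" "s *\<^sub>R e"] by (simp add: algebra_simps)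
    moreover have "norm (p - y) < 2 * \<delta>" using that(1) by (simp add: dist_norm)
    moreover have "norm (s *\<^sub>R e) \<le> \<delta>" using that(2) e by simp
    ultimately have "norm (p - (y + s *\<^sub>R e)) < r1" using \<delta> by (simp add: \<delta>_def)
    then show ?thesis by (simp add: dist_norm)
  qed
  have der: "((\<lambda>s. \<rho> (y + s *\<^sub>R e)) has_real_derivative \<sigma> * partial_deriv j \<rho> (y + s *\<^sub>R e)) (at s)"
    if "y \<in> ball p (2 * \<delta>)" "s \<in> {0..\<delta>}" for y s
  proof -
    have "((\<lambda>t. \<rho> (y + t *\<^sub>R axis j 1)) has_real_derivative partial_deriv j \<rho> (y + (\<sigma> * s) *\<^sub>R axis j 1)) (at (\<sigma> * s))"
      using inb[OF that] r1 by (intro Cinf_on_has_partial[OF \<rho>]) (auto simp: e_def mult.commute)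
    moreover have "((\<lambda>s. \<sigma> * s) has_real_derivative \<sigma>) (at s)" by (auto intro!: derivative_eq_intros)
    ultimately have "((\<lambda>s. \<rho> (y + (\<sigma> * s) *\<^sub>R axis j 1)) has_real_derivative partial_deriv j \<rho> (y + (\<sigma> * s) *\<^sub>R axis j 1) * \<sigma>) (at s)"
      by (rule DERIV_chain2)
    then show ?thesis by (simp add: e_def mult.commute)
  qed
  have decr: "\<rho> (y + s *\<^sub>R e) < \<rho> y" if y: "y \<in> ball p (2 * \<delta>)" and s: "0 < s" "s \<le> \<delta>" for y s
  proof -
    have "\<rho> (y + s *\<^sub>R e) < \<rho> (y + 0 *\<^sub>R e)"
    proof (rule DERIV_neg_imp_decreasing[OF s(1)])
      fix t assume t: "0 \<le> t" "t \<le> s"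
      then have "t \<in> {0..\<delta>}" using s by auto
      then show "\<exists>d. ((\<lambda>s. \<rho> (y + s *\<^sub>R e)) has_real_derivative d) (at t) \<and> d < 0"
        using der[OF y] r1(3)[OF inb[OF y]] by blast
    qed
    then show ?thesis by simp
  qed
  have sweep: "y + s *\<^sub>R e \<in> \<Omega>" if y: "y \<in> ball p (2 * \<delta>)" "\<rho> y < 0" and s: "s \<in> {0..\<delta>}" for y s
  proof -
    have "\<rho> (y + s *\<^sub>R e) < 0" using decr[OF y(1), of s] y s by (cases "s = 0") auto
    moreover have "y + s *\<^sub>R e \<in> ball p r" using inb[OF y(1) s] r1 by auto
    ultimately show ?thesis using \<Omega> by blast
  qed
  have pr: "p \<in> ball p r" using r by simp
  \<comment> \<open>By continuity, since p is a limit of points of the domain, where \<rho> is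
    negative. Strict decrease then puts p + \<delta> e into the open domain.\<close>
  have "\<rho> p \<le> 0"
  proof (rule ccontr)
    assume "\<not> \<rho> p \<le> 0"
    then have "0 < \<rho> p" by simp
    have "open ({y \<in> ball p r. 0 < \<rho> y})"
      using continuous_open_preimage[OF Cinf_on_continuous(1)[OF \<rho>] open_ball open_greaterThan[of 0]]
      by (simp add: vimage_def Int_def)
    moreover have "p \<in> closure \<Omega>" using p by (simp add: frontier_def)
    ultimately have "\<Omega> \<inter> {y \<in> ball p r. 0 < \<rho> y} \<noteq> {}"
      using \<open>0 < \<rho> p\<close> pr by (subst (asm) closure_iff_nhds_not_empty) blast
    then obtain x where x: "x \<in> \<Omega>" "x \<in> ball p r" "0 < \<rho> x" by blast
    then have "x \<in> {y \<in> ball p r. \<rho> y < 0}" using \<Omega> by blast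
    then show False using x(3) by simp
  qed
  then have "\<rho> (p + \<delta> *\<^sub>R e) < 0" using decr[of p \<delta>] \<delta> by simp
  moreover have "p + \<delta> *\<^sub>R e \<in> ball p r" using inb[of p \<delta>] r1 \<delta> by auto
  ultimately have "p + \<delta> *\<^sub>R e \<in> \<Omega>" using \<Omega> by blast
  then obtain \<epsilon>0 where \<epsilon>0: "\<epsilon>0 > 0" "cball (p + \<delta> *\<^sub>R e) \<epsilon>0 \<subseteq> \<Omega>" using op open_contains_cball by blast
  define \<epsilon> where "\<epsilon> = min \<epsilon>0 (2 * \<delta>)"
  show ?thesis
  proof (rule that[of \<epsilon> \<delta> e])
    show "0 < \<epsilon>" using \<epsilon>0 \<delta> by (simp add: \<epsilon>_def)
    show "cball (p + \<delta> *\<^sub>R e) \<epsilon> \<subseteq> \<Omega>" using \<epsilon>0(2) by (auto simp: \<epsilon>_def)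
    fix y s assume y: "y \<in> \<Omega>" "y \<in> ball p \<epsilon>" and s: "s \<in> {0..\<delta>}"
    have y2: "y \<in> ball p (2 * \<delta>)" using y(2) by (simp add: \<epsilon>_def)
    then have "y \<in> ball p r" using inb[of y 0] \<delta> r1 by auto
    then have "\<rho> y < 0" using y(1) \<Omega> by blast
    then show "y + s *\<^sub>R e \<in> \<Omega>" using sweep[OF y2 _ s] by blast
  qed (use \<delta> e in auto)
qed

text \<open>Averaging g over translates along a unit segment leaves its integral unchanged and turns
  g into w(x + e) - w(x), whose integral vanishes by translation invariance.\<close>

lemma integral_partial_zero:
  fixes w g :: "real^'d::finite \<Rightarrow> real"
  assumes w: "integrable lborel w" and g: "integrable lborel g" and cont: "continuous_on UNIV g"
    and der: "\<And>x s. ((\<lambda>t. w (x + t *\<^sub>R axis j 1)) has_real_derivative g (x + s *\<^sub>R axis j 1)) (at s)"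
  shows "(\<integral>x. g x \<partial>lborel) = 0"
proof -
  define e :: "real^'d" where "e = axis j 1"
  interpret seg: finite_measure "seg_measure 1" by (rule finite_seg_measure)
  interpret pair_sigma_finite "seg_measure 1" "lborel :: (real^'d) measure" ..
  have [measurable]: "w \<in> borel_measurable borel" "g \<in> borel_measurable borel" using w g by auto
  have int: "integrable (seg_measure 1 \<Otimes>\<^sub>M lborel) (\<lambda>(s, y). g (y + s *\<^sub>R e))"
    by (rule integrable_pair_shift[OF finite_seg_measure _ g]) measurable
  have "(\<integral>x. g x \<partial>lborel) = (\<integral>s. (\<integral>x. g x \<partial>lborel) \<partial>seg_measure 1)"
    by (simp add: measure_def seg_measure_def emeasure_restrict_space space_restrict_space)
  also have "\<dots> = (\<integral>s. (\<integral>x. g (x + s *\<^sub>R e) \<partial>lborel) \<partial>seg_measure 1)"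
    by (simp add: lborel_integral_shift)
  also have "\<dots> = (\<integral>x. (\<integral>s. g (x + s *\<^sub>R e) \<partial>seg_measure 1) \<partial>lborel)"
    using Fubini_integral[OF int] by simp
  also have "\<dots> = (\<integral>x. w (x + e) - w x \<partial>lborel)"
  proof (rule Bochner_Integration.integral_cong)
    fix x
    have "((\<lambda>s. g (x + s *\<^sub>R e)) has_integral w (x + 1 *\<^sub>R e) - w (x + 0 *\<^sub>R e)) {0..1}"
    proof (rule fundamental_theorem_of_calculus)
      show "((\<lambda>s. w (x + s *\<^sub>R e)) has_vector_derivative g (x + s *\<^sub>R e)) (at s within {0..1})" for s
        using der[of x s] by (auto simp: e_def has_real_derivative_iff_has_vector_derivative intro: has_vector_derivative_at_within)
    qed simp
    moreover have "continuous_on {0..1} (\<lambda>s. g (x + s *\<^sub>R e))"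
      by (rule continuous_on_compose2[OF cont]) (auto intro!: continuous_intros)
    ultimately show "(\<integral>s. g (x + s *\<^sub>R e) \<partial>seg_measure 1) = w (x + e) - w x"
      by (simp add: integral_seg_measure integral_unique)
  qed simp
  also have "\<dots> = (\<integral>x. w (x + e) \<partial>lborel) - (\<integral>x. w x \<partial>lborel)"
    by (rule Bochner_Integration.integral_diff[OF lborel_integrable_shift[OF w] w])
  also have "\<dots> = 0" by (simp add: lborel_integral_shift)
  finally show ?thesis .
qed

lemma partial_deriv_eq_0_outside:
  assumes "open U" "x \<in> U" "\<And>y. y \<in> U \<Longrightarrow> f y = 0"
  shows "partial_deriv j f x = 0"
proof -
  have "open ((\<lambda>t. x + t *\<^sub>R axis j 1) -` U)"
    by (rule open_vimage[OF assms(1)]) (auto intro!: continuous_intros)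
  then have "((\<lambda>t. f (x + t *\<^sub>R axis j 1)) has_real_derivative 0) (at 0)"
    by (rule has_field_derivative_transform_within_open[OF DERIV_const[of 0]]) (use assms in auto)
  then show ?thesis unfolding partial_deriv_def by (rule DERIV_imp_deriv)
qed

lemma integrable_compact_support:
  fixes g :: "'a::euclidean_space \<Rightarrow> real"
  assumes "compact S" "continuous_on UNIV g" "\<And>x. x \<notin> S \<Longrightarrow> g x = 0"
  shows "integrable lborel g"
proof -
  have "integrable lborel (\<lambda>x. indicator S x *\<^sub>R g x)"
    by (rule borel_integrable_compact[OF assms(1)]) (use assms(2) continuous_on_subset in blast)
  moreover have "(\<lambda>x. indicator S x *\<^sub>R g x) = g" using assms(3) by (auto simp: fun_eq_iff indicator_def)
  ultimately show ?thesis by simp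
qed

locale bounded_connection = connection +
  assumes ne: "\<Omega> \<noteq> {}" and bdd: "bounded \<Omega>" and sm: "smooth_boundary \<Omega>"
begin

section \<open>Boundedness up to the boundary and square integrability\<close>

lemma parallel_section_continuous:
  assumes "parallel_section \<Omega> B u" shows "continuous_on \<Omega> u"
  using assms unfolding parallel_section_def
  by (meson continuous_at_imp_continuous_on has_derivative_continuous)

lemma parallel_section_locally_bounded:
  assumes u: "parallel_section \<Omega> B u" and p: "p \<in> closure \<Omega>"
  shows "\<exists>\<epsilon>>0. \<exists>M. \<forall>y\<in>\<Omega> \<inter> ball p \<epsilon>. norm (u y) \<le> M"
proof (cases "p \<in> \<Omega>")
  case True
  then obtain \<epsilon> where \<epsilon>: "\<epsilon> > 0" "cball p \<epsilon> \<subseteq> \<Omega>" using op open_contains_cball by blast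
  have "bounded (u ` cball p \<epsilon>)"
    by (intro compact_imp_bounded compact_continuous_image continuous_on_subset[OF parallel_section_continuous[OF u] \<epsilon>(2)]) simp
  then obtain M where "\<forall>x\<in>u ` cball p \<epsilon>. norm x \<le> M" unfolding bounded_iff by blast
  then have "\<forall>y\<in>\<Omega> \<inter> ball p \<epsilon>. norm (u y) \<le> M" by auto
  then show ?thesis using \<epsilon>(1) by blast
next
  case False
  then have "p \<in> frontier \<Omega>" using p op by (simp add: frontier_def interior_open)
  from boundary_sweep[OF sm op this] obtain \<epsilon> \<delta> e where \<epsilon>: "0 < \<epsilon>" and \<delta>: "0 < \<delta>" and e: "norm e = 1"
    and cb: "cball (p + \<delta> *\<^sub>R e) \<epsilon> \<subseteq> \<Omega>"
    and sweep: "\<And>y s. y \<in> \<Omega> \<Longrightarrow> y \<in> ball p \<epsilon> \<Longrightarrow> s \<in> {0..\<delta>} \<Longrightarrow> y + s *\<^sub>R e \<in> \<Omega>" by blast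
  have "bounded (u ` cball (p + \<delta> *\<^sub>R e) \<epsilon>)"
    by (intro compact_imp_bounded compact_continuous_image continuous_on_subset[OF parallel_section_continuous[OF u] cb]) simp
  then obtain M where M: "\<forall>x\<in>u ` cball (p + \<delta> *\<^sub>R e) \<epsilon>. norm x \<le> M" unfolding bounded_iff by blast
  have "norm (u y) \<le> exp (C * \<delta>) * M" if y: "y \<in> \<Omega>" "y \<in> ball p \<epsilon>" for y
  proof -
    \<comment> \<open>The curve runs backwards, from the interior point y + \<delta> e at t = 0 to y
      at t = \<delta>, so Gronwall bounds u at y by its value on the compact ball.\<close>
    define \<phi> where "\<phi> t = u (y + (\<delta> - t) *\<^sub>R e)" for t
    have 1: "norm (\<phi> \<delta>) \<le> exp (C * (\<delta> - 0)) * norm (\<phi> 0)"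
    proof (rule gronwall)
      fix t assume t: "t \<in> {0..\<delta>}"
      define z where "z = y + (\<delta> - t) *\<^sub>R e"
      have z: "z \<in> \<Omega>" unfolding z_def using t by (intro sweep y) auto
      have "((\<lambda>t. y + (\<delta> - t) *\<^sub>R e) has_vector_derivative - e) (at t within {0..\<delta>})"
        by (auto intro!: derivative_eq_intros)
      moreover have "(u has_derivative (\<lambda>h. - contr (B z) h (u z))) (at z within (\<lambda>t. y + (\<delta> - t) *\<^sub>R e) ` {0..\<delta>})"
        using u z unfolding parallel_section_def by (blast intro: has_derivative_at_withinI)
      ultimately have "((u \<circ> (\<lambda>t. y + (\<delta> - t) *\<^sub>R e)) has_vector_derivative - contr (B z) (- e) (u z)) (at t within {0..\<delta>})"
        unfolding z_def by (rule vector_derivative_diff_chain_within)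
      then show "(\<phi> has_vector_derivative - contr (B z) (- e) (u z)) (at t within {0..\<delta>})"
        by (simp add: \<phi>_def[abs_def] o_def)
      show "norm (- contr (B z) (- e) (u z)) \<le> C * norm (\<phi> t)"
        using B_le[OF z, of "- e" "u z"] e by (simp add: \<phi>_def z_def)
    qed (use \<delta> in simp)
    have "norm (\<phi> 0) \<le> M"
    proof -
      have "y + \<delta> *\<^sub>R e \<in> cball (p + \<delta> *\<^sub>R e) \<epsilon>" using y(2) by (simp add: dist_norm)
      then show ?thesis using M by (simp add: \<phi>_def)
    qed
    then have "exp (C * \<delta>) * norm (\<phi> 0) \<le> exp (C * \<delta>) * M" by (intro mult_left_mono) auto
    from order_trans[OF 1[unfolded diff_zero] this] have "norm (\<phi> \<delta>) \<le> exp (C * \<delta>) * M" .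
    then show ?thesis by (simp add: \<phi>_def)
  qed
  then show ?thesis using \<epsilon> by blast
qed

lemma parallel_section_bounded:
  assumes u: "parallel_section \<Omega> B u"
  obtains M where "\<And>y. y \<in> \<Omega> \<Longrightarrow> norm (u y) \<le> M"
proof -
  have "\<forall>p\<in>closure \<Omega>. \<exists>\<epsilon>. \<epsilon> > 0 \<and> (\<exists>M. \<forall>y\<in>\<Omega> \<inter> ball p \<epsilon>. norm (u y) \<le> M)"
    using parallel_section_locally_bounded[OF u] by blast
  from bchoice[OF this] obtain \<epsilon> where \<epsilon>: "\<forall>p\<in>closure \<Omega>. \<epsilon> p > 0 \<and> (\<exists>M. \<forall>y\<in>\<Omega> \<inter> ball p (\<epsilon> p). norm (u y) \<le> M)" ..
  then have "\<forall>p\<in>closure \<Omega>. \<exists>M. \<forall>y\<in>\<Omega> \<inter> ball p (\<epsilon> p). norm (u y) \<le> M" by blast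
  from bchoice[OF this] obtain M where M: "\<forall>p\<in>closure \<Omega>. \<forall>y\<in>\<Omega> \<inter> ball p (\<epsilon> p). norm (u y) \<le> M p" ..
  have "compact (closure \<Omega>)" using bdd by simp
  have cov: "closure \<Omega> \<subseteq> (\<Union>p\<in>closure \<Omega>. ball p (\<epsilon> p))" using \<epsilon> by force
  obtain F where F: "F \<subseteq> closure \<Omega>" "finite F" "closure \<Omega> \<subseteq> (\<Union>p\<in>F. ball p (\<epsilon> p))"
    by (rule compactE_image[OF \<open>compact (closure \<Omega>)\<close> open_ball cov])
  have "norm (u y) \<le> (\<Sum>p\<in>F. \<bar>M p\<bar>)" if y: "y \<in> \<Omega>" for y
  proof -
    obtain p where p: "p \<in> F" "y \<in> ball p (\<epsilon> p)" using F(3) y closure_subset by blast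
    then have "norm (u y) \<le> M p" using M F(1) y by blast
    also have "\<dots> \<le> \<bar>M p\<bar>" by simp
    also have "\<dots> \<le> (\<Sum>p\<in>F. \<bar>M p\<bar>)" using F(2) p(1) by (intro member_le_sum) auto
    finally show ?thesis .
  qed
  then show ?thesis by (rule that)
qed

lemma lmeas: "\<Omega> \<in> lmeasurable"
  using op bdd by (simp add: lmeasurable_open)

lemma sets_leb: "\<Omega> \<in> sets lebesgue"
  using lmeas by (rule fmeasurableD)

lemma parallel_section_L2:
  assumes u: "parallel_section \<Omega> B u" shows "L2_on \<Omega> u"
proof -
  obtain M where M: "\<And>y. y \<in> \<Omega> \<Longrightarrow> norm (u y) \<le> M" using parallel_section_bounded[OF u] by blast
  interpret finite_measure "lebesgue_on \<Omega>" by (rule finite_measure_lebesgue_on[OF lmeas])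
  have meas: "u \<in> borel_measurable (lebesgue_on \<Omega>)"
    by (rule continuous_imp_measurable_on_sets_lebesgue[OF parallel_section_continuous[OF u] sets_leb])
  moreover have "integrable (lebesgue_on \<Omega>) (\<lambda>x. (norm (u x))\<^sup>2)"
  proof (rule integrable_const_bound[where B="M\<^sup>2"])
    show "AE x in lebesgue_on \<Omega>. norm ((norm (u x))\<^sup>2) \<le> M\<^sup>2"
      using M by (intro AE_I2) (auto intro!: power_mono)
    show "(\<lambda>x. (norm (u x))\<^sup>2) \<in> borel_measurable (lebesgue_on \<Omega>)" using meas by measurable
  qed
  ultimately show ?thesis by (simp add: L2_on_def)
qed

text \<open>By the product rule the weak integrand is minus the partial derivative of the component
  of u times \<phi>. Extended by 0 this product has compact support, so the integral of its partial
  derivative vanishes.\<close>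

lemma parallel_section_in_null_space:
  assumes u: "parallel_section \<Omega> B u" shows "in_null_space \<Omega> B u"
  unfolding in_null_space_def
proof (intro conjI allI impI parallel_section_L2 u)
  fix \<phi> i j assume \<phi>: "test_function \<Omega> \<phi>"
  define S where "S = closure {x. \<phi> x \<noteq> 0}"
  have S: "compact S" "closed S" "S \<subseteq> \<Omega>" using \<phi> by (auto simp: test_function_def S_def)
  have C\<phi>: "Cinf_on UNIV \<phi>" using \<phi> by (simp add: test_function_def)
  have \<phi>0: "\<phi> x = 0" if "x \<notin> S" for x using that closure_subset[of "{x. \<phi> x \<noteq> 0}"] by (auto simp: S_def)
  have d\<phi>0: "partial_deriv j \<phi> x = 0" if "x \<notin> S" for x
    by (rule partial_deriv_eq_0_outside[of "- S"]) (use S that \<phi>0 in auto)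
  define w where "w x = (if x \<in> \<Omega> then u x $ i * \<phi> x else 0)" for x
  define F where "F x = - (u x $ i) * partial_deriv j \<phi> x + (\<Sum>k\<in>UNIV. B x $ i $ j $ k * u x $ k) * \<phi> x" for x
  define g where "g x = (if x \<in> \<Omega> then - F x else 0)" for x
  have out: "w x = 0" "g x = 0" if "x \<in> - S" for x
    using that \<phi>0[of x] d\<phi>0[of x] by (auto simp: w_def g_def F_def)
  have cu: "continuous_on \<Omega> u" by (rule parallel_section_continuous[OF u])
  \<comment> \<open>The support S lies in the domain, so the open sets \<open>\<Omega>\<close> and
    \<open>- S\<close> cover the space and continuity can be checked on each.\<close>
  have cont: "continuous_on UNIV k" if "continuous_on \<Omega> k" "\<And>x. x \<in> - S \<Longrightarrow> k x = 0" for k :: "real^'a \<Rightarrow> real"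
  proof -
    have "continuous_on (- S) k"
      using continuous_on_cong[of "- S" "- S" k "\<lambda>_. 0"] that(2) by auto
    then have "continuous_on (\<Omega> \<union> - S) k" using that(1) op S by (intro continuous_on_open_Un) auto
    moreover have "\<Omega> \<union> - S = UNIV" using S by auto
    ultimately show ?thesis by simp
  qed
  have cw: "continuous_on UNIV w"
  proof (rule cont[OF _ out(1)])
    have "continuous_on \<Omega> (\<lambda>x. u x $ i * \<phi> x)"
      by (intro continuous_intros cu continuous_on_subset[OF Cinf_on_continuous(1)[OF C\<phi>]]) auto
    then show "continuous_on \<Omega> w" by (rule continuous_on_eq) (simp add: w_def)
  qed
  have cg: "continuous_on UNIV g"
  proof (rule cont[OF _ out(2)])
    have "continuous_on \<Omega> (\<lambda>x. - F x)"
      unfolding F_def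
      by (intro continuous_intros cu contB continuous_on_subset[OF Cinf_on_continuous(1)[OF C\<phi>]]
          continuous_on_subset[OF Cinf_on_continuous(2)[OF C\<phi>]]) auto
    then show "continuous_on \<Omega> g" by (rule continuous_on_eq) (simp add: g_def)
  qed
  have der: "((\<lambda>t. w (x + t *\<^sub>R axis j 1)) has_real_derivative g (x + s *\<^sub>R axis j 1)) (at s)" for x s
  proof (cases "x + s *\<^sub>R axis j 1 \<in> \<Omega>")
    case True
    define z where "z = x + s *\<^sub>R axis j 1"
    have z: "z \<in> \<Omega>" using True by (simp add: z_def)
    have opn: "open ((\<lambda>t. x + t *\<^sub>R axis j 1) -` \<Omega>)"
      by (rule open_vimage[OF op]) (auto intro!: continuous_intros)
    have "((\<lambda>t. x + t *\<^sub>R axis j 1) has_vector_derivative axis j 1) (at s)"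
      by (auto intro!: derivative_eq_intros)
    moreover have "(u has_derivative (\<lambda>h. - contr (B z) h (u z))) (at z within range (\<lambda>t. x + t *\<^sub>R axis j 1))"
      using u z unfolding parallel_section_def by (blast intro: has_derivative_at_withinI)
    ultimately have "((u \<circ> (\<lambda>t. x + t *\<^sub>R axis j 1)) has_vector_derivative - contr (B z) (axis j 1) (u z)) (at s)"
      unfolding z_def by (rule vector_derivative_diff_chain_within)
    from bounded_linear.has_vector_derivative[OF bounded_linear_vec_nth[of i] this]
    have "((\<lambda>t. u (x + t *\<^sub>R axis j 1) $ i) has_real_derivative - (\<Sum>k\<in>UNIV. B z $ i $ j $ k * u z $ k)) (at s)"
      by (simp add: has_real_derivative_iff_has_vector_derivative contr_axis_nth o_def)
    from DERIV_mult[OF this Cinf_on_has_partial[OF C\<phi>, of x s j]]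
    have "((\<lambda>t. u (x + t *\<^sub>R axis j 1) $ i * \<phi> (x + t *\<^sub>R axis j 1)) has_real_derivative - F z) (at s)"
      by (simp add: F_def z_def algebra_simps)
    then have "((\<lambda>t. u (x + t *\<^sub>R axis j 1) $ i * \<phi> (x + t *\<^sub>R axis j 1)) has_real_derivative g (x + s *\<^sub>R axis j 1)) (at s)"
      using z by (simp add: g_def z_def)
    then show ?thesis
      by (rule has_field_derivative_transform_within_open[OF _ opn]) (use z in \<open>auto simp: z_def w_def\<close>)
  next
    case False
    have opn: "open ((\<lambda>t. x + t *\<^sub>R axis j 1) -` (- S))"
      by (rule open_vimage) (use S in \<open>auto intro!: continuous_intros\<close>)
    have "((\<lambda>t. 0) has_real_derivative g (x + s *\<^sub>R axis j 1)) (at s)" using False by (simp add: g_def)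
    then show ?thesis
      by (rule has_field_derivative_transform_within_open[OF _ opn]) (use False S out(1) in auto)
  qed
  have gi: "integrable lborel g" "integrable lborel w"
    using integrable_compact_support[OF S(1) cg] integrable_compact_support[OF S(1) cw] out by auto
  have "integral\<^sup>L (lebesgue_on \<Omega>) F = integral\<^sup>L lebesgue (\<lambda>x. if x \<in> \<Omega> then F x else 0)"
    by (rule Lebesgue_Measure.integral_restrict_UNIV[OF sets_leb, symmetric])
  also have "\<dots> = integral\<^sup>L lebesgue (\<lambda>x. - g x)"
    by (intro Bochner_Integration.integral_cong) (auto simp: g_def)
  also have "\<dots> = integral\<^sup>L lborel (\<lambda>x. - g x)"
    by (rule integral_completion) (use gi in auto)
  also have "\<dots> = 0" using integral_partial_zero[OF gi(2,1) cg der] by simp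
  finally show "integral\<^sup>L (lebesgue_on \<Omega>) (\<lambda>x. - (u x $ i) * partial_deriv j \<phi> x + (\<Sum>k\<in>UNIV. B x $ i $ j $ k * u x $ k) * \<phi> x) = 0"
    unfolding F_def .
qed

end

section \<open>The null space consists of parallel sections\<close>

lemma exists_borel_version:
  fixes \<mu> :: "'a::euclidean_space \<Rightarrow> 'b::euclidean_space"
  assumes "\<mu> \<in> borel_measurable lebesgue"
  obtains f where "f \<in> borel_measurable borel" "AE x in lborel. \<mu> x = f x"
proof -
  have "\<exists>h. h \<in> borel_measurable lborel \<and> (AE x in lborel. \<mu> x \<bullet> i = h x)" for i
    using completion_ex_borel_measurable_real[of "\<lambda>x. \<mu> x \<bullet> i" lborel] assms by auto
  then obtain h where h: "\<And>i. h i \<in> borel_measurable lborel" "\<And>i. AE x in lborel. \<mu> x \<bullet> i = h i x" by metis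
  show ?thesis
  proof
    show "(\<lambda>x. \<Sum>i\<in>Basis. h i x *\<^sub>R i) \<in> borel_measurable borel" using h(1) by measurable
    have "AE x in lborel. \<forall>i\<in>Basis. \<mu> x \<bullet> i = h i x"
      by (rule AE_finite_allI) (use h(2) in auto)
    then show "AE x in lborel. \<mu> x = (\<Sum>i\<in>Basis. h i x *\<^sub>R i)"
    proof eventually_elim
      case (elim x)
      then have "(\<Sum>i\<in>Basis. h i x *\<^sub>R i) = (\<Sum>i\<in>Basis. (\<mu> x \<bullet> i) *\<^sub>R i)" by (intro sum.cong) auto
      then show ?case by (simp add: euclidean_representation)
    qed
  qed
qed

lemma bounded_compact_support:
  fixes g :: "'a::euclidean_space \<Rightarrow> real"
  assumes "compact S" "continuous_on UNIV g" "\<And>x. x \<notin> S \<Longrightarrow> g x = 0"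
  obtains M where "\<And>x. \<bar>g x\<bar> \<le> M"
proof -
  have "bounded (g ` S)"
    by (intro compact_imp_bounded compact_continuous_image continuous_on_subset[OF assms(2)] assms(1)) simp
  then have "\<exists>M. \<forall>x\<in>S. \<bar>g x\<bar> \<le> M" by (simp add: bounded_iff)
  then obtain M where M: "\<And>x. x \<in> S \<Longrightarrow> \<bar>g x\<bar> \<le> M" by blast
  have "\<bar>g x\<bar> \<le> max M 0" for x using M[of x] assms(3)[of x] by (cases "x \<in> S") auto
  then show ?thesis by (rule that)
qed

context bounded_connection
begin

text \<open>Extension by 0 makes the bound by C global, as \<open>local_weak_solution\<close>
  demands; near a point of the open domain it changes nothing.\<close>

definition field_op :: "'a \<Rightarrow> real^'a \<Rightarrow> real^'b \<Rightarrow> real^'b" where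
  "field_op j x v = (if x \<in> \<Omega> then contr (B x) (axis j 1) v else 0)"

lemma field_op_linear: "linear (field_op j x)"
  using linear_contr(1)[of "B x" "axis j 1"]
  by (cases "x \<in> \<Omega>") (auto simp: field_op_def[abs_def] intro!: linearI)

lemma field_op_le: "norm (field_op j x v) \<le> C * norm v"
  using B_le[of x "axis j 1" v] C by (simp add: field_op_def norm_axis_1)

lemma field_op_measurable:
  assumes "f \<in> borel_measurable borel"
  shows "(\<lambda>x. field_op j x (f x)) \<in> borel_measurable borel"
proof -
  have "(\<lambda>x. contr (indicator \<Omega> x *\<^sub>R B x) (axis j 1) (f x)) \<in> borel_measurable borel"
  proof (rule borel_measurable_continuous_Pair[where H="\<lambda>b v. contr b (axis j 1) v"])
    show "(\<lambda>x. indicator \<Omega> x *\<^sub>R B x) \<in> borel_measurable borel"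
      by (rule borel_measurable_continuous_on_indicator[OF _ contB]) (use op in simp)
    show "continuous_on UNIV (\<lambda>x. contr (fst x) (axis j 1) (snd x))" by (intro continuous_intros)
  qed (rule assms)
  moreover have "contr (indicator \<Omega> x *\<^sub>R B x) (axis j 1) (f x) = field_op j x (f x)" for x
    by (simp add: field_op_def indicator_def)
  ultimately show ?thesis by simp
qed

text \<open>Translations and Fubini were set up for \<open>lborel\<close> on the whole space, hence
  a Borel representative extended by 0. It is integrable because the domain has finite measure and
  |f| is at most 1 + |f|^2.\<close>

lemma null_space_borel_version:
  assumes \<mu>: "in_null_space \<Omega> B \<mu>"
  obtains f where "f \<in> borel_measurable borel" "integrable lborel f" "AE x in lborel. x \<in> \<Omega> \<longrightarrow> \<mu> x = f x"
    "\<And>x. x \<notin> \<Omega> \<Longrightarrow> f x = 0"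
proof -
  interpret finite_measure "lebesgue_on \<Omega>" by (rule finite_measure_lebesgue_on[OF lmeas])
  have m: "\<mu> \<in> borel_measurable (lebesgue_on \<Omega>)" and i2: "integrable (lebesgue_on \<Omega>) (\<lambda>x. (norm (\<mu> x))\<^sup>2)"
    using \<mu> by (auto simp: in_null_space_def L2_on_def)
  have "integrable (lebesgue_on \<Omega>) (\<lambda>x. 1 + (norm (\<mu> x))\<^sup>2)" by (intro Bochner_Integration.integrable_add i2) simp
  then have "integrable (lebesgue_on \<Omega>) \<mu>"
  proof (rule Bochner_Integration.integrable_bound[OF _ m])
    have "norm (\<mu> x) \<le> 1 + (norm (\<mu> x))\<^sup>2" for x
      using zero_le_power2[of "norm (\<mu> x) - 1/2"] by (simp add: power2_eq_square algebra_simps)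
    then show "AE x in lebesgue_on \<Omega>. norm (\<mu> x) \<le> norm (1 + (norm (\<mu> x))\<^sup>2)"
      by (intro AE_I2) (simp add: order_trans[OF _ abs_ge_self])
  qed
  then have i0: "integrable lebesgue (\<lambda>x. if x \<in> \<Omega> then \<mu> x else 0)"
    by (rule Lebesgue_Measure.integrable_restrict_UNIV[OF sets_leb, THEN iffD2])
  then obtain h where h: "h \<in> borel_measurable borel" "AE x in lborel. (if x \<in> \<Omega> then \<mu> x else 0) = h x"
    using exists_borel_version[OF borel_measurable_integrable] by blast
  define f where "f x = (if x \<in> \<Omega> then h x else 0)" for x
  have [measurable]: "\<Omega> \<in> sets borel" using op by simp
  have fm: "f \<in> borel_measurable borel" unfolding f_def using h(1) by measurable
  have ae: "AE x in lborel. (if x \<in> \<Omega> then \<mu> x else 0) = f x"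
    using h(2) by eventually_elim (auto simp: f_def)
  show ?thesis
  proof (rule that[OF fm])
    have "integrable lebesgue f"
      by (rule integrable_cong_AE_imp[OF i0]) (use fm AE_completion[OF ae] in \<open>auto intro: measurable_completion\<close>)
    then show "integrable lborel f" by (subst (asm) integrable_completion) (use fm in auto)
    show "AE x in lborel. x \<in> \<Omega> \<longrightarrow> \<mu> x = f x" using ae by eventually_elim auto
  qed (simp add: f_def)
qed

text \<open>The definition makes the integral of a sum vanish. Splitting it needs each summand
  integrable, which holds because \<phi> and its partial derivative are bounded, having compact
  support.\<close>

lemma null_space_weak:
  assumes \<mu>: "in_null_space \<Omega> B \<mu>" and f: "integrable lborel f" "AE x in lborel. x \<in> \<Omega> \<longrightarrow> \<mu> x = f x"
    and f0: "\<And>x. x \<notin> \<Omega> \<Longrightarrow> f x = 0" and \<phi>: "test_function \<Omega> \<phi>"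
  shows "(\<integral>x. f x $ i * partial_deriv j \<phi> x \<partial>lborel) = (\<integral>x. field_op j x (f x) $ i * \<phi> x \<partial>lborel)"
proof -
  define S where "S = closure {x. \<phi> x \<noteq> 0}"
  have S: "compact S" "closed S" using \<phi> by (auto simp: test_function_def S_def)
  have C\<phi>: "Cinf_on UNIV \<phi>" using \<phi> by (simp add: test_function_def)
  have \<phi>0: "\<phi> x = 0" if "x \<notin> S" for x using that closure_subset[of "{x. \<phi> x \<noteq> 0}"] by (auto simp: S_def)
  have d\<phi>0: "partial_deriv j \<phi> x = 0" if "x \<notin> S" for x
    by (rule partial_deriv_eq_0_outside[of "- S"]) (use S that \<phi>0 in auto)
  obtain M where M: "\<And>x. \<bar>\<phi> x\<bar> \<le> M" using bounded_compact_support[OF S(1) Cinf_on_continuous(1)[OF C\<phi>] \<phi>0] by blast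
  obtain N where N: "\<And>x. \<bar>partial_deriv j \<phi> x\<bar> \<le> N" using bounded_compact_support[OF S(1) Cinf_on_continuous(2)[OF C\<phi>] d\<phi>0] by blast
  have [measurable]: "f \<in> borel_measurable borel" "\<phi> \<in> borel_measurable borel" "partial_deriv j \<phi> \<in> borel_measurable borel"
    using f Cinf_on_continuous[OF C\<phi>] by (auto intro: borel_measurable_continuous_onI)
  have [measurable]: "(\<lambda>x. field_op j x (f x)) \<in> borel_measurable borel" by (rule field_op_measurable) measurable
  have nth: "(\<lambda>x. h x $ i) \<in> borel_measurable borel" if "h \<in> borel_measurable borel" for h :: "real^'a \<Rightarrow> real^'b"
    by (rule borel_measurable_continuous_on[OF _ that]) (intro continuous_intros)
  note [measurable] = nth[of f] nth[of "\<lambda>x. field_op j x (f x)"]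
  have int: "integrable lborel (\<lambda>x. h x $ i * k x)"
    if "h \<in> borel_measurable borel" "k \<in> borel_measurable borel" "\<And>x. norm (h x) \<le> c * norm (f x)" "\<And>x. \<bar>k x\<bar> \<le> d" "0 \<le> c" for h :: "real^'a \<Rightarrow> real^'b" and k c d
  proof (rule Bochner_Integration.integrable_bound[of _ "\<lambda>x. c * norm (f x) * d"])
    show "integrable lborel (\<lambda>x. c * norm (f x) * d)" using f(1) by auto
    show "(\<lambda>x. h x $ i * k x) \<in> borel_measurable lborel" using nth[OF that(1)] that(2) by measurable
    have "\<bar>h x $ i\<bar> * \<bar>k x\<bar> \<le> c * norm (f x) * d" for x
      using component_le_norm_cart[of "h x" i] that(3)[of x] that(4)[of x] that(5)
      by (intro mult_mono) auto
    then have "\<bar>h x $ i * k x\<bar> \<le> \<bar>c * norm (f x) * d\<bar>" for x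
      unfolding abs_mult[of "h x $ i"] by (rule order_trans[OF _ abs_ge_self])
    then show "AE x in lborel. norm (h x $ i * k x) \<le> norm (c * norm (f x) * d)"
      by simp
  qed
  have i1: "integrable lborel (\<lambda>x. f x $ i * partial_deriv j \<phi> x)"
    by (rule int[where c=1 and d=N]) (use N in auto)
  have i2: "integrable lborel (\<lambda>x. field_op j x (f x) $ i * \<phi> x)"
    by (rule int[where c=C and d=M]) (use M C field_op_le in auto)
  define F where "F x = - (\<mu> x $ i) * partial_deriv j \<phi> x + (\<Sum>k\<in>UNIV. B x $ i $ j $ k * \<mu> x $ k) * \<phi> x" for x
  define G where "G x = - (f x $ i * partial_deriv j \<phi> x) + field_op j x (f x) $ i * \<phi> x" for x
  have Gi: "integrable lborel G" unfolding G_def using i1 i2 by auto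
  have Gl: "G \<in> borel_measurable lebesgue" using Gi by (intro measurable_completion) auto
  have FG: "AE x in lebesgue. G x = (if x \<in> \<Omega> then F x else 0)"
    using AE_completion[OF f(2)]
    by eventually_elim (auto simp: F_def G_def field_op_def contr_axis_nth f0)
  have F0: "integral\<^sup>L (lebesgue_on \<Omega>) F = 0"
    using \<mu> \<phi> unfolding in_null_space_def F_def[abs_def] by blast
  have "0 = integral\<^sup>L (lebesgue_on \<Omega>) F" using F0 by (rule sym)
  also have "\<dots> = integral\<^sup>L lebesgue (\<lambda>x. if x \<in> \<Omega> then F x else 0)"
    by (rule Lebesgue_Measure.integral_restrict_UNIV[OF sets_leb, symmetric])
  also have "\<dots> = integral\<^sup>L lebesgue G"
    using FG by (intro integral_cong_AE borel_measurable_AE[OF Gl FG] Gl) auto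
  also have "\<dots> = integral\<^sup>L lborel G" by (rule integral_completion) (use Gi in auto)
  also have "\<dots> = - (\<integral>x. f x $ i * partial_deriv j \<phi> x \<partial>lborel) + (\<integral>x. field_op j x (f x) $ i * \<phi> x \<partial>lborel)"
    unfolding G_def using i1 i2 by simp
  finally show ?thesis by simp
qed

lemma null_space_increment:
  assumes \<mu>: "in_null_space \<Omega> B \<mu>" and f: "integrable lborel f" "AE x in lborel. x \<in> \<Omega> \<longrightarrow> \<mu> x = f x"
    and f0: "\<And>x. x \<notin> \<Omega> \<Longrightarrow> f x = 0" and Lf: "integrable lborel (\<lambda>x. field_op j x (f x))"
    and t: "0 \<le> t" and sub: "cbox a (b + t *\<^sub>R axis j 1) \<subseteq> \<Omega>"
  shows "AE y in lborel. y \<in> box a b \<longrightarrow> f (y + t *\<^sub>R axis j 1) - f y =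
    - (\<integral>s. field_op j (y + s *\<^sub>R axis j 1) (f (y + s *\<^sub>R axis j 1)) \<partial>seg_measure t)"
proof -
  have comp: "integrable lborel (\<lambda>x. h x $ i)" if "integrable lborel h" for h :: "real^'a \<Rightarrow> real^'b" and i
    by (rule integrable_bounded_linear[OF bounded_linear_vec_nth that])
  have "AE y in lborel. y \<in> box a b \<longrightarrow> f (y + t *\<^sub>R axis j 1) $ i - f y $ i =
    - (\<integral>s. field_op j (y + s *\<^sub>R axis j 1) (f (y + s *\<^sub>R axis j 1)) $ i \<partial>seg_measure t)" for i
    by (rule weak_increment_AE[OF comp[OF f(1)] comp[OF Lf] null_space_weak[OF \<mu> f f0] t sub])
  then have "AE y in lborel. \<forall>i\<in>UNIV. y \<in> box a b \<longrightarrow> f (y + t *\<^sub>R axis j 1) $ i - f y $ i =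
    - (\<integral>s. field_op j (y + s *\<^sub>R axis j 1) (f (y + s *\<^sub>R axis j 1)) $ i \<partial>seg_measure t)"
    by (intro AE_finite_allI) auto
  \<comment> \<open>Taking a component inside the Bochner integral requires integrability along the
    segment, which Fubini grants for almost every y.\<close>
  moreover have "AE y in lborel. integrable (seg_measure t) (\<lambda>s. field_op j (y + s *\<^sub>R axis j 1) (f (y + s *\<^sub>R axis j 1)))"
  proof -
    interpret seg: finite_measure "seg_measure t" by (rule finite_seg_measure)
    interpret pair_sigma_finite "seg_measure t" "lborel :: (real^'a) measure" ..
    have "(\<lambda>s. s *\<^sub>R axis j 1 :: real^'a) \<in> borel_measurable (seg_measure t)" by measurable
    from AE_integrable_snd[OF integrable_pair_shift[OF finite_seg_measure this Lf]] show ?thesis by simp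
  qed
  ultimately show ?thesis
  proof eventually_elim
    case (elim y)
    have "(\<integral>s. field_op j (y + s *\<^sub>R axis j 1) (f (y + s *\<^sub>R axis j 1)) \<partial>seg_measure t) $ i =
        (\<integral>s. field_op j (y + s *\<^sub>R axis j 1) (f (y + s *\<^sub>R axis j 1)) $ i \<partial>seg_measure t)" for i
      by (rule integral_bounded_linear[OF bounded_linear_vec_nth elim(2), symmetric])
    then show ?case using elim(1) by (simp add: vec_eq_iff)
  qed
qed

lemma null_space_parallel_section:
  assumes \<mu>: "in_null_space \<Omega> B \<mu>"
  obtains u where "parallel_section \<Omega> B u" "AE x in lborel. x \<in> \<Omega> \<longrightarrow> \<mu> x = u x"
proof -
  obtain f where fm: "f \<in> borel_measurable borel" and f: "integrable lborel f" "AE x in lborel. x \<in> \<Omega> \<longrightarrow> \<mu> x = f x"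
    and f0: "\<And>x. x \<notin> \<Omega> \<Longrightarrow> f x = 0"
    using null_space_borel_version[OF \<mu>] by blast
  have Lf: "integrable lborel (\<lambda>x. field_op j x (f x))" for j
  proof (rule Bochner_Integration.integrable_bound[of _ "\<lambda>x. C * norm (f x)"])
    show "integrable lborel (\<lambda>x. C * norm (f x))" using f(1) by auto
    show "(\<lambda>x. field_op j x (f x)) \<in> borel_measurable lborel" using field_op_measurable[OF fm] by simp
    show "AE x in lborel. norm (field_op j x (f x)) \<le> norm (C * norm (f x))"
      using C by (intro AE_I2) (simp add: field_op_le)
  qed
  \<comment> \<open>One global function for all base points, since the locale's \<open>rep\<close>
    depends on f only.\<close>
  define u where "u = local_weak_solution.rep f"
  have local: "\<exists>r>0. (AE y in lborel. y \<in> cube x r \<longrightarrow> f y = u y) \<and> (u has_derivative (\<lambda>h. - contr (B x) h (u x))) (at x)"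
    if x: "x \<in> \<Omega>" for x
  proof -
    obtain d where d: "d > 0" "ball x d \<subseteq> \<Omega>" using op x openE by blast
    define m where "m = real CARD('a)"
    have m: "m > 0" by (simp add: m_def)
    \<comment> \<open>The first bound gives 4 C R at most 1. The second keeps the cube of radius 2 R
      in the ball: the norm is at most the sum of m coordinates, each at most 2 R.\<close>
    define R where "R = min (1 / (4 * (C + 1))) (d / (4 * m))"
    have R: "0 < R" "4 * C * R \<le> 1" "2 * R * m < d"
    proof -
      show "0 < R" using C d m by (simp add: R_def)
      have "R \<le> 1 / (4 * (C + 1))" by (simp add: R_def)
      then have "R * (4 * (C + 1)) \<le> 1" using C by (simp add: pos_le_divide_eq)
      then show "4 * C * R \<le> 1" using \<open>0 < R\<close> by (simp add: algebra_simps)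
      have "R \<le> d / (4 * m)" by (simp add: R_def)
      then have "R * (4 * m) \<le> d" using m by (simp add: pos_le_divide_eq)
      then show "2 * R * m < d" using d by (simp add: algebra_simps)
    qed
    have cb: "cbox (x - vec (2 * R)) (x + vec (2 * R)) \<subseteq> \<Omega>"
    proof
      fix y assume y: "y \<in> cbox (x - vec (2 * R)) (x + vec (2 * R))"
      have yi: "\<bar>(y - x) $ i\<bar> \<le> 2 * R" for i
      proof -
        have "x $ i - 2 * R \<le> y $ i" "y $ i \<le> x $ i + 2 * R" using y by (auto simp: mem_box_cart)
        then show ?thesis by (simp add: abs_le_iff)
      qed
      have "norm (y - x) \<le> (\<Sum>i\<in>UNIV. \<bar>(y - x) $ i\<bar>)" by (rule norm_le_l1_cart)
      also have "\<dots> \<le> (\<Sum>i\<in>(UNIV :: 'a set). 2 * R)" by (intro sum_mono yi)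
      also have "\<dots> < d" using R(3) by (simp add: m_def mult_ac)
      finally show "y \<in> \<Omega>" using d(2) by (auto simp: dist_norm norm_minus_commute)
    qed
    interpret local_weak_solution f field_op C R x
    proof
      show "AE y in lborel. y \<in> box a b \<longrightarrow> f (y + t *\<^sub>R axis j 1) - f y =
          - (\<integral>s. field_op j (y + s *\<^sub>R axis j 1) (f (y + s *\<^sub>R axis j 1)) \<partial>seg_measure t)"
        if "0 \<le> t" "cbox a (b + t *\<^sub>R axis j 1) \<subseteq> cbox (x - vec (2 * R)) (x + vec (2 * R))" for j a b t
        by (rule null_space_increment[OF \<mu> f f0 Lf that(1) order_trans[OF that(2) cb]])
    qed (use f(1) Lf linear_add[OF field_op_linear] linear_scale[OF field_op_linear] field_op_le C R in auto)
    have rep: "rep = u" by (simp add: u_def)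
    have "(rep has_derivative (\<lambda>z. - (\<Sum>j\<in>UNIV. z $ j *\<^sub>R field_op j x (rep x)))) (at x)"
    proof (rule rep_has_derivative)
      fix \<eta> :: real assume \<eta>: "0 < \<eta>"
      define Kc where "Kc = real CARD('b) * (real CARD('a) * real CARD('b))"
      have Kc: "Kc > 0" by (simp add: Kc_def)
      have "continuous (at x) B" using contB op x by (simp add: continuous_on_eq_continuous_at)
      then obtain d1 where d1: "d1 > 0" "\<And>z. dist z x < d1 \<Longrightarrow> dist (B z) (B x) < \<eta> / Kc"
        using \<eta> Kc unfolding continuous_at_eps_delta by (metis divide_pos_pos)
      \<comment> \<open>Summing m coordinates smaller than s keeps the distance below both d and
        d1.\<close>
      define s where "s = min d d1 / m"
      have s: "s > 0" "s * m = min d d1" using d d1 m by (auto simp: s_def)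
      have "norm (field_op j y v - field_op j x v) \<le> \<eta> * norm v" if y: "y \<in> cube x s" for y j v
      proof -
        have "norm (y - x) \<le> (\<Sum>i\<in>UNIV. \<bar>(y - x) $ i\<bar>)" by (rule norm_le_l1_cart)
        also have "\<dots> < (\<Sum>i\<in>(UNIV :: 'a set). s)" using y by (intro sum_strict_mono) (auto simp: cube_def)
        also have "\<dots> = min d d1" using s(2) by (simp add: m_def mult_ac)
        finally have yx: "dist y x < d" "dist y x < d1" by (auto simp: dist_norm)
        then have yO: "y \<in> \<Omega>" using d(2) by (auto simp: dist_commute)
        have "norm (field_op j y v - field_op j x v) = norm (contr (B y - B x) (axis j 1) v)"
          using x yO by (simp add: field_op_def contr_diff)
        also have "\<dots> \<le> Kc * norm (B y - B x) * norm v"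
          using norm_contr_le[of "B y - B x" "axis j 1" v] by (simp add: norm_axis_1 Kc_def mult_ac)
        also have "\<dots> \<le> Kc * (\<eta> / Kc) * norm v"
          using d1(2)[OF yx(2)] Kc by (intro mult_right_mono mult_left_mono) (auto simp: dist_norm)
        also have "\<dots> = \<eta> * norm v" using Kc by simp
        finally show ?thesis .
      qed
      then show "\<exists>s>0. \<forall>y\<in>cube x s. \<forall>j v. norm (field_op j y v - field_op j x v) \<le> \<eta> * norm v"
        using s(1) by blast
    qed
    moreover have "(\<Sum>j\<in>UNIV. z $ j *\<^sub>R field_op j x (rep x)) = contr (B x) z (rep x)" for z
      using x by (subst contr_axis) (simp add: field_op_def)
    ultimately have "(u has_derivative (\<lambda>h. - contr (B x) h (u x))) (at x)" by (simp add: rep)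
    moreover have "AE y in lborel. y \<in> cube x (R / 2) \<longrightarrow> f y = u y" using AE_eq_rep by (simp add: rep)
    ultimately show ?thesis using half_gt_zero[OF R(1)] by blast
  qed
  \<comment> \<open>Equality almost everywhere is known only on a cube around each point;
    negligibility is a local property, so no countable cover has to be chosen by hand.\<close>
  have "negligible {x \<in> \<Omega>. f x \<noteq> u x}"
  proof (rule locally_negligible_alt[THEN iffD2], rule ballI)
    fix x assume "x \<in> {x \<in> \<Omega>. f x \<noteq> u x}"
    then have x: "x \<in> \<Omega>" by simp
    obtain r where r: "r > 0" "AE y in lborel. y \<in> cube x r \<longrightarrow> f y = u y" using local[OF x] by blast
    show "\<exists>U. openin (top_of_set {x \<in> \<Omega>. f x \<noteq> u x}) U \<and> x \<in> U \<and> negligible U"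
    proof (intro exI conjI)
      show "openin (top_of_set {x \<in> \<Omega>. f x \<noteq> u x}) ({x \<in> \<Omega>. f x \<noteq> u x} \<inter> cube x r)"
        by (rule openin_open_Int[OF open_cube])
      show "x \<in> {x \<in> \<Omega>. f x \<noteq> u x} \<inter> cube x r" using \<open>x \<in> {x \<in> \<Omega>. f x \<noteq> u x}\<close> center_in_cube[OF r(1)] by blast
      obtain N where N: "N \<in> null_sets lborel" "{y. \<not> (y \<in> cube x r \<longrightarrow> f y = u y)} \<subseteq> N"
        using r(2) by (auto simp: eventually_ae_filter)
      have "negligible N" using N(1) by (simp add: negligible_iff_null_sets null_sets_completionI)
      then show "negligible ({x \<in> \<Omega>. f x \<noteq> u x} \<inter> cube x r)"
        by (rule negligible_subset) (use N(2) in blast)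
    qed
  qed
  then have "AE x in lebesgue. x \<notin> {x \<in> \<Omega>. f x \<noteq> u x}"
    by (intro AE_not_in) (simp add: negligible_iff_null_sets)
  then have "AE x in lborel. x \<notin> {x \<in> \<Omega>. f x \<noteq> u x}" by (simp only: AE_completion_iff)
  with f(2) have "AE x in lborel. x \<in> \<Omega> \<longrightarrow> \<mu> x = u x" by eventually_elim auto
  moreover have "parallel_section \<Omega> B u" using local by (auto simp: parallel_section_def)
  ultimately show ?thesis using that by blast
qed

end

section \<open>Dimensions\<close>

text \<open>Bridges the indexed families of \<open>null_space_dim\<close> and the sets behind
  \<open>dim\<close>. Injectivity of the family must come out of independence, since a repeated
  vector would lower the cardinality.\<close>

lemma dim_eq_family_length:
  fixes v :: "nat \<Rightarrow> 'a::euclidean_space"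
  assumes ind: "\<And>c. (\<Sum>l<k. c l *\<^sub>R v l) = 0 \<Longrightarrow> \<forall>l<k. c l = 0"
    and mem: "\<And>l. l < k \<Longrightarrow> v l \<in> E" and sp: "\<And>w. w \<in> E \<Longrightarrow> \<exists>c. w = (\<Sum>l<k. c l *\<^sub>R v l)"
  shows "dim E = k"
proof (rule dim_unique)
  have inj: "inj_on v {..<k}"
  proof (rule inj_onI, rule ccontr)
    fix i j assume ij: "i \<in> {..<k}" "j \<in> {..<k}" "v i = v j" "i \<noteq> j"
    define c where "c l = (if l = i then 1 else 0) - (if l = j then 1 else 0::real)" for l
    have "(\<Sum>l<k. c l *\<^sub>R v l) = (\<Sum>l<k. if l = i then v l else 0) - (\<Sum>l<k. if l = j then v l else 0)"
      unfolding sum_subtractf[symmetric] by (intro sum.cong) (auto simp: c_def)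
    also have "\<dots> = 0" using ij by simp
    finally have "c i = 0" using ind[of c] ij by blast
    then show False using ij by (simp add: c_def)
  qed
  show "v ` {..<k} \<subseteq> E" using mem by auto
  show "E \<subseteq> span (v ` {..<k})"
  proof
    fix w assume "w \<in> E"
    then obtain c where w: "w = (\<Sum>l<k. c l *\<^sub>R v l)" using sp by blast
    show "w \<in> span (v ` {..<k})" unfolding w by (intro span_sum span_scale span_base imageI)
  qed
  show "independent (v ` {..<k})"
  proof (rule independent_if_scalars_zero)
    fix f x assume "(\<Sum>x\<in>v ` {..<k}. f x *\<^sub>R x) = 0" and x: "x \<in> v ` {..<k}"
    then have "(\<Sum>l<k. f (v l) *\<^sub>R v l) = 0" by (simp add: sum.reindex[OF inj])
    from ind[OF this] show "f x = 0" using x by auto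
  qed simp
  show "card (v ` {..<k}) = k" by (simp add: card_image[OF inj])
qed

lemma basis_family_exists:
  fixes E :: "'a::euclidean_space set"
  assumes "dim E = k"
  obtains v where "\<And>l. l < k \<Longrightarrow> v l \<in> E" "\<And>c. (\<Sum>l<k. c l *\<^sub>R v l) = 0 \<Longrightarrow> \<forall>l<k. c l = (0::real)"
    "\<And>w. w \<in> E \<Longrightarrow> \<exists>c. w = (\<Sum>l<k. c l *\<^sub>R v l)"
proof -
  obtain S where S: "S \<subseteq> E" "independent S" "E \<subseteq> span S" "card S = k"
    using basis_exists[of E] assms by metis
  have fin: "finite S" using S(2) by (rule independent_imp_finite)
  obtain v where v: "bij_betw v {..<k} S"
    using ex_bij_betw_nat_finite[OF fin] S(4) by (auto simp: atLeast0LessThan)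
  have sum_eq: "(\<Sum>l<k. c l *\<^sub>R v l) = (\<Sum>x\<in>S. c (inv_into {..<k} v x) *\<^sub>R x)" for c :: "nat \<Rightarrow> real"
    unfolding sum.reindex_bij_betw[OF v, symmetric]
    by (intro sum.cong refl) (use v in \<open>auto simp: bij_betw_def inv_into_f_f\<close>)
  show ?thesis
  proof
    show "v l \<in> E" if "l < k" for l using v S(1) that by (auto simp: bij_betw_def)
    show "\<forall>l<k. c l = 0" if c: "(\<Sum>l<k. c l *\<^sub>R v l) = 0" for c :: "nat \<Rightarrow> real"
    proof (intro allI impI)
      fix l assume l: "l < k"
      then have "v l \<in> S" using v by (auto simp: bij_betw_def)
      with independentD[OF S(2) fin subset_refl, of "\<lambda>x. c (inv_into {..<k} v x)" "v l"] c
      have "c (inv_into {..<k} v (v l)) = 0" by (simp add: sum_eq)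
      then show "c l = 0" using v l by (simp add: bij_betw_def inv_into_f_f)
    qed
    show "\<exists>c. w = (\<Sum>l<k. c l *\<^sub>R v l)" if "w \<in> E" for w
    proof -
      have "w \<in> span S" using S(3) that by blast
      then obtain q where "w = (\<Sum>x\<in>S. q x *\<^sub>R x)" using span_finite[OF fin] by auto
      also have "\<dots> = (\<Sum>l<k. q (v l) *\<^sub>R v l)" by (rule sum.reindex_bij_betw[OF v, symmetric])
      finally show ?thesis by (rule exI[of _ "\<lambda>l. q (v l)"])
    qed
  qed
qed

section \<open>Transfer of bases between the null space and E_x\<close>

context bounded_connection
begin

lemma parallel_section_zero: "parallel_section \<Omega> B (\<lambda>_. 0)"
  by (simp add: parallel_section_def)

lemma parallel_section_sum:
  assumes "\<And>l. l < k \<Longrightarrow> parallel_section \<Omega> B (u l)"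
  shows "parallel_section \<Omega> B (\<lambda>x. \<Sum>l<k. c l *\<^sub>R u l x)"
  unfolding parallel_section_def
proof
  fix x assume x: "x \<in> \<Omega>"
  have "((\<lambda>x. \<Sum>l<k. c l *\<^sub>R u l x) has_derivative (\<lambda>h. \<Sum>l<k. c l *\<^sub>R (- contr (B x) h (u l x)))) (at x)"
    using assms x by (intro has_derivative_sum has_derivative_scaleR_right) (auto simp: parallel_section_def)
  moreover have "(\<Sum>l<k. c l *\<^sub>R (- contr (B x) h (u l x))) = - contr (B x) h (\<Sum>l<k. c l *\<^sub>R u l x)" for h
    by (simp add: linear_sum[OF linear_contr(1)] contr_scaleR sum_negf)
  ultimately show "((\<lambda>x. \<Sum>l<k. c l *\<^sub>R u l x) has_derivative (\<lambda>h. - contr (B x) h (\<Sum>l<k. c l *\<^sub>R u l x))) (at x)"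
    by simp
qed

text \<open>A nonempty open set is not negligible, so the sections agree at some point of the
  domain, and transport spreads the equality to all of it.\<close>

lemma parallel_section_AE_eq:
  assumes u: "parallel_section \<Omega> B u" and w: "parallel_section \<Omega> B w"
    and ae: "AE x in lebesgue. x \<in> \<Omega> \<longrightarrow> u x = w x" and y: "y \<in> \<Omega>"
  shows "u y = w y"
proof -
  have "\<exists>x\<in>\<Omega>. u x = w x"
  proof (rule ccontr)
    assume "\<not> (\<exists>x\<in>\<Omega>. u x = w x)"
    then have "AE x in lebesgue. x \<notin> \<Omega>" using ae by (auto elim!: eventually_mono)
    then have "negligible \<Omega>" using sets_leb by (simp add: AE_iff_null_sets negligible_iff_null_sets)
    then show False using open_not_negligible[OF op ne] by simp
  qed
  then show ?thesis using parallel_section_eq[OF u w _ _ y] by blast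
qed

text \<open>Evaluation at x maps the parallel representatives of a basis of the null space to a
  basis of E_x: a linear relation at x propagates over the domain, and every vector of E_x extends
  to a section.\<close>

lemma null_space_dim_imp_dim_E_space:
  assumes k: "null_space_dim \<Omega> B k" and x: "x \<in> \<Omega>"
  shows "dim (E_space \<Omega> B x) = k"
proof -
  obtain \<mu>s where len: "length \<mu>s = k" and \<mu>s: "\<forall>\<mu>\<in>set \<mu>s. in_null_space \<Omega> B \<mu>"
    and ind: "\<And>c. (AE x in lebesgue. x \<in> \<Omega> \<longrightarrow> (\<Sum>l<k. c l *\<^sub>R (\<mu>s ! l) x) = 0) \<Longrightarrow> \<forall>l<k. c l = (0::real)"
    and sp: "\<And>\<mu>. in_null_space \<Omega> B \<mu> \<Longrightarrow>
           \<exists>c. AE x in lebesgue. x \<in> \<Omega> \<longrightarrow> \<mu> x = (\<Sum>l<k. c l *\<^sub>R (\<mu>s ! l) x)"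
    using k unfolding null_space_dim_def by blast
  have "\<forall>l\<in>{..<k}. \<exists>u. parallel_section \<Omega> B u \<and> (AE x in lebesgue. x \<in> \<Omega> \<longrightarrow> (\<mu>s ! l) x = u x)"
  proof
    fix l assume "l \<in> {..<k}"
    then have "in_null_space \<Omega> B (\<mu>s ! l)" using \<mu>s len by simp
    then obtain u where "parallel_section \<Omega> B u" "AE x in lborel. x \<in> \<Omega> \<longrightarrow> (\<mu>s ! l) x = u x"
      using null_space_parallel_section by blast
    then show "\<exists>u. parallel_section \<Omega> B u \<and> (AE x in lebesgue. x \<in> \<Omega> \<longrightarrow> (\<mu>s ! l) x = u x)"
      using AE_completion by blast
  qed
  from bchoice[OF this] obtain u where u: "\<And>l. l < k \<Longrightarrow> parallel_section \<Omega> B (u l)"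
    and ae: "\<And>l. l < k \<Longrightarrow> AE x in lebesgue. x \<in> \<Omega> \<longrightarrow> (\<mu>s ! l) x = u l x" by auto
  have "AE x in lebesgue. \<forall>l\<in>{..<k}. x \<in> \<Omega> \<longrightarrow> (\<mu>s ! l) x = u l x"
    by (rule AE_finite_allI) (use ae in auto)
  then have sum_ae: "AE x in lebesgue. x \<in> \<Omega> \<longrightarrow> (\<Sum>l<k. c l *\<^sub>R (\<mu>s ! l) x) = (\<Sum>l<k. c l *\<^sub>R u l x)" for c :: "nat \<Rightarrow> real"
    by eventually_elim (auto intro!: sum.cong)
  show ?thesis
  proof (rule dim_eq_family_length[where v="\<lambda>l. u l x"])
    fix c :: "nat \<Rightarrow> real" assume c: "(\<Sum>l<k. c l *\<^sub>R u l x) = 0"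
    have "(\<Sum>l<k. c l *\<^sub>R u l y) = 0" if "y \<in> \<Omega>" for y
      using parallel_section_eq[OF parallel_section_sum[where k=k and u=u and c=c, OF u] parallel_section_zero x _ that] c by simp
    then have "AE x in lebesgue. x \<in> \<Omega> \<longrightarrow> (\<Sum>l<k. c l *\<^sub>R (\<mu>s ! l) x) = 0"
      using sum_ae[of c] by (auto elim!: eventually_mono)
    then show "\<forall>l<k. c l = 0" by (rule ind)
  next
    show "u l x \<in> E_space \<Omega> B x" if "l < k" for l by (rule parallel_section_in_E_space[OF u[OF that]])
  next
    fix w assume "w \<in> E_space \<Omega> B x"
    then obtain q where q: "parallel_section \<Omega> B q" "q x = w" using E_space_section[OF x] by blast
    obtain c where "AE x in lebesgue. x \<in> \<Omega> \<longrightarrow> q x = (\<Sum>l<k. c l *\<^sub>R (\<mu>s ! l) x)"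
      using sp[OF parallel_section_in_null_space[OF q(1)]] by blast
    then have "AE x in lebesgue. x \<in> \<Omega> \<longrightarrow> q x = (\<Sum>l<k. c l *\<^sub>R u l x)"
      using sum_ae[of c] by eventually_elim auto
    from parallel_section_AE_eq[OF q(1) parallel_section_sum[OF u] this x]
    show "\<exists>c. w = (\<Sum>l<k. c l *\<^sub>R u l x)" using q(2) by auto
  qed
qed

text \<open>One point x suffices: sections extending a basis of E_x span the null space, as any
  section is determined by its value at x.\<close>

lemma dim_E_space_imp_null_space_dim:
  assumes x: "x \<in> \<Omega>" and k: "dim (E_space \<Omega> B x) = k"
  shows "null_space_dim \<Omega> B k"
proof -
  obtain v where v: "\<And>l. l < k \<Longrightarrow> v l \<in> E_space \<Omega> B x"
    and ind: "\<And>c. (\<Sum>l<k. c l *\<^sub>R v l) = 0 \<Longrightarrow> \<forall>l<k. c l = (0::real)"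
    and sp: "\<And>w. w \<in> E_space \<Omega> B x \<Longrightarrow> \<exists>c. w = (\<Sum>l<k. c l *\<^sub>R v l)"
    using basis_family_exists[OF k] by blast
  have "\<forall>l\<in>{..<k}. \<exists>u. parallel_section \<Omega> B u \<and> u x = v l"
    using E_space_section[OF x v] by (metis lessThan_iff)
  from bchoice[OF this] obtain u where u: "\<And>l. l < k \<Longrightarrow> parallel_section \<Omega> B (u l)"
    and ux: "\<And>l. l < k \<Longrightarrow> u l x = v l" by auto
  have nth: "(\<Sum>l<k. c l *\<^sub>R (map u [0..<k] ! l) y) = (\<Sum>l<k. c l *\<^sub>R u l y)" for c :: "nat \<Rightarrow> real" and y
    by (intro sum.cong) auto
  have sx: "(\<Sum>l<k. c l *\<^sub>R u l x) = (\<Sum>l<k. c l *\<^sub>R v l)" for c :: "nat \<Rightarrow> real"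
    by (intro sum.cong) (auto simp: ux)
  show ?thesis
    unfolding null_space_dim_def
  proof (intro exI[of _ "map u [0..<k]"] conjI ballI allI impI)
    show "length (map u [0..<k]) = k" by simp
    show "in_null_space \<Omega> B \<mu>" if "\<mu> \<in> set (map u [0..<k])" for \<mu>
      using that u parallel_section_in_null_space by auto
  next
    fix c :: "nat \<Rightarrow> real" and l
    assume "AE x in lebesgue. x \<in> \<Omega> \<longrightarrow> (\<Sum>l<k. c l *\<^sub>R (map u [0..<k] ! l) x) = 0" and l: "l < k"
    then have "AE x in lebesgue. x \<in> \<Omega> \<longrightarrow> (\<Sum>l<k. c l *\<^sub>R u l x) = 0" unfolding nth by simp
    from parallel_section_AE_eq[OF parallel_section_sum[OF u] parallel_section_zero this x]
    have "(\<Sum>l<k. c l *\<^sub>R v l) = 0" by (simp add: sx)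
    then show "c l = 0" using ind l by blast
  next
    fix \<mu> assume "in_null_space \<Omega> B \<mu>"
    then obtain q where q: "parallel_section \<Omega> B q" "AE x in lborel. x \<in> \<Omega> \<longrightarrow> \<mu> x = q x"
      using null_space_parallel_section by blast
    obtain c where c: "q x = (\<Sum>l<k. c l *\<^sub>R v l)" using sp[OF parallel_section_in_E_space[OF q(1)]] by blast
    have "q y = (\<Sum>l<k. c l *\<^sub>R u l y)" if "y \<in> \<Omega>" for y
      using parallel_section_eq[OF q(1) parallel_section_sum[where k=k and u=u and c=c, OF u] x _ that] c by (simp add: sx)
    then have "AE x in lebesgue. x \<in> \<Omega> \<longrightarrow> \<mu> x = (\<Sum>l<k. c l *\<^sub>R (map u [0..<k] ! l) x)"
      unfolding nth using AE_completion[OF q(2)] by (auto elim!: eventually_mono)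
    then show "\<exists>c. AE x in lebesgue. x \<in> \<Omega> \<longrightarrow> \<mu> x = (\<Sum>l<k. c l *\<^sub>R (map u [0..<k] ! l) x)" by blast
  qed
qed

end

theorem theorem4p1:
  fixes \<Omega> :: "(real^'d::finite) set"
    and B :: "real^'d \<Rightarrow> real^'n^'d^'n::finite"
    and k :: nat
  assumes "CARD('d) \<ge> 2"
    and "\<Omega> \<noteq> {}" and "bounded \<Omega>" and "connected \<Omega>" and "open \<Omega>" and "smooth_boundary \<Omega>"
    and "continuous_on (closure \<Omega>) B"
    and "k \<le> CARD('n)"
  shows "null_space_dim \<Omega> B k \<longleftrightarrow> k_conservative \<Omega> B k"
proof -
  define Kc where "Kc = real CARD('n) * (real CARD('d) * real CARD('n))"
  \<comment> \<open>Continuity up to the boundary gives one bound for B on the whole domain, and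
    with it the uniform constant of \<open>connection\<close>.\<close>
  have "bounded (B ` closure \<Omega>)"
    using assms by (intro compact_imp_bounded compact_continuous_image) auto
  then have "\<exists>b. \<forall>x\<in>closure \<Omega>. norm (B x) \<le> b" by (simp add: bounded_iff)
  then obtain b where b: "\<And>x. x \<in> \<Omega> \<Longrightarrow> norm (B x) \<le> b" using closure_subset by blast
  obtain x0 where x0: "x0 \<in> \<Omega>" using assms by blast
  have b0: "0 \<le> b" using b[OF x0] norm_ge_zero order_trans by blast
  interpret bounded_connection \<Omega> B "Kc * b"
  proof
    show "continuous_on \<Omega> B" using assms(7) closure_subset continuous_on_subset by blast
    show "norm (contr (B x) h v) \<le> Kc * b * norm h * norm v" if "x \<in> \<Omega>" for x h v
    proof -
      have "norm (contr (B x) h v) \<le> Kc * norm (B x) * norm h * norm v"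
        using norm_contr_le[of "B x" h v] by (simp add: Kc_def mult_ac)
      also have "\<dots> \<le> Kc * b * norm h * norm v"
        using b[OF that] by (intro mult_right_mono mult_left_mono) (auto simp: Kc_def)
      finally show ?thesis .
    qed
    show "0 \<le> Kc * b" using b0 by (simp add: Kc_def)
  qed (use assms in auto)
  show ?thesis
    unfolding k_conservative_def
    using null_space_dim_imp_dim_E_space dim_E_space_imp_null_space_dim[OF x0] x0 by blast
qed

end
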